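(* Let $s\in(0,1)$, $p,q\in[1,\infty)$ and $f\in L^p(\mathbb{R}^n)$. Then $$|\Pi^{*,s}_{p,q}f^\star|^{-\frac{sq}{n}}\le4^q(2^n+1)^{\max\{\frac qp,1\}}\,|\Pi^{*,s}_{p,q}f|^{-\frac{sq}{n}}.$$ If $p=q$, the constant $4^p(2^n+1)$ can be replaced by $1$.
   Context: $\Delta_hf(x)=f(x+h)-f(x)$. $\Pi^{*,s}_{p,q}f$ is the star-shaped set with gauge $\|\xi\|^{sq}_{\Pi^{*,s}_{p,q}f}=\int_0^\infty t^{-sq}\|\Delta_{t\xi}f\|^q_{L^p}\frac{dt}{t}$ and volume $\frac1n\int_{\mathbb{S}^{n-1}}\|\xi\|^{-n}_{\Pi^{*,s}_{p,q}f}d\sigma(\xi)$. $f^\star(x)=\int_0^\infty\mathbf 1_{\{|f|\ge t\}^\star}(x)dt$ is the Schwarz symmetral, where $E^\star$ is the closed centered ball with $|E^\star|=|E|$. *)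

theory Defs
  imports "HOL-Analysis.Analysis"
begin

text \<open>L^p norm of a real function on a Euclidean space (Lebesgue measure).\<close>
definition Lp_norm :: "real \<Rightarrow> ('a::euclidean_space \<Rightarrow> real) \<Rightarrow> real" where
  "Lp_norm p g = (\<integral>x. \<bar>g x\<bar> powr p \<partial>lebesgue) powr (1 / p)"

text \<open>Membership in L^p(R^n).\<close>
definition in_Lp :: "real \<Rightarrow> ('a::euclidean_space \<Rightarrow> real) \<Rightarrow> bool" where
  "in_Lp p f \<longleftrightarrow> f \<in> borel_measurable lebesgue \<and> integrable lebesgue (\<lambda>x. \<bar>f x\<bar> powr p)"

text \<open>Finite difference Delta_h f (x) = f(x+h) - f(x).\<close>
definition Delta :: "'a::euclidean_space \<Rightarrow> ('a \<Rightarrow> real) \<Rightarrow> 'a \<Rightarrow> real" where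
  "Delta h f x = f (x + h) - f x"

text \<open>The s q-th power of the gauge of the polar fractional L^p Sobolev body:
  int_0^infty t^(-sq) ||Delta_(t xi) f||_p^q dt/t  (possibly infinite).\<close>
definition gauge_pow :: "real \<Rightarrow> real \<Rightarrow> real \<Rightarrow> ('a::euclidean_space \<Rightarrow> real) \<Rightarrow> 'a \<Rightarrow> ennreal" where
  "gauge_pow s p q f \<xi> =
     (\<integral>\<^sup>+ t. indicator {0<..} t *
        ennreal (t powr (- s * q) * (Lp_norm p (Delta (t *\<^sub>R \<xi>) f)) powr q / t) \<partial>lborel)"

text \<open>The star-shaped set Pi^{*,s}_{p,q} f = { xi : ||xi|| <= 1 }; since the gauge is
  nonnegative, ||xi|| <= 1 iff ||xi||^{sq} <= 1.\<close>
definition PiStar :: "real \<Rightarrow> real \<Rightarrow> real \<Rightarrow> ('a::euclidean_space \<Rightarrow> real) \<Rightarrow> 'a set" where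
  "PiStar s p q f = {\<xi>. gauge_pow s p q f \<xi> \<le> 1}"

text \<open>Its volume (Lebesgue measure, possibly infinite).\<close>
definition volPiStar :: "real \<Rightarrow> real \<Rightarrow> real \<Rightarrow> ('a::euclidean_space \<Rightarrow> real) \<Rightarrow> ennreal" where
  "volPiStar s p q f = emeasure lebesgue (PiStar s p q f)"

text \<open>x^(-a) for x in [0,infty], a > 0, with 0^(-a) = infty and infty^(-a) = 0.\<close>
definition neg_pow :: "ennreal \<Rightarrow> real \<Rightarrow> ennreal" where
  "neg_pow x a = (if x = 0 then \<infinity> else if x = \<infinity> then 0
                  else ennreal (enn2real x powr (- a)))"

text \<open>E^star: closed centred ball with the same Lebesgue measure as E
  (the whole space if |E| = infty).\<close>
definition sym_set :: "'a::euclidean_space set \<Rightarrow> 'a set" where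
  "sym_set E = (if emeasure lebesgue E = \<infinity> then UNIV
     else cball 0 (SOME r. r \<ge> 0 \<and> emeasure lebesgue (cball (0::'a) r) = emeasure lebesgue E))"

text \<open>Schwarz symmetral f^star(x) = int_0^infty 1_{{|f| >= t}^star}(x) dt
  (set to 0 where this integral is infinite, which only happens on a null set for f in L^p).\<close>
definition schwarz :: "('a::euclidean_space \<Rightarrow> real) \<Rightarrow> 'a \<Rightarrow> real" where
  "schwarz f x = enn2real (\<integral>\<^sup>+ t. indicator {0<..} t *
                     indicator (sym_set {y. \<bar>f y\<bar> \<ge> t}) x \<partial>lborel)"

end

theory Submission
  imports Defs
begin

text \<open>
  Write \<open>N f h\<close> for the \<open>p\<close>-th power of the \<open>L\<^sup>p\<close> norm of \<open>Delta h f\<close>. Slicing \<open>\<bar>a - b\<bar> powr p\<close> into indicators of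
  level sets, the Riesz rearrangement inequality for sets gives that the integral of \<open>N f\<close> over any set \<open>K\<close>
  is at least the integral of \<open>N (schwarz f)\<close> over the centred ball of the same volume.

  If \<open>q \<le> p\<close>, concavity of \<open>x powr (q / p)\<close> transfers this first to \<open>N powr (q / p)\<close> and then, by integrating over
  dilates of \<open>K\<close>, to the gauges \<open>g\<close>. Applied to \<open>K = {g \<le> 1}\<close>, homogeneity of \<open>g\<close> turns it into the
  volume inequality with constant 1.

  If \<open>q > p\<close>, Jensen's inequality bounds the integral of the gauge of \<open>f\<close> below by that of a radial gauge
  built from the averages of \<open>N (schwarz f)\<close> over centred balls. The triangle inequality bounds
  \<open>N (schwarz f) h\<close> by such an average up to the factor \<open>2 powr (p + 1) * 2 ^ n\<close>, which gives the constant.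

  The Riesz inequality is proved on the line by cutting off mass at opposite ends of two of the sets, carries
  over to Steiner symmetrization slice by slice, and reaches balls because a set that differs from its ball can be
  brought closer to it, by a definite amount, by a suitable Steiner symmetrization.
\<close>

section \<open>The triple integral on the line\<close>

text \<open>The obstacle is that symmetrization may increase \<open>N f h\<close> at a single shift
  \<open>h\<close>; only integrals over sets of shifts compare. So the argument is kept throughout
  in the form "integral over a ball against integral over any \<open>K\<close> of the same volume",
  and a sublevel set of the gauge is itself an admissible \<open>K\<close>, up to a cut to finite
  volume. For \<open>q > p\<close> the power \<open>q / p\<close> is convex and this form is not
  inherited by it. Jensen's inequality then helps only on the side of \<open>f\<close>, where it
  yields powers of averages of \<open>N (schwarz f)\<close>; the return from averages to values is
  the only place where a constant is lost. The power \<open>q / p\<close> of that loss fits under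
  the stated constant because \<open>(p + 1) * q / p \<le> 2 * q\<close> for
  \<open>1 \<le> p\<close>. In the Riesz inequality the definite gain of a single symmetrization
  lets an infimum argument stand in for the convergence of a sequence of symmetrizations.\<close>

definition triple_int :: "'a::euclidean_space set \<Rightarrow> 'a set \<Rightarrow> 'a set \<Rightarrow> ennreal" where
  "triple_int A B C =
     (\<integral>\<^sup>+x. \<integral>\<^sup>+y. indicator A x * indicator B y * indicator C (x + y) \<partial>lborel \<partial>lborel)"

lemma nn_integral_lborel_translate:
  fixes F :: "'a::euclidean_space \<Rightarrow> ennreal"
  assumes [measurable]: "F \<in> borel_measurable borel"
  shows "(\<integral>\<^sup>+x. F (a + x) \<partial>lborel) = (\<integral>\<^sup>+x. F x \<partial>lborel)"
proof -
  have "(\<integral>\<^sup>+x. F x \<partial>lborel) = (\<integral>\<^sup>+x. F x \<partial>(distr lborel borel ((+) a)))"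
    by (simp add: lborel_distr_plus)
  also have "\<dots> = (\<integral>\<^sup>+x. F (a + x) \<partial>lborel)"
    by (subst nn_integral_distr) auto
  finally show ?thesis by simp
qed

lemma triple_int_commute:
  fixes A B C :: "'a::euclidean_space set"
  assumes [measurable]: "A \<in> sets borel" "B \<in> sets borel" "C \<in> sets borel"
  shows "triple_int A B C = triple_int B A C"
  unfolding triple_int_def
  by (subst lborel_pair.Fubini') (auto simp: mult.commute add.commute)

lemma triple_int_le_mult:
  fixes A B C :: "'a::euclidean_space set"
  assumes [measurable]: "A \<in> sets borel" "B \<in> sets borel" "C \<in> sets borel"
  shows "triple_int A B C \<le> emeasure lborel A * emeasure lborel B"
proof -
  have "triple_int A B C \<le> (\<integral>\<^sup>+x. \<integral>\<^sup>+y. indicator A x * indicator B y \<partial>lborel \<partial>lborel)"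
    unfolding triple_int_def
    by (intro nn_integral_mono) (auto simp: indicator_def)
  also have "\<dots> = emeasure lborel A * emeasure lborel B"
    by (simp add: nn_integral_cmult nn_integral_multc)
  finally show ?thesis .
qed

lemma triple_int_le_mult':
  fixes A B C :: "'a::euclidean_space set"
  assumes [measurable]: "A \<in> sets borel" "B \<in> sets borel" "C \<in> sets borel"
  shows "triple_int A B C \<le> emeasure lborel A * emeasure lborel C"
proof -
  have "triple_int A B C \<le> (\<integral>\<^sup>+x. \<integral>\<^sup>+y. indicator A x * indicator C (x + y) \<partial>lborel \<partial>lborel)"
    unfolding triple_int_def
    by (intro nn_integral_mono) (auto simp: indicator_def)
  also have "\<dots> = (\<integral>\<^sup>+x. indicator A x * (\<integral>\<^sup>+y. indicator C (x + y) \<partial>lborel) \<partial>lborel)"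
    by (simp add: nn_integral_cmult)
  also have "\<dots> = emeasure lborel A * emeasure lborel C"
    by (subst nn_integral_lborel_translate) (auto simp: nn_integral_multc)
  finally show ?thesis .
qed

lemma triple_int_mono:
  assumes "A \<subseteq> A'" "B \<subseteq> B'" "C \<subseteq> C'"
  shows "triple_int A B C \<le> triple_int A' B' C'"
  unfolding triple_int_def
  using assms by (intro nn_integral_mono) (auto simp: indicator_def)

lemma triple_int_Un:
  fixes A B C :: "'a::euclidean_space set"
  assumes [measurable]: "A \<in> sets borel" "A' \<in> sets borel" "B \<in> sets borel" "C \<in> sets borel"
    and "A \<inter> A' = {}"
  shows "triple_int (A \<union> A') B C = triple_int A B C + triple_int A' B C"
proof -
  have "indicator (A \<union> A') x * indicator B y * indicator C (x + y)
     = indicator A x * indicator B y * indicator C (x + y)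
       + (indicator A' x * indicator B y * indicator C (x + y) :: ennreal)" for x y
    using assms(5) by (auto simp: indicator_def)
  then show ?thesis
    unfolding triple_int_def by (simp add: nn_integral_add)
qed

text \<open>Intermediate value theorem for the distribution function \<open>F\<close> of
  \<open>A\<close>, which is 1-Lipschitz. The values 0 and \<open>measure lborel A\<close> are
  treated apart, since \<open>F\<close> may reach them only in the limit.\<close>

lemma real_lower_cut:
  fixes A :: "real set"
  assumes A: "A \<in> fmeasurable lborel" and \<tau>: "0 \<le> \<tau>" "\<tau> \<le> measure lborel A"
  obtains A' where "A' \<subseteq> A" "A' \<in> fmeasurable lborel" "measure lborel A' = \<tau>"
    "\<And>x s. x \<in> A' \<Longrightarrow> s \<in> A - A' \<Longrightarrow> x \<le> s"
proof -
  consider "\<tau> = 0" | "\<tau> = measure lborel A" | "0 < \<tau>" "\<tau> < measure lborel A"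
    using \<tau> by linarith
  then show thesis
  proof cases
    case 1
    then show ?thesis by (intro that[of "{}"]) auto
  next
    case 2
    then show ?thesis using A by (intro that[of A]) auto
  next
    case 3
    define F where "F = (\<lambda>x. measure lborel (A \<inter> {..x}))"
    have fm: "A \<inter> S \<in> fmeasurable lborel" if "S \<in> sets borel" for S
      using A that by (simp add: fmeasurable_Int_fmeasurable)
    have bs: "A \<inter> S \<in> sets borel" if "S \<in> sets borel" for S
      using fmeasurableD[OF fm[OF that]] by simp
    have mono: "F x \<le> F y" if "x \<le> y" for x y
      unfolding F_def by (rule measure_mono_fmeasurable) (use that fm bs in auto)
    have Lip: "F y - F x \<le> y - x" if "x \<le> y" for x y
    proof -
      have f2: "{x<..y} \<in> fmeasurable lborel" by (cases "x \<le> y") (auto simp: fmeasurable_def)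
      have "F y \<le> measure lborel (A \<inter> {..x} \<union> {x<..y})"
        unfolding F_def by (rule measure_mono_fmeasurable) (use fm bs f2 in \<open>auto intro!: fmeasurable.Un\<close>)
      also have "\<dots> \<le> F x + measure lborel {x<..y}"
        unfolding F_def using bs by (intro measure_Un_le) auto
      finally show ?thesis using that by simp
    qed
    have "1-lipschitz_on UNIV F"
    proof (rule lipschitz_onI)
      fix x y :: real
      show "dist (F x) (F y) \<le> 1 * dist x y"
        using mono[of x y] mono[of y x] Lip[of x y] Lip[of y x]
        by (cases "x \<le> y") (auto simp: dist_real_def)
    qed simp
    then have cont: "continuous_on S F" for S
      by (meson continuous_on_subset lipschitz_on_continuous_on subset_UNIV)
    have UA: "(\<Union>n. A \<inter> {..real n}) = A"
      by (auto simp: real_arch_simple)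
    have "(\<lambda>n. measure lborel (A \<inter> {..real n})) \<longlonglongrightarrow> measure lborel (\<Union>n. A \<inter> {..real n})"
    proof (rule Lim_measure_incseq[where A = "\<lambda>n. A \<inter> {..real n}"])
      show "emeasure lborel (\<Union>n. A \<inter> {..real n}) \<noteq> \<infinity>"
        unfolding UA using A by (auto simp: fmeasurable_def)
    qed (auto simp: incseq_def bs image_subset_iff)
    also note UA
    finally have "\<forall>\<^sub>F n in sequentially. \<tau> < F (real n)"
      using 3(2) unfolding F_def by (rule order_tendstoD(1))
    then obtain m where m: "\<tau> < F (real m)"
      by (auto simp: eventually_sequentially)
    have "(\<lambda>n. measure lborel (A \<inter> {..- real n})) \<longlonglongrightarrow> measure lborel (\<Inter>n. A \<inter> {..- real n})"
      using fm[of "{..- real i}" for i] by (intro Lim_measure_decseq)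
        (auto simp: decseq_def bs image_subset_iff fmeasurable_def top.not_eq_extremum)
    also have "(\<Inter>n. A \<inter> {..- real n}) = {}"
    proof -
      have "\<exists>n. \<not> x \<le> - real n" for x
      proof -
        obtain n where "- x < real n" using reals_Archimedean2 by blast
        then show ?thesis by (intro exI[of _ n]) linarith
      qed
      then show ?thesis by auto
    qed
    finally have "\<forall>\<^sub>F n in sequentially. F (- real n) < \<tau>"
      using 3(1) unfolding F_def by (intro order_tendstoD(2)) auto
    then obtain k where k: "F (- real k) < \<tau>"
      by (auto simp: eventually_sequentially)
    obtain \<alpha> where "F \<alpha> = \<tau>"
      using IVT'[of F "- real k" \<tau> "real m"] m k cont by auto
    then show ?thesis
      using fm by (intro that[of "A \<inter> {..\<alpha>}"]) (auto simp: F_def)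
  qed
qed

text \<open>Remove mass \<open>d\<close> from the top of \<open>A\<close> and from the bottom of \<open>B\<close>. For removed points \<open>s\<close> and \<open>t\<close> the
  translates \<open>s + B'\<close> and \<open>t + A'\<close> meet only in \<open>s + t\<close>, so together they cover at most \<open>|C|\<close> of \<open>C\<close>.\<close>

lemma triple_int_cut_step:
  fixes A B C :: "real set"
  assumes A: "A \<in> fmeasurable lborel" and B: "B \<in> fmeasurable lborel" and C: "C \<in> fmeasurable lborel"
    and e: "0 < d" "d \<le> measure lborel A" "d \<le> measure lborel B"
  obtains A' B' where "A' \<in> fmeasurable lborel" "B' \<in> fmeasurable lborel"
    "measure lborel A' = measure lborel A - d" "measure lborel B' = measure lborel B - d"
    "triple_int A B C \<le> triple_int A' B' C
       + ennreal (d * min (measure lborel C) (measure lborel A + measure lborel B - 2 * d))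
       + ennreal (d\<^sup>2)"
proof -
  obtain A' where A': "A' \<subseteq> A" "A' \<in> fmeasurable lborel" "measure lborel A' = measure lborel A - d"
    and ordA: "\<And>x s. x \<in> A' \<Longrightarrow> s \<in> A - A' \<Longrightarrow> x \<le> s"
    using real_lower_cut[OF A, of "measure lborel A - d"] e by auto
  obtain B'' where B'': "B'' \<subseteq> B" "B'' \<in> fmeasurable lborel" "measure lborel B'' = d"
    and ordB: "\<And>x s. x \<in> B'' \<Longrightarrow> s \<in> B - B'' \<Longrightarrow> x \<le> s"
    using real_lower_cut[OF B, of "d"] e by auto
  define A'' where "A'' = A - A'"
  define B' where "B' = B - B''"
  have fA'': "A'' \<in> fmeasurable lborel" and fB': "B' \<in> fmeasurable lborel"
    unfolding A''_def B'_def using A B A' B'' by (auto intro: fmeasurable.Diff)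
  have mA'': "measure lborel A'' = d" and mB': "measure lborel B' = measure lborel B - d"
    unfolding A''_def B'_def
    using measurable_measure_Diff[OF A fmeasurableD[OF A'(2)] A'(1)]
      measurable_measure_Diff[OF B fmeasurableD[OF B''(2)] B''(1)] A'(3) B''(3) by auto
  note fm = A B C A'(2) B''(2) fA'' fB'
  have [measurable]: "A \<in> sets borel" "B \<in> sets borel" "C \<in> sets borel" "A' \<in> sets borel"
      "B'' \<in> sets borel" "A'' \<in> sets borel" "B' \<in> sets borel"
    using fm by (auto dest: fmeasurableD)
  have em: "emeasure lborel S = ennreal (measure lborel S)" if "S \<in> fmeasurable lborel" for S :: "real set"
    using that by (rule emeasure_eq_measure2)
  have eA: "A = A' \<union> A''" "A' \<inter> A'' = {}" and eB: "B = B' \<union> B''" "B' \<inter> B'' = {}"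
    using A' B'' unfolding A''_def B'_def by auto
  have split: "triple_int X B C = triple_int X B' C + triple_int X B'' C" if [measurable]: "X \<in> sets borel" for X
    unfolding eB(1) using eB(2) by (simp add: triple_int_commute[of X] triple_int_Un)
  have dec: "triple_int A B C = triple_int A' B' C + (triple_int A'' B' C + triple_int A' B'' C) + triple_int A'' B'' C"
  proof -
    have "triple_int A B C = triple_int A' B C + triple_int A'' B C"
      unfolding eA(1) using eA(2) by (simp add: triple_int_Un)
    then show ?thesis by (simp add: split ac_simps)
  qed
  \<comment> \<open>Two bounds for the same two translates: inside \<open>C\<close> they overlap in
    at most one point, and their total length is that of \<open>A'\<close> and \<open>B'\<close>.
    The minimum of both is what centred intervals attain.\<close>
  define m where "m = min (measure lborel C) (measure lborel A + measure lborel B - 2 * d)"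
  have m0: "0 \<le> m" unfolding m_def using e by auto
  define \<phi> :: "real \<Rightarrow> ennreal" where "\<phi> s = (\<integral>\<^sup>+y. indicator B' y * indicator C (s + y) \<partial>lborel)" for s
  define \<psi> :: "real \<Rightarrow> ennreal" where "\<psi> t = (\<integral>\<^sup>+x. indicator A' x * indicator C (t + x) \<partial>lborel)" for t
  have [measurable]: "\<phi> \<in> borel_measurable borel" "\<psi> \<in> borel_measurable borel"
    unfolding \<phi>_def \<psi>_def by measurable
  have key: "\<phi> s + \<psi> t \<le> ennreal m" if s: "s \<in> A''" and t: "t \<in> B''" for s t
  proof -
    have "\<phi> s = (\<integral>\<^sup>+y. indicator B' (- s + (s + y)) * indicator C (s + y) \<partial>lborel)"
      unfolding \<phi>_def by simp
    also have "\<dots> = (\<integral>\<^sup>+z. indicator B' (- s + z) * indicator C z \<partial>lborel)"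
      by (rule nn_integral_lborel_translate) measurable
    finally have 1: "\<phi> s = \<dots>" .
    have "\<psi> t = (\<integral>\<^sup>+y. indicator A' (- t + (t + y)) * indicator C (t + y) \<partial>lborel)"
      unfolding \<psi>_def by simp
    also have "\<dots> = (\<integral>\<^sup>+z. indicator A' (- t + z) * indicator C z \<partial>lborel)"
      by (rule nn_integral_lborel_translate) measurable
    finally have 2: "\<psi> t = \<dots>" .
    have "\<phi> s + \<psi> t = (\<integral>\<^sup>+z. indicator B' (- s + z) * indicator C z + indicator A' (- t + z) * indicator C z \<partial>lborel)"
      unfolding 1 2 by (rule nn_integral_add[symmetric]) measurable
    also have "\<dots> \<le> (\<integral>\<^sup>+z. indicator C z \<partial>lborel)"
    proof (rule nn_integral_mono_AE)
      have "AE z in lborel. z \<noteq> s + t" by (rule AE_lborel_singleton)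
      then show "AE z in lborel. indicator B' (- s + z) * indicator C z + indicator A' (- t + z) * indicator C z \<le> (indicator C z :: ennreal)"
      proof (eventually_elim)
        case (elim z)
        have "\<not> (- s + z \<in> B' \<and> - t + z \<in> A')"
          using ordA[of "- t + z" s] ordB[of t "- s + z"] s t elim unfolding A''_def B'_def by auto
        then show ?case by (auto simp: indicator_def)
      qed
    qed
    also have "\<dots> = ennreal (measure lborel C)" using C by (simp add: em)
    finally have 3: "\<phi> s + \<psi> t \<le> ennreal (measure lborel C)" .
    have "\<phi> s \<le> (\<integral>\<^sup>+y. indicator B' y \<partial>lborel)" "\<psi> t \<le> (\<integral>\<^sup>+y. indicator A' y \<partial>lborel)"
      unfolding \<phi>_def \<psi>_def by (auto intro!: nn_integral_mono simp: indicator_def)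
    then have "\<phi> s + \<psi> t \<le> ennreal (measure lborel B - d) + ennreal (measure lborel A - d)"
      using A' fB' by (intro add_mono) (auto simp: em mB')
    also have "\<dots> = ennreal (measure lborel A + measure lborel B - 2 * d)"
      using e by (simp flip: ennreal_plus)
    finally show ?thesis using 3 by (auto simp: m_def min_def)
  qed
  \<comment> \<open>The bound \<open>\<phi> s + \<psi> t \<le> m\<close> holds for every pair, and
    \<open>A''\<close> and \<open>B''\<close> have the same mass \<open>d\<close>. Splitting
    \<open>m\<close> at the supremum of \<open>\<psi>\<close> therefore bounds the two integrals
    together by \<open>d * m\<close>, without pairing points of \<open>A''\<close> with points of
    \<open>B''\<close>.\<close>
  define \<Psi> where "\<Psi> = (SUP t\<in>B''. \<psi> t)"
  have neA: "A'' \<noteq> {}" using mA'' e by auto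
  have neB: "B'' \<noteq> {}" using B'' e by auto
  have kPsi: "\<phi> s + \<Psi> \<le> ennreal m" if "s \<in> A''" for s
    unfolding \<Psi>_def using neB key[OF that]
    by (subst ennreal_SUP_add_right) (auto intro!: SUP_least)
  have Pm: "\<Psi> \<le> ennreal m" using kPsi neA 
    by (metis (no_types, lifting) add_increasing ex_in_conv order.refl order.trans zero_le)
  have "triple_int A'' B' C = (\<integral>\<^sup>+x. indicator A'' x * \<phi> x \<partial>lborel)"
    unfolding triple_int_def \<phi>_def by (simp add: mult.assoc nn_integral_cmult)
  also have "\<dots> \<le> (\<integral>\<^sup>+x. indicator A'' x * (ennreal m - \<Psi>) \<partial>lborel)"
    using kPsi Pm by (intro nn_integral_mono)
      (auto simp: indicator_def ennreal_le_minus_iff)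
  also have "\<dots> = ennreal d * (ennreal m - \<Psi>)"
    using fA'' by (simp add: nn_integral_multc em mA'')
  finally have i1: "triple_int A'' B' C \<le> ennreal d * (ennreal m - \<Psi>)" .
  have "triple_int A' B'' C = (\<integral>\<^sup>+x. indicator B'' x * \<psi> x \<partial>lborel)"
    unfolding triple_int_commute[of A' B'' C, simplified]
    unfolding triple_int_def \<psi>_def by (simp add: mult.assoc nn_integral_cmult)
  also have "\<dots> \<le> (\<integral>\<^sup>+x. indicator B'' x * \<Psi> \<partial>lborel)"
    by (intro nn_integral_mono) (auto simp: indicator_def \<Psi>_def intro: SUP_upper)
  also have "\<dots> = ennreal d * \<Psi>"
    using B'' by (simp add: nn_integral_multc em)
  finally have i2: "triple_int A' B'' C \<le> ennreal d * \<Psi>" .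
  have "triple_int A'' B' C + triple_int A' B'' C \<le> ennreal d * ((ennreal m - \<Psi>) + \<Psi>)"
    using add_mono[OF i1 i2] by (simp add: distrib_left)
  also have "\<dots> = ennreal (d * m)"
    using Pm e m0 by (simp add: diff_add_cancel_ennreal ennreal_mult)
  finally have i3: "triple_int A'' B' C + triple_int A' B'' C \<le> ennreal (d * m)" .
  \<comment> \<open>The corner piece is of second order in \<open>d\<close>, so the trivial bound is
    enough.\<close>
  have "triple_int A'' B'' C \<le> ennreal d * ennreal d"
    using triple_int_le_mult[of A'' B'' C] by (simp add: em fA'' B'' mA'')
  also have "\<dots> = ennreal (d\<^sup>2)" using e by (simp add: power2_eq_square flip: ennreal_mult)
  finally have i4: "triple_int A'' B'' C \<le> ennreal (d\<^sup>2)" .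
  show thesis
    using A' fB' mB' i3 i4
    unfolding m_def by (intro that[of A' B'] add_mono order.refl, simp_all only: dec) (intro add_mono order.refl)
qed

text \<open>For \<open>w = a + b\<close> and \<open>m = min a b\<close> this is the triple integral of the centred intervals
  of lengths \<open>a\<close>, \<open>b\<close>, \<open>c\<close>.\<close>

definition interval_profile :: "real \<Rightarrow> real \<Rightarrow> real \<Rightarrow> ennreal" where
  "interval_profile w c m = (\<integral>\<^sup>+\<tau>. indicator {0<..<m} \<tau> * ennreal (min c (w - 2 * \<tau>)) \<partial>lborel)"

text \<open>The integrand decreases in \<open>\<tau>\<close>, so on \<open>{0<..<d}\<close> it is at
  least its value at \<open>d\<close>; the rest, shifted by \<open>d\<close>, is the profile of
  intervals shortened by \<open>d\<close>.\<close>

lemma interval_profile_step: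
  assumes "0 < d" "d \<le> m" "0 \<le> c" "2 * m \<le> w"
  shows "ennreal (d * min c (w - 2 * d)) + interval_profile (w - 2 * d) c (m - d) \<le> interval_profile w c m"
proof -
  have "interval_profile (w - 2 * d) c (m - d)
      = (\<integral>\<^sup>+\<tau>. indicator {d<..<m} (d + \<tau>) * ennreal (min c (w - 2 * (d + \<tau>))) \<partial>lborel)"
    unfolding interval_profile_def by (intro nn_integral_cong) (auto simp: indicator_def algebra_simps)
  also have "\<dots> = (\<integral>\<^sup>+\<tau>. indicator {d<..<m} \<tau> * ennreal (min c (w - 2 * \<tau>)) \<partial>lborel)"
    by (rule nn_integral_lborel_translate) measurable
  finally have 1: "interval_profile (w - 2 * d) c (m - d) = \<dots>" .
  have "ennreal (d * min c (w - 2 * d)) = (\<integral>\<^sup>+\<tau>. indicator {0<..<d} \<tau> * ennreal (min c (w - 2 * d)) \<partial>lborel)"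
    using assms by (simp add: nn_integral_multc ennreal_mult)
  then have "ennreal (d * min c (w - 2 * d)) + interval_profile (w - 2 * d) c (m - d)
     = (\<integral>\<^sup>+\<tau>. indicator {0<..<d} \<tau> * ennreal (min c (w - 2 * d))
          + indicator {d<..<m} \<tau> * ennreal (min c (w - 2 * \<tau>)) \<partial>lborel)"
    unfolding 1 by (simp add: nn_integral_add)
  also have "\<dots> \<le> interval_profile w c m"
    unfolding interval_profile_def using assms by (intro nn_integral_mono) (auto simp: indicator_def intro!: ennreal_leI)
  finally show ?thesis .
qed

text \<open>Each cut takes \<open>d\<close> from both measures, so \<open>k\<close> cuts exhaust the
  smaller set. The main terms collected on the way form a lower Riemann sum of the profile, and the
  corner pieces add up to the error term.\<close>

lemma triple_int_le_interval_profile_approx: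
  fixes A B C :: "real set"
  assumes "A \<in> fmeasurable lborel" "B \<in> fmeasurable lborel" "C \<in> fmeasurable lborel"
    and "0 < d" "min (measure lborel A) (measure lborel B) = real k * d"
  shows "triple_int A B C \<le> interval_profile (measure lborel A + measure lborel B) (measure lborel C) (real k * d)
            + ennreal (real k * d\<^sup>2)"
  using assms(1,2,5)
proof (induction k arbitrary: A B)
  case 0
  have "emeasure lborel A * emeasure lborel B = 0"
    using 0 by (auto simp: emeasure_eq_measure2 min_def split: if_splits)
  then have "triple_int A B C = 0"
    using triple_int_le_mult[of A B C] fmeasurableD[OF 0(1)] fmeasurableD[OF 0(2)] fmeasurableD[OF assms(3)] by auto
  then show ?case by simp
next
  case (Suc k)
  have kn: "0 \<le> real k * d" using assms by simp
  have e2: "d \<le> measure lborel A" "d \<le> measure lborel B"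
    using Suc.prems(3) kn by (auto simp: algebra_simps min_def split: if_splits)
  from triple_int_cut_step[OF Suc.prems(1,2) assms(3,4) e2]
  obtain A' B' where s: "A' \<in> fmeasurable lborel" "B' \<in> fmeasurable lborel"
    "measure lborel A' = measure lborel A - d" "measure lborel B' = measure lborel B - d"
    "triple_int A B C \<le> triple_int A' B' C
       + ennreal (d * min (measure lborel C) (measure lborel A + measure lborel B - 2 * d))
       + ennreal (d\<^sup>2)" by blast
  define w where "w = measure lborel A + measure lborel B"
  have w': "measure lborel A' + measure lborel B' = w - 2 * d" unfolding w_def s by simp
  have "triple_int A' B' C \<le> interval_profile (w - 2 * d) (measure lborel C) (real k * d) + ennreal (real k * d\<^sup>2)"
    using Suc.IH[OF s(1,2)] Suc.prems(3) unfolding w' by (auto simp: s algebra_simps min_def split: if_splits)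
  moreover have "ennreal (d * min (measure lborel C) (w - 2 * d)) + interval_profile (w - 2 * d) (measure lborel C) (real (Suc k) * d - d)
      \<le> interval_profile w (measure lborel C) (real (Suc k) * d)"
    using assms Suc.prems(3) kn by (intro interval_profile_step) (auto simp: w_def algebra_simps min_def split: if_splits)
  moreover have "real (Suc k) * d - d = real k * d" by (simp add: algebra_simps)
  moreover have "ennreal (real (Suc k) * d\<^sup>2) = ennreal (real k * d\<^sup>2) + ennreal (d\<^sup>2)"
    by (simp add: algebra_simps flip: ennreal_plus)
  ultimately have "triple_int A' B' C + (ennreal (d * min (measure lborel C) (w - 2 * d)) + ennreal (d\<^sup>2))
     \<le> interval_profile (w - 2 * d) (measure lborel C) (real k * d) + ennreal (real k * d\<^sup>2)
        + (ennreal (d * min (measure lborel C) (w - 2 * d)) + ennreal (d\<^sup>2))"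
    and "(ennreal (d * min (measure lborel C) (w - 2 * d)) + interval_profile (w - 2 * d) (measure lborel C) (real k * d))
        + (ennreal (real k * d\<^sup>2) + ennreal (d\<^sup>2))
       \<le> interval_profile w (measure lborel C) (real (Suc k) * d) + ennreal (real (Suc k) * d\<^sup>2)"
    by (auto intro!: add_mono)
  then have "triple_int A' B' C + (ennreal (d * min (measure lborel C) (w - 2 * d)) + ennreal (d\<^sup>2))
     \<le> interval_profile w (measure lborel C) (real (Suc k) * d) + ennreal (real (Suc k) * d\<^sup>2)"
    by (simp only: ac_simps)
  then show ?case using s(5) unfolding w_def[symmetric] add.assoc by (rule order.trans[rotated])
qed

lemma triple_int_le_interval_profile:
  fixes A B C :: "real set"
  assumes "A \<in> fmeasurable lborel" "B \<in> fmeasurable lborel" "C \<in> fmeasurable lborel"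
  shows "triple_int A B C
    \<le> interval_profile (measure lborel A + measure lborel B) (measure lborel C) (min (measure lborel A) (measure lborel B))"
    (is "_ \<le> interval_profile ?w ?c ?m")
proof (cases "?m = 0")
  case True
  then show ?thesis
    using triple_int_le_interval_profile_approx[OF assms, of 1 0] by simp
next
  case False
  then have m: "?m > 0"
    by (metis measure_nonneg min_def order_le_less)
  show ?thesis
  proof (rule ennreal_le_epsilon)
    fix e :: real assume e: "0 < e"
    \<comment> \<open>With \<open>k\<close> cuts of size \<open>?m / k\<close> the total error is
      \<open>?m\<^sup>2 / k\<close>, which this choice pushes below \<open>e\<close>.\<close>
    obtain k :: nat where k: "?m\<^sup>2 / e < real k" using reals_Archimedean2 by blast
    have k0: "real k > 0" using k e m by (smt (verit) divide_pos_pos zero_less_power)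
    define d where "d = ?m / real k"
    have "triple_int A B C \<le> interval_profile ?w ?c (real k * d) + ennreal (real k * d\<^sup>2)"
      using k0 m by (intro triple_int_le_interval_profile_approx assms) (auto simp: d_def)
    moreover have "real k * d = ?m" using k0 by (simp add: d_def)
    moreover have "real k * d\<^sup>2 \<le> e"
    proof -
      have "real k * d\<^sup>2 = ?m\<^sup>2 / real k" using k0 by (simp add: d_def power2_eq_square)
      also have "\<dots> \<le> e" using k k0 e by (simp add: field_simps)
      finally show ?thesis .
    qed
    ultimately show "triple_int A B C \<le> interval_profile ?w ?c ?m + ennreal e"
      using add_left_mono[OF ennreal_leI, of "real k * d\<^sup>2" e "interval_profile ?w ?c ?m"] by (simp only: HOL.simp_thms) (meson order.trans)
  qed
qed

text \<open>The convolution of the indicators of \<open>I a\<close> and \<open>I b\<close> has a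
  trapezoidal graph, and cutting it horizontally exhibits it as the integral over
  \<open>\<tau>\<close> in \<open>{0<..<min a b}\<close> of the indicators of
  \<open>I (a + b - 2 * \<tau>)\<close>. Testing against \<open>I c\<close> gives the profile. The
  offsets are free because the slice of a Steiner symmetral through \<open>x\<close> is centred at
  \<open>- (x \<bullet> u)\<close> and not at 0.\<close>

lemma interval_profile_le_triple_int:
  fixes a b c \<alpha> \<beta> :: real
  assumes "0 \<le> a" "0 \<le> b" "0 \<le> c"
  shows "interval_profile (a + b) c (min a b)
    \<le> triple_int {s. 2 * \<bar>s + \<alpha>\<bar> < a} {t. 2 * \<bar>t + \<beta>\<bar> < b} {z. 2 * \<bar>z + (\<alpha> + \<beta>)\<bar> < c}"
proof -
  define I :: "real \<Rightarrow> real set" where "I l = {s. 2 * \<bar>s\<bar> < l}" for l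
  have I_eq: "I l = {- l / 2<..<l / 2}" for l unfolding I_def by auto
  have [measurable]: "I l \<in> sets borel" for l unfolding I_eq by simp
  have emI: "emeasure lborel (I l) = ennreal l" for l
    unfolding I_eq by (cases "0 \<le> l") (auto simp: ennreal_neg)
  have "triple_int {s. 2 * \<bar>s + \<alpha>\<bar> < a} {t. 2 * \<bar>t + \<beta>\<bar> < b} {z. 2 * \<bar>z + (\<alpha> + \<beta>)\<bar> < c}
    = (\<integral>\<^sup>+x. \<integral>\<^sup>+y. indicator (I a) (\<alpha> + x) * indicator (I b) (\<beta> + y) * indicator (I c) ((\<alpha> + x) + (\<beta> + y)) \<partial>lborel \<partial>lborel)"
    unfolding triple_int_def I_def by (simp add: indicator_def algebra_simps)
  also have "\<dots> = (\<integral>\<^sup>+x. \<integral>\<^sup>+y. indicator (I a) (\<alpha> + x) * indicator (I b) y * indicator (I c) ((\<alpha> + x) + y) \<partial>lborel \<partial>lborel)"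
    by (intro nn_integral_cong nn_integral_lborel_translate) measurable
  also have "\<dots> = (\<integral>\<^sup>+x. \<integral>\<^sup>+y. indicator (I a) x * indicator (I b) y * indicator (I c) (x + y) \<partial>lborel \<partial>lborel)"
    by (rule nn_integral_lborel_translate) measurable
  also have "\<dots> = (\<integral>\<^sup>+x. \<integral>\<^sup>+y. indicator (I a) x * indicator (I b) (- x + (x + y)) * indicator (I c) (x + y) \<partial>lborel \<partial>lborel)"
    by simp
  also have "\<dots> = (\<integral>\<^sup>+x. \<integral>\<^sup>+z. indicator (I a) x * indicator (I b) (- x + z) * indicator (I c) z \<partial>lborel \<partial>lborel)"
    by (intro nn_integral_cong nn_integral_lborel_translate) measurable
  also have "\<dots> = (\<integral>\<^sup>+z. \<integral>\<^sup>+x. indicator (I a) x * indicator (I b) (- x + z) * indicator (I c) z \<partial>lborel \<partial>lborel)"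
    by (rule lborel_pair.Fubini') measurable
  also have "\<dots> = (\<integral>\<^sup>+z. indicator (I c) z * (\<integral>\<^sup>+x. indicator (I a) x * indicator (I b) (- x + z) \<partial>lborel) \<partial>lborel)"
    by (intro nn_integral_cong, subst nn_integral_multc) (simp_all add: mult.commute)
  finally have T: "triple_int {s. 2 * \<bar>s + \<alpha>\<bar> < a} {t. 2 * \<bar>t + \<beta>\<bar> < b} {z. 2 * \<bar>z + (\<alpha> + \<beta>)\<bar> < c} = \<dots>" .
  have inner: "(\<integral>\<^sup>+\<tau>. indicator {0<..<min a b} \<tau> * indicator (I (a + b - 2 * \<tau>)) z \<partial>lborel)
      \<le> (\<integral>\<^sup>+x. indicator (I a) x * indicator (I b) (- x + z) \<partial>lborel)" for z
  proof -
    define M where "M = min (min a b) ((a + b) / 2 - \<bar>z\<bar>)"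
    define L where "L = {max (- a / 2) (z - b / 2)<..<min (a / 2) (z + b / 2)}"
    have "(\<integral>\<^sup>+\<tau>. indicator {0<..<min a b} \<tau> * indicator (I (a + b - 2 * \<tau>)) z \<partial>lborel)
      = (\<integral>\<^sup>+\<tau>. indicator {0<..<M} \<tau> \<partial>lborel)"
      unfolding M_def I_def by (intro nn_integral_cong) (auto simp: indicator_def field_simps)
    also have "\<dots> = ennreal M" by (cases "0 \<le> M") (auto simp: ennreal_neg)
    also have "\<dots> \<le> emeasure lborel L"
    proof (cases "0 \<le> M")
      case True
      have "M \<le> a" "M \<le> b" "M \<le> (a + b) / 2 - z" "M \<le> (a + b) / 2 + z"
        unfolding M_def by linarith+
      then have "M \<le> min (a / 2) (z + b / 2) - max (- a / 2) (z - b / 2)"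
        by (simp add: min_def max_def add_divide_distrib)
      then show ?thesis using True unfolding L_def by (subst emeasure_lborel_Ioo) (linarith, auto intro!: ennreal_leI)
    qed (simp add: ennreal_neg)
    also have "\<dots> = (\<integral>\<^sup>+x. indicator L x \<partial>lborel)" unfolding L_def by simp
    also have "\<dots> = (\<integral>\<^sup>+x. indicator (I a) x * indicator (I b) (- x + z) \<partial>lborel)"
      unfolding L_def I_eq by (intro nn_integral_cong) (auto simp: indicator_def)
    finally show ?thesis .
  qed
  have "interval_profile (a + b) c (min a b)
      = (\<integral>\<^sup>+\<tau>. indicator {0<..<min a b} \<tau> * (\<integral>\<^sup>+z. indicator (I c) z * indicator (I (a + b - 2 * \<tau>)) z \<partial>lborel) \<partial>lborel)"
    unfolding interval_profile_def
  proof (intro nn_integral_cong)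
    fix \<tau>
    have "(\<integral>\<^sup>+z. indicator (I c) z * indicator (I (a + b - 2 * \<tau>)) z \<partial>lborel)
        = (\<integral>\<^sup>+z. indicator (I (min c (a + b - 2 * \<tau>))) z \<partial>lborel)"
      unfolding I_def by (intro nn_integral_cong) (auto simp: indicator_def)
    also have "\<dots> = ennreal (min c (a + b - 2 * \<tau>))" by (simp add: emI)
    finally show "indicator {0<..<min a b} \<tau> * ennreal (min c (a + b - 2 * \<tau>)) =
      indicator {0<..<min a b} \<tau> * (\<integral>\<^sup>+z. indicator (I c) z * indicator (I (a + b - 2 * \<tau>)) z \<partial>lborel)"
      by simp
  qed
  also have "\<dots> = (\<integral>\<^sup>+\<tau>. \<integral>\<^sup>+z. indicator (I c) z * (indicator {0<..<min a b} \<tau> * indicator (I (a + b - 2 * \<tau>)) z) \<partial>lborel \<partial>lborel)"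
    by (intro nn_integral_cong) (simp add: nn_integral_cmult[symmetric] ac_simps)
  also have "\<dots> = (\<integral>\<^sup>+z. \<integral>\<^sup>+\<tau>. indicator (I c) z * (indicator {0<..<min a b} \<tau> * indicator (I (a + b - 2 * \<tau>)) z) \<partial>lborel \<partial>lborel)"
    unfolding I_def by (rule lborel_pair.Fubini') measurable
  also have "\<dots> = (\<integral>\<^sup>+z. indicator (I c) z * (\<integral>\<^sup>+\<tau>. indicator {0<..<min a b} \<tau> * indicator (I (a + b - 2 * \<tau>)) z \<partial>lborel) \<partial>lborel)"
    unfolding I_def by (intro nn_integral_cong nn_integral_cmult) measurable
  also have "\<dots> \<le> (\<integral>\<^sup>+z. indicator (I c) z * (\<integral>\<^sup>+x. indicator (I a) x * indicator (I b) (- x + z) \<partial>lborel) \<partial>lborel)"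
    by (intro nn_integral_mono mult_left_mono inner) simp
  finally show ?thesis unfolding T .
qed

lemma riesz_real:
  fixes A B C :: "real set"
  assumes "A \<in> fmeasurable lborel" "B \<in> fmeasurable lborel" "C \<in> fmeasurable lborel"
  shows "triple_int A B C \<le> triple_int {s. 2 * \<bar>s + \<alpha>\<bar> < measure lborel A}
     {t. 2 * \<bar>t + \<beta>\<bar> < measure lborel B} {z. 2 * \<bar>z + (\<alpha> + \<beta>)\<bar> < measure lborel C}"
  using triple_int_le_interval_profile[OF assms] interval_profile_le_triple_int[of "measure lborel A" "measure lborel B" "measure lborel C" \<alpha> \<beta>]
  by (auto intro: order.trans)

section \<open>Steiner symmetrization\<close>

lemma sets_borel_ball [measurable]: "ball (x::'a::euclidean_space) r \<in> sets borel"
  by simp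

text \<open>Lines parallel to \<open>u\<close> are parametrized by the slab \<open>0 \<le> x \<bullet> u < 1\<close>, which avoids choosing coordinates.\<close>

lemma nn_integral_disintegrate:
  fixes u :: "'a::euclidean_space" and F :: "'a \<Rightarrow> ennreal"
  assumes u: "norm u = 1" and [measurable]: "F \<in> borel_measurable borel"
  shows "(\<integral>\<^sup>+x. F x \<partial>lborel)
    = (\<integral>\<^sup>+x. indicator {0..<1} (x \<bullet> u) * (\<integral>\<^sup>+t. F (x + t *\<^sub>R u) \<partial>lborel) \<partial>lborel)"
proof -
  have uu: "u \<bullet> u = 1" using u by (simp add: dot_square_norm)
  define k :: "real \<Rightarrow> ennreal" where "k = indicator {0..<1}"
  have [measurable]: "k \<in> borel_measurable borel" unfolding k_def by simp
  have "(\<integral>\<^sup>+x. k (x \<bullet> u) * (\<integral>\<^sup>+t. F (x + t *\<^sub>R u) \<partial>lborel) \<partial>lborel)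
      = (\<integral>\<^sup>+x. \<integral>\<^sup>+t. k (x \<bullet> u) * F (x + t *\<^sub>R u) \<partial>lborel \<partial>lborel)"
    by (simp add: nn_integral_cmult)
  also have "\<dots> = (\<integral>\<^sup>+t. \<integral>\<^sup>+x. k (x \<bullet> u) * F (x + t *\<^sub>R u) \<partial>lborel \<partial>lborel)"
    by (rule lborel_pair.Fubini') measurable
  also have "\<dots> = (\<integral>\<^sup>+t. \<integral>\<^sup>+x. k ((t *\<^sub>R u + x) \<bullet> u - t) * F (t *\<^sub>R u + x) \<partial>lborel \<partial>lborel)"
    by (simp add: inner_add_left uu add.commute)
  also have "\<dots> = (\<integral>\<^sup>+t. \<integral>\<^sup>+x. k (x \<bullet> u - t) * F x \<partial>lborel \<partial>lborel)"
    by (intro nn_integral_cong nn_integral_lborel_translate) measurable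
  also have "\<dots> = (\<integral>\<^sup>+x. \<integral>\<^sup>+t. k (x \<bullet> u - t) * F x \<partial>lborel \<partial>lborel)"
    by (rule lborel_pair.Fubini') measurable
  also have "\<dots> = (\<integral>\<^sup>+x. (\<integral>\<^sup>+t. k (x \<bullet> u - t) \<partial>lborel) * F x \<partial>lborel)"
    by (simp add: nn_integral_multc)
  also have "\<dots> = (\<integral>\<^sup>+x. F x \<partial>lborel)"
  proof (intro nn_integral_cong)
    fix x
    have "(\<integral>\<^sup>+t. k (x \<bullet> u - t) \<partial>lborel) = (\<integral>\<^sup>+t. indicator {x \<bullet> u - 1<..x \<bullet> u} t \<partial>lborel)"
      unfolding k_def by (intro nn_integral_cong) (auto simp: indicator_def)
    also have "\<dots> = 1" by simp
    finally show "(\<integral>\<^sup>+t. k (x \<bullet> u - t) \<partial>lborel) * F x = F x" by simp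
  qed
  finally show ?thesis unfolding k_def by simp
qed

definition slice :: "'a::euclidean_space \<Rightarrow> 'a set \<Rightarrow> 'a \<Rightarrow> real set" where
  "slice u A x = {t. x + t *\<^sub>R u \<in> A}"

text \<open>No projection onto the hyperplane orthogonal to \<open>u\<close> is taken: slices
  through points of one line are translates of each other, so the line may be parametrized from
  \<open>x\<close> itself.\<close>

definition steiner :: "'a::euclidean_space \<Rightarrow> 'a set \<Rightarrow> 'a set" where
  "steiner u A = {x. ennreal (2 * \<bar>x \<bullet> u\<bar>) < emeasure lborel (slice u A x)}"

lemma sets_slice [measurable]:
  assumes [measurable]: "A \<in> sets borel" shows "slice u A x \<in> sets borel"
  unfolding slice_def by measurable

lemma emeasure_slice_eq:
  assumes [measurable]: "A \<in> sets borel"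
  shows "emeasure lborel (slice u A x) = (\<integral>\<^sup>+t. indicator A (x + t *\<^sub>R u) \<partial>lborel)"
proof -
  have "emeasure lborel (slice u A x) = (\<integral>\<^sup>+t. indicator (slice u A x) t \<partial>lborel)" by simp
  also have "\<dots> = (\<integral>\<^sup>+t. indicator A (x + t *\<^sub>R u) \<partial>lborel)"
    by (intro nn_integral_cong) (auto simp: indicator_def slice_def)
  finally show ?thesis .
qed

lemma emeasure_slice_measurable [measurable]:
  assumes [measurable]: "A \<in> sets borel"
  shows "(\<lambda>x. emeasure lborel (slice u A x)) \<in> borel_measurable borel"
  unfolding emeasure_slice_eq[OF assms] by measurable

lemma sets_steiner [measurable]:
  assumes [measurable]: "A \<in> sets borel" shows "steiner u A \<in> sets borel"
  unfolding steiner_def by measurable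

lemma emeasure_slice_shift:
  fixes u :: "'a::euclidean_space"
  assumes [measurable]: "A \<in> sets borel"
  shows "emeasure lborel (slice u A (x + s *\<^sub>R u)) = emeasure lborel (slice u A x)"
proof -
  have "emeasure lborel (slice u A (x + s *\<^sub>R u)) = (\<integral>\<^sup>+t. indicator A (x + (s + t) *\<^sub>R u) \<partial>lborel)"
    unfolding emeasure_slice_eq[OF assms] by (simp add: algebra_simps)
  also have "\<dots> = (\<integral>\<^sup>+t. indicator A (x + t *\<^sub>R u) \<partial>lborel)"
    by (rule nn_integral_lborel_translate) measurable
  finally show ?thesis unfolding emeasure_slice_eq[OF assms] .
qed

lemma slice_steiner:
  fixes u :: "'a::euclidean_space"
  assumes u: "norm u = 1" and A: "A \<in> sets borel"
  shows "slice u (steiner u A) x = {t. ennreal (2 * \<bar>t + x \<bullet> u\<bar>) < emeasure lborel (slice u A x)}"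
proof -
  have uu: "u \<bullet> u = 1" using u by (simp add: dot_square_norm)
  show ?thesis
    unfolding steiner_def slice_def[of u "Collect _"]
    by (simp add: inner_add_left uu emeasure_slice_shift[OF A] add.commute)
qed

lemma emeasure_centred_interval:
  "emeasure lborel {t::real. ennreal (2 * \<bar>t + \<alpha>\<bar>) < m} = m"
proof (cases m)
  case (real r)
  then have "{t::real. ennreal (2 * \<bar>t + \<alpha>\<bar>) < m} = {- \<alpha> - r / 2<..<- \<alpha> + r / 2}"
    by (auto simp: ennreal_less_iff abs_if)
  then show ?thesis using real by simp
next
  case top
  then show ?thesis by simp
qed

lemma emeasure_disintegrate:
  fixes u :: "'a::euclidean_space"
  assumes u: "norm u = 1" and [measurable]: "A \<in> sets borel"
  shows "emeasure lborel A = (\<integral>\<^sup>+x. indicator {0..<1} (x \<bullet> u) * emeasure lborel (slice u A x) \<partial>lborel)"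
  using nn_integral_disintegrate[OF u, of "indicator A"] by (simp add: emeasure_slice_eq)

lemma emeasure_steiner:
  fixes u :: "'a::euclidean_space"
  assumes u: "norm u = 1" and [measurable]: "A \<in> sets borel"
  shows "emeasure lborel (steiner u A) = emeasure lborel A"
  unfolding emeasure_disintegrate[OF u assms(2)] emeasure_disintegrate[OF u sets_steiner[OF assms(2)]]
    slice_steiner[OF u assms(2)] emeasure_centred_interval ..

text \<open>Complete the square in \<open>t\<close>. The centre is the same as for slices of Steiner
  symmetrals, so on every line the slice of the ball and that of a symmetral are nested. The value
  \<open>l = 0\<close> covers lines that miss the ball.\<close>

lemma slice_ball:
  fixes u :: "'a::euclidean_space"
  assumes u: "norm u = 1"
  obtains l where "0 \<le> l" "slice u (ball 0 \<rho>) x = {t. 2 * \<bar>t + x \<bullet> u\<bar> < l}"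
proof -
  have uu: "u \<bullet> u = 1" using u by (simp add: dot_square_norm)
  define d where "d = \<rho>\<^sup>2 - x \<bullet> x + (x \<bullet> u)\<^sup>2"
  have eq: "norm (x + t *\<^sub>R u) < \<rho> \<longleftrightarrow> (t + x \<bullet> u)\<^sup>2 < d" if "0 < \<rho>" for t
  proof -
    have "norm (x + t *\<^sub>R u) < \<rho> \<longleftrightarrow> (norm (x + t *\<^sub>R u))\<^sup>2 < \<rho>\<^sup>2"
      using that by (metis less_imp_le norm_ge_zero power2_less_imp_less power_strict_mono zero_less_numeral)
    also have "(norm (x + t *\<^sub>R u))\<^sup>2 = x \<bullet> x + 2 * t * (x \<bullet> u) + t\<^sup>2"
      unfolding power2_norm_eq_inner power2_eq_square[of t]
      by (simp add: inner_add_left inner_add_right uu inner_commute)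
    finally show ?thesis unfolding d_def by (simp add: power2_eq_square algebra_simps)
  qed
  show thesis
  proof (cases "0 < \<rho> \<and> 0 < d")
    case True
    have "slice u (ball 0 \<rho>) x = {t. 2 * \<bar>t + x \<bullet> u\<bar> < 2 * sqrt d}"
      using True eq by (auto simp: slice_def simp flip: real_sqrt_abs)
    then show ?thesis using True by (intro that[of "2 * sqrt d"]) auto
  next
    case False
    then have "slice u (ball 0 \<rho>) x = {}"
      using eq by (auto simp: slice_def) (smt (verit) zero_le_power2 norm_ge_zero)+
    then show ?thesis by (intro that[of 0]) auto
  qed
qed

lemma steiner_subset_ball:
  fixes u :: "'a::euclidean_space"
  assumes u: "norm u = 1" and A: "A \<in> sets borel" "A \<subseteq> ball 0 R"
  shows "steiner u A \<subseteq> ball 0 R"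
proof
  fix x assume x: "x \<in> steiner u A"
  obtain l where l: "0 \<le> l" "slice u (ball 0 R) x = {t. 2 * \<bar>t + x \<bullet> u\<bar> < l}"
    using slice_ball[OF u] by blast
  have "ennreal (2 * \<bar>x \<bullet> u\<bar>) < emeasure lborel (slice u A x)" using x by (simp add: steiner_def)
  also have "\<dots> \<le> emeasure lborel (slice u (ball 0 R) x)"
    using A by (intro emeasure_mono) (auto simp: slice_def[of _ A] slice_def[of _ "ball 0 R"])
  also have "\<dots> = ennreal l"
    unfolding l(2) using emeasure_centred_interval[of "x \<bullet> u" "ennreal l"] l(1) by (simp add: ennreal_less_iff)
  finally have "0 \<in> slice u (ball 0 R) x" unfolding l(2) using l(1) by (simp add: ennreal_less_iff)
  then show "x \<in> ball 0 R" by (simp add: slice_def)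
qed

lemma slice_fmeasurable:
  fixes u :: "'a::euclidean_space"
  assumes u: "norm u = 1" and A: "A \<in> sets borel" "A \<subseteq> ball 0 R"
  shows "slice u A x \<in> fmeasurable lborel"
proof -
  obtain l where l: "0 \<le> l" "slice u (ball 0 R) x = {t. 2 * \<bar>t + x \<bullet> u\<bar> < l}"
    using slice_ball[OF u] by blast
  have "emeasure lborel (slice u A x) \<le> emeasure lborel (slice u (ball 0 R) x)"
    using A by (intro emeasure_mono) (auto simp: slice_def[of _ A] slice_def[of _ "ball 0 R"])
  also have "\<dots> = ennreal l"
    unfolding l(2) using emeasure_centred_interval[of "x \<bullet> u" "ennreal l"] l(1) by (simp add: ennreal_less_iff)
  finally show ?thesis using A by (intro fmeasurableI) (auto simp: less_top[symmetric] top_unique)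
qed

lemma triple_int_disintegrate:
  fixes u :: "'a::euclidean_space"
  assumes u: "norm u = 1" and [measurable]: "A \<in> sets borel" "B \<in> sets borel" "C \<in> sets borel"
  shows "triple_int A B C = (\<integral>\<^sup>+x. \<integral>\<^sup>+y. indicator {0..<1} (x \<bullet> u) * indicator {0..<1} (y \<bullet> u)
      * triple_int (slice u A x) (slice u B y) (slice u C (x + y)) \<partial>lborel \<partial>lborel)"
proof -
  let ?L = "\<lambda>x y s t. indicator A (x + s *\<^sub>R u) * indicator B (y + t *\<^sub>R u)
       * indicator C (x + s *\<^sub>R u + (y + t *\<^sub>R u)) :: ennreal"
  define k :: "real \<Rightarrow> ennreal" where "k = indicator {0..<1}"
  have [measurable]: "k \<in> borel_measurable borel" unfolding k_def by simp
  have "triple_int A B C = (\<integral>\<^sup>+x. k (x \<bullet> u) * (\<integral>\<^sup>+s. \<integral>\<^sup>+y. indicator A (x + s *\<^sub>R u) * indicator B y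
       * indicator C (x + s *\<^sub>R u + y) \<partial>lborel \<partial>lborel) \<partial>lborel)"
    unfolding triple_int_def k_def by (rule nn_integral_disintegrate[OF u]) measurable
  also have "\<dots> = (\<integral>\<^sup>+x. k (x \<bullet> u) * (\<integral>\<^sup>+s. \<integral>\<^sup>+y. k (y \<bullet> u) * (\<integral>\<^sup>+t. ?L x y s t \<partial>lborel) \<partial>lborel \<partial>lborel) \<partial>lborel)"
    unfolding k_def by (intro nn_integral_cong arg_cong2[where f = times] refl nn_integral_disintegrate[OF u]) measurable
  also have "\<dots> = (\<integral>\<^sup>+x. k (x \<bullet> u) * (\<integral>\<^sup>+y. \<integral>\<^sup>+s. k (y \<bullet> u) * (\<integral>\<^sup>+t. ?L x y s t \<partial>lborel) \<partial>lborel \<partial>lborel) \<partial>lborel)"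
    by (intro nn_integral_cong arg_cong2[where f = times] refl lborel_pair.Fubini') measurable
  also have "\<dots> = (\<integral>\<^sup>+x. \<integral>\<^sup>+y. k (x \<bullet> u) * k (y \<bullet> u) * (\<integral>\<^sup>+s. \<integral>\<^sup>+t. ?L x y s t \<partial>lborel \<partial>lborel) \<partial>lborel \<partial>lborel)"
    by (simp add: nn_integral_cmult mult.assoc)
  also have "\<dots> = (\<integral>\<^sup>+x. \<integral>\<^sup>+y. k (x \<bullet> u) * k (y \<bullet> u)
      * triple_int (slice u A x) (slice u B y) (slice u C (x + y)) \<partial>lborel \<partial>lborel)"
    unfolding triple_int_def slice_def by (simp add: indicator_def algebra_simps)
  finally show ?thesis unfolding k_def .
qed

text \<open>Apply the inequality on the line to the slices through \<open>x\<close>,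
  \<open>y\<close> and \<open>x + y\<close>; linearity of the inner product makes the centres fit
  together as \<open>riesz_real\<close> requires.\<close>

lemma triple_int_steiner:
  fixes u :: "'a::euclidean_space"
  assumes u: "norm u = 1" and [measurable]: "A \<in> sets borel" "B \<in> sets borel" "C \<in> sets borel"
    and R: "A \<subseteq> ball 0 R" "B \<subseteq> ball 0 R" "C \<subseteq> ball 0 R"
  shows "triple_int A B C \<le> triple_int (steiner u A) (steiner u B) (steiner u C)"
proof -
  have sl: "slice u (steiner u S) x = {t. 2 * \<bar>t + x \<bullet> u\<bar> < measure lborel (slice u S x)}"
    if "S \<in> sets borel" "S \<subseteq> ball 0 R" for S x
    using slice_fmeasurable[OF u that]
    by (simp add: slice_steiner[OF u that(1)] emeasure_eq_measure2 ennreal_less_iff)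
  have "triple_int (slice u A x) (slice u B y) (slice u C (x + y))
     \<le> triple_int (slice u (steiner u A) x) (slice u (steiner u B) y) (slice u (steiner u C) (x + y))" for x y
    using riesz_real[of "slice u A x" "slice u B y" "slice u C (x + y)" "x \<bullet> u" "y \<bullet> u"]
    by (simp add: sl R slice_fmeasurable[OF u _ R(1)] slice_fmeasurable[OF u _ R(2)] slice_fmeasurable[OF u _ R(3)]
         inner_add_left)
  then show ?thesis
    by (subst (1 2) triple_int_disintegrate[OF u]) (simp_all add: nn_integral_mono mult_left_mono)
qed

text \<open>On one line let \<open>E\<close>, \<open>I\<close>, \<open>S\<close> be the slices of
  \<open>A\<close>, of the ball and of the symmetral. \<open>S\<close> and \<open>I\<close> are
  nested, so \<open>S - I\<close> is empty or has measure \<open>|E - I| - |I - E|\<close>. The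
  transported mass \<open>M\<close> lies in \<open>E - I\<close>, and its translate by
  \<open>c\<close> lies in \<open>I - E\<close>; in either case it fits into what is gained. For
  \<open>c = 0\<close> the transported set is empty and plain monotonicity remains.\<close>

lemma steiner_diff_ball:
  fixes u :: "'a::euclidean_space"
  assumes u: "norm u = 1" and [measurable]: "A \<in> sets borel" and R: "A \<subseteq> ball 0 R"
  shows "emeasure lborel (steiner u A - ball 0 \<rho>)
      + emeasure lborel {x \<in> A - ball 0 \<rho>. x + c *\<^sub>R u \<in> ball 0 \<rho> - A}
    \<le> emeasure lborel (A - ball 0 \<rho>)"
proof -
  define W where "W = {x \<in> A - ball 0 \<rho>. x + c *\<^sub>R u \<in> ball 0 \<rho> - A}"
  have [measurable]: "W \<in> sets borel" unfolding W_def by (simp add: Measurable.pred_def) measurable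
  have key: "emeasure lborel (slice u (steiner u A - ball 0 \<rho>) x) + emeasure lborel (slice u W x)
     \<le> emeasure lborel (slice u (A - ball 0 \<rho>) x)" for x
  proof -
    define E where "E = slice u A x"
    define M where "M = slice u W x"
    obtain l where l: "0 \<le> l" "slice u (ball 0 \<rho>) x = {t. 2 * \<bar>t + x \<bullet> u\<bar> < l}"
      using slice_ball[OF u] by blast
    define I where "I = {t. 2 * \<bar>t + x \<bullet> u\<bar> < l}"
    have I_eq: "I = {t. ennreal (2 * \<bar>t + x \<bullet> u\<bar>) < ennreal l}" unfolding I_def using l(1) by (simp add: ennreal_less_iff)
    have emI: "emeasure lborel I = ennreal l" unfolding I_eq by (rule emeasure_centred_interval)
    have [measurable]: "E \<in> sets borel" "M \<in> sets borel" "I \<in> sets borel"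
      unfolding E_def M_def I_def by measurable
    have fE: "E \<in> fmeasurable lborel" unfolding E_def by (rule slice_fmeasurable[OF u _ R]) simp
    define a where "a = measure lborel E"
    have ema: "emeasure lborel E = ennreal a" unfolding a_def by (rule emeasure_eq_measure2[OF fE])
    have fI: "I \<in> fmeasurable lborel" using emI by (intro fmeasurableI) auto
    have mI: "measure lborel I = l" using emI l(1) by (simp add: measure_def)
    define S where "S = {t. ennreal (2 * \<bar>t + x \<bullet> u\<bar>) < ennreal a}"
    have emS: "emeasure lborel S = ennreal a" unfolding S_def by (rule emeasure_centred_interval)
    have [measurable]: "S \<in> sets borel" unfolding S_def by measurable
    have ME: "M \<subseteq> E - I" unfolding M_def E_def I_def l(2)[symmetric] W_def slice_def by auto
    have "(\<lambda>t. c + t) ` M \<subseteq> I - E"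
      unfolding M_def E_def I_def l(2)[symmetric] W_def slice_def by (auto simp: algebra_simps)
    then have MI: "emeasure lborel M \<le> emeasure lborel (I - E)"
    proof -
      assume sub: "(\<lambda>t. c + t) ` M \<subseteq> I - E"
      have "emeasure lborel M = (\<integral>\<^sup>+t. indicator M t \<partial>lborel)" by simp
      also have "\<dots> \<le> (\<integral>\<^sup>+t. indicator (I - E) (c + t) \<partial>lborel)"
        using sub by (intro nn_integral_mono) (auto simp: indicator_def)
      also have "\<dots> = (\<integral>\<^sup>+t. indicator (I - E) t \<partial>lborel)"
        by (rule nn_integral_lborel_translate) measurable
      finally show ?thesis by simp
    qed
    have "emeasure lborel (S - I) + emeasure lborel M \<le> emeasure lborel (E - I)"
    proof (cases "a \<le> l")
      case True
      then have "S - I = {}" unfolding S_def I_eq by (auto dest!: ennreal_leI)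
      then have "emeasure lborel (S - I) = 0" by (metis emeasure_empty)
      then show ?thesis using ME by (simp add: emeasure_mono)
    next
      case False
      then have IS: "I \<subseteq> S" unfolding S_def I_eq by (auto intro: order.strict_trans2[OF _ ennreal_leI])
      have fS: "S \<in> fmeasurable lborel" using emS by (intro fmeasurableI) auto
      have mS: "measure lborel S = a" using emS by (simp add: measure_def a_def)
      have "measure lborel (S - I) = a - l"
        using measurable_measure_Diff[OF fS _ IS] by (simp add: mS mI)
      moreover have "measure lborel (E - I) = a - measure lborel (E \<inter> I)"
        using measurable_measure_Diff[OF fE, of "E \<inter> I"] by (simp add: a_def Diff_Int)
      moreover have "measure lborel (I - E) = l - measure lborel (E \<inter> I)"
        using measurable_measure_Diff[OF fI, of "E \<inter> I"] by (simp add: mI Diff_Int)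
      ultimately have "measure lborel (S - I) + measure lborel (I - E) = measure lborel (E - I)" by simp
      moreover have "S - I \<in> fmeasurable lborel" "I - E \<in> fmeasurable lborel" "E - I \<in> fmeasurable lborel"
        using fS fI fE by (auto intro: fmeasurable.Diff)
      ultimately have "emeasure lborel (S - I) + emeasure lborel (I - E) = emeasure lborel (E - I)"
        by (simp add: emeasure_eq_measure2 flip: ennreal_plus)
      then show ?thesis using MI by (metis add_left_mono)
    qed
    moreover have "slice u (steiner u A - ball 0 \<rho>) x = S - I"
      using slice_steiner[OF u, of A x] l(2) ema unfolding S_def I_def E_def by (auto simp: slice_def)
    moreover have "slice u (A - ball 0 \<rho>) x = E - I"
      using l(2) unfolding I_def E_def by (auto simp: slice_def)
    ultimately show ?thesis unfolding M_def by simp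
  qed
  have "emeasure lborel (steiner u A - ball 0 \<rho>) + emeasure lborel W
     = (\<integral>\<^sup>+x. indicator {0..<1} (x \<bullet> u) * (emeasure lborel (slice u (steiner u A - ball 0 \<rho>) x) + emeasure lborel (slice u W x)) \<partial>lborel)"
    by (subst (1 2) emeasure_disintegrate[OF u]) (simp_all add: nn_integral_add distrib_left)
  also have "\<dots> \<le> emeasure lborel (A - ball 0 \<rho>)"
    unfolding emeasure_disintegrate[OF u sets.Diff[OF assms(2) borel_open[OF open_ball]]]
    by (intro nn_integral_mono mult_left_mono key) simp
  finally show ?thesis unfolding W_def .
qed

section \<open>The Riesz rearrangement inequality\<close>

text \<open>An averaging argument: the overlaps integrate over \<open>h\<close> to the product of
  the two measures, and they vanish for \<open>h\<close> outside \<open>ball 0 (2 * R)\<close>, so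
  some shift does at least as well as the mean.\<close>

lemma exists_overlap_shift:
  fixes P Q :: "'a::euclidean_space set"
  assumes [measurable]: "P \<in> sets borel" "Q \<in> sets borel"
    and sub: "P \<subseteq> ball 0 R" "Q \<subseteq> ball 0 R" and pos: "0 < v"
    and v: "ennreal v * emeasure lborel (ball (0::'a) (2 * R)) < emeasure lborel P * emeasure lborel Q"
  obtains h where "ennreal v \<le> emeasure lborel {x \<in> P. x + h \<in> Q}"
proof (rule ccontr)
  assume "\<not> thesis"
  then have lt: "emeasure lborel {x \<in> P. x + h \<in> Q} \<le> ennreal v" for h
    using that by (meson linear)
  have W: "emeasure lborel {x \<in> P. x + h \<in> Q} = (\<integral>\<^sup>+x. indicator P x * indicator Q (x + h) \<partial>lborel)" for h
  proof -
    have [measurable]: "{x \<in> P. x + h \<in> Q} \<in> sets borel" by simp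
    have "emeasure lborel {x \<in> P. x + h \<in> Q} = (\<integral>\<^sup>+x. indicator {x \<in> P. x + h \<in> Q} x \<partial>lborel)" by simp
    also have "\<dots> = (\<integral>\<^sup>+x. indicator P x * indicator Q (x + h) \<partial>lborel)"
      by (intro nn_integral_cong) (auto simp: indicator_def)
    finally show ?thesis .
  qed
  have le: "emeasure lborel {x \<in> P. x + h \<in> Q} \<le> ennreal v * indicator (ball 0 (2 * R)) h" for h
  proof (cases "h \<in> ball 0 (2 * R)")
    case False
    have "{x \<in> P. x + h \<in> Q} = {}"
    proof safe
      fix x assume "x \<in> P" "x + h \<in> Q"
      then have "norm x < R" "norm (x + h) < R" using sub by auto
      then have "norm h < 2 * R" using norm_triangle_ineq4[of "x + h" x] by simp
      then show "x \<in> {}" using False by simp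
    qed
    then have "emeasure lborel {x \<in> P. x + h \<in> Q} = 0" by (metis emeasure_empty)
    then show ?thesis by simp
  qed (use lt in auto)
  have "emeasure lborel P * emeasure lborel Q = (\<integral>\<^sup>+x. indicator P x * (\<integral>\<^sup>+h. indicator Q h \<partial>lborel) \<partial>lborel)"
    by (simp add: nn_integral_multc)
  also have "\<dots> = (\<integral>\<^sup>+x. indicator P x * (\<integral>\<^sup>+h. indicator Q (x + h) \<partial>lborel) \<partial>lborel)"
    by (subst nn_integral_lborel_translate) auto
  also have "\<dots> = (\<integral>\<^sup>+x. \<integral>\<^sup>+h. indicator P x * indicator Q (x + h) \<partial>lborel \<partial>lborel)"
    by (simp add: nn_integral_cmult)
  also have "\<dots> = (\<integral>\<^sup>+h. \<integral>\<^sup>+x. indicator P x * indicator Q (x + h) \<partial>lborel \<partial>lborel)"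
    by (rule lborel_pair.Fubini') measurable
  also have "\<dots> \<le> (\<integral>\<^sup>+h. ennreal v * indicator (ball (0::'a) (2 * R)) h \<partial>lborel)"
    unfolding W[symmetric] by (rule nn_integral_mono, rule le)
  also have "\<dots> = ennreal v * emeasure lborel (ball (0::'a) (2 * R))"
    by (rule nn_integral_cmult_indicator) simp
  finally show False using v by simp
qed

lemma fmeasurable_subset_ball:
  assumes "A \<in> sets borel" "A \<subseteq> ball (0::'a::euclidean_space) R"
  shows "A \<in> fmeasurable lborel"
proof (rule fmeasurableI)
  have "emeasure lborel A \<le> emeasure lborel (ball (0::'a) R)"
    using assms by (intro emeasure_mono) auto
  also have "\<dots> < \<infinity>" using emeasure_lborel_ball_finite by blast
  finally show "emeasure lborel A < \<infinity>" .
qed (use assms in auto)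

text \<open>Symmetrizing along the shift \<open>h\<close> found by the previous lemma cancels, on every line parallel to \<open>h\<close>, the part of
  \<open>X - ball 0 \<rho>\<close> that \<open>h\<close> carries into \<open>ball 0 \<rho> - X\<close>.\<close>

lemma steiner_improves:
  fixes X :: "'a::euclidean_space set"
  assumes X [measurable]: "X \<in> sets borel" and sub: "X \<subseteq> ball 0 R" and \<rho>: "\<rho> \<le> R"
    and eq: "emeasure lborel X = emeasure lborel (ball (0::'a) \<rho>)"
    and e: "0 < e" "e \<le> measure lborel (X - ball 0 \<rho>)"
  obtains u where "norm u = 1"
    "measure lborel (steiner u X - ball 0 \<rho>)
       \<le> measure lborel (X - ball 0 \<rho>) - e\<^sup>2 / (2 * measure lborel (ball (0::'a) (2 * R)))"
proof -
  define P where "P = X - ball 0 \<rho>"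
  define Q where "Q = ball 0 \<rho> - X"
  have subs: "P \<subseteq> ball 0 R" "Q \<subseteq> ball 0 R" "ball (0::'a) \<rho> \<subseteq> ball 0 R"
    unfolding P_def Q_def using sub \<rho> by auto
  have [measurable]: "P \<in> sets borel" "Q \<in> sets borel" unfolding P_def Q_def by auto
  have fm: "P \<in> fmeasurable lborel" "Q \<in> fmeasurable lborel" "X \<in> fmeasurable lborel" "ball (0::'a) \<rho> \<in> fmeasurable lborel"
    using subs sub by (auto intro: fmeasurable_subset_ball)
  have mXD: "measure lborel X = measure lborel (ball (0::'a) \<rho>)" using eq by (simp add: measure_def)
  have "measure lborel P = measure lborel X - measure lborel (X \<inter> ball 0 \<rho>)"
    unfolding P_def using measurable_measure_Diff[OF fm(3), of "X \<inter> ball 0 \<rho>"] by (simp add: Diff_Int)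
  moreover have "measure lborel Q = measure lborel (ball (0::'a) \<rho>) - measure lborel (X \<inter> ball 0 \<rho>)"
    unfolding Q_def using measurable_measure_Diff[OF fm(4), of "X \<inter> ball 0 \<rho>"] by (simp add: Diff_Int)
  ultimately have PQ: "measure lborel Q = measure lborel P" using mXD by simp
  define V where "V = measure lborel (ball (0::'a) (2 * R))"
  have R0: "0 < R"
  proof (rule ccontr)
    assume "\<not> 0 < R"
    then have "P = {}" using subs(1) ball_empty[of R "0::'a"] by auto
    then show False using e unfolding P_def by (metis measure_empty not_le)
  qed
  have V0: "0 < V" unfolding V_def using R0 by simp
  have eV: "emeasure lborel (ball (0::'a) (2 * R)) = ennreal V"
    unfolding V_def by (intro emeasure_eq_measure2 fmeasurable_subset_ball[of _ "2 * R"]) auto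
  \<comment> \<open>The mean overlap over \<open>ball 0 (2 * R)\<close> is at least
    \<open>e\<^sup>2 / V\<close>; half of it makes the hypothesis of
    \<open>exists_overlap_shift\<close> strict.\<close>
  define v where "v = e\<^sup>2 / (2 * V)"
  have v0: "0 < v" unfolding v_def using e V0 by simp
  have eP: "e \<le> measure lborel P" using e by (simp add: P_def)
  have "ennreal v * emeasure lborel (ball (0::'a) (2 * R)) = ennreal (e\<^sup>2 / 2)"
    unfolding eV v_def using V0 by (simp flip: ennreal_mult)
  also have "\<dots> < ennreal (e * e)" using e by (simp add: ennreal_less_iff power2_eq_square)
  also have "\<dots> \<le> ennreal (measure lborel P * measure lborel Q)"
    using eP e PQ by (intro ennreal_leI mult_mono) auto
  also have "\<dots> = emeasure lborel P * emeasure lborel Q"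
    using fm by (simp add: emeasure_eq_measure2 ennreal_mult)
  finally obtain h where h: "ennreal v \<le> emeasure lborel {x \<in> P. x + h \<in> Q}"
    using exists_overlap_shift[of P Q R v] subs v0 by auto
  have "h \<noteq> 0"
  proof
    assume "h = 0"
    then have "{x \<in> P. x + h \<in> Q} = {}" unfolding P_def Q_def by auto
    then have "emeasure lborel {x \<in> P. x + h \<in> Q} = 0" by (metis emeasure_empty)
    then show False using h v0 by simp
  qed
  define u where "u = h /\<^sub>R norm h"
  have u: "norm u = 1" and hu: "h = norm h *\<^sub>R u" using \<open>h \<noteq> 0\<close> by (auto simp: u_def)
  have S: "steiner u X - ball 0 \<rho> \<in> fmeasurable lborel"
    using steiner_subset_ball[OF u X sub] by (intro fmeasurable_subset_ball[of _ R]) auto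
  have "ennreal (measure lborel (steiner u X - ball 0 \<rho>) + v) \<le> emeasure lborel (steiner u X - ball 0 \<rho>)
      + emeasure lborel {x \<in> X - ball 0 \<rho>. x + norm h *\<^sub>R u \<in> ball 0 \<rho> - X}"
    using h v0 S unfolding hu[symmetric] P_def Q_def by (simp add: emeasure_eq_measure2 ennreal_plus)
  also have "\<dots> \<le> emeasure lborel (X - ball 0 \<rho>)"
    by (rule steiner_diff_ball[OF u X sub])
  also have "\<dots> = ennreal (measure lborel (X - ball 0 \<rho>))"
    using fm(1) unfolding P_def by (rule emeasure_eq_measure2)
  finally have "measure lborel (steiner u X - ball 0 \<rho>) + v \<le> measure lborel (X - ball 0 \<rho>)"
    by simp
  then show thesis using u by (intro that[of u]) (auto simp: v_def V_def)
qed

lemma steiner_diff_mono: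
  fixes u :: "'a::euclidean_space"
  assumes u: "norm u = 1" and X [measurable]: "X \<in> sets borel" and sub: "X \<subseteq> ball 0 R"
  shows "measure lborel (steiner u X - ball 0 \<rho>) \<le> measure lborel (X - ball 0 \<rho>)"
proof -
  have "emeasure lborel (steiner u X - ball 0 \<rho>) \<le> emeasure lborel (X - ball 0 \<rho>)"
    using steiner_diff_ball[OF u X sub, of \<rho> 0] by (rule order.trans[rotated]) simp
  moreover have "X - ball 0 \<rho> \<in> fmeasurable lborel"
    using sub by (intro fmeasurable_subset_ball[of _ R]) auto
  ultimately show ?thesis
    unfolding measure_def by (intro enn2real_mono) (auto simp: fmeasurable_def)
qed

lemma triple_int_Un3:
  fixes A B C C' :: "'a::euclidean_space set"
  assumes [measurable]: "A \<in> sets borel" "B \<in> sets borel" "C \<in> sets borel" "C' \<in> sets borel"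
  shows "triple_int A B (C \<union> C') \<le> triple_int A B C + triple_int A B C'"
proof -
  have "triple_int A B (C \<union> C') \<le> (\<integral>\<^sup>+x. \<integral>\<^sup>+y. indicator A x * indicator B y * indicator C (x + y)
       + indicator A x * indicator B y * indicator C' (x + y) \<partial>lborel \<partial>lborel)"
    unfolding triple_int_def by (intro nn_integral_mono) (auto simp: indicator_def)
  also have "\<dots> = triple_int A B C + triple_int A B C'"
    unfolding triple_int_def by (simp add: nn_integral_add)
  finally show ?thesis .
qed

text \<open>The sets are exchanged one at a time. Only the one-sided differences enter, which is why
  distances to balls can be measured by \<open>X - ball 0 a\<close> alone.\<close>

lemma triple_int_diff_bound:
  fixes A B C A' B' C' :: "'a::euclidean_space set"
  assumes [measurable]: "A \<in> sets borel" "B \<in> sets borel" "C \<in> sets borel"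
     "A' \<in> sets borel" "B' \<in> sets borel" "C' \<in> sets borel"
  shows "triple_int A B C \<le> triple_int A' B' C' + (emeasure lborel (A - A') * emeasure lborel B
     + emeasure lborel A' * emeasure lborel (B - B') + emeasure lborel A' * emeasure lborel (C - C'))"
proof -
  have 1: "triple_int X Y Z \<le> triple_int X' Y Z + emeasure lborel (X - X') * emeasure lborel Y"
    if [measurable]: "X \<in> sets borel" "X' \<in> sets borel" "Y \<in> sets borel" "Z \<in> sets borel" for X X' Y Z :: "'a set"
  proof -
    have "triple_int X Y Z \<le> triple_int (X' \<union> (X - X')) Y Z" by (rule triple_int_mono) auto
    also have "\<dots> = triple_int X' Y Z + triple_int (X - X') Y Z" by (rule triple_int_Un) auto
    also have "\<dots> \<le> triple_int X' Y Z + emeasure lborel (X - X') * emeasure lborel Y"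
      by (intro add_left_mono triple_int_le_mult) auto
    finally show ?thesis .
  qed
  have 2: "triple_int A' B C \<le> triple_int A' B' C + emeasure lborel A' * emeasure lborel (B - B')"
    using 1[of B B' A' C] by (simp add: triple_int_commute[of A'] mult.commute)
  have "triple_int A' B' C \<le> triple_int A' B' (C' \<union> (C - C'))" by (rule triple_int_mono) auto
  also have "\<dots> \<le> triple_int A' B' C' + triple_int A' B' (C - C')" by (rule triple_int_Un3) auto
  also have "\<dots> \<le> triple_int A' B' C' + emeasure lborel A' * emeasure lborel (C - C')"
    by (intro add_left_mono triple_int_le_mult') auto
  finally have 3: "triple_int A' B' C \<le> \<dots>" .
  have "triple_int A B C \<le> triple_int A' B C + emeasure lborel (A - A') * emeasure lborel B"
    by (rule 1) auto
  also have "\<dots> \<le> (triple_int A' B' C + emeasure lborel A' * emeasure lborel (B - B')) + emeasure lborel (A - A') * emeasure lborel B"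
    by (intro add_right_mono 2)
  also have "\<dots> \<le> ((triple_int A' B' C' + emeasure lborel A' * emeasure lborel (C - C')) + emeasure lborel A' * emeasure lborel (B - B')) + emeasure lborel (A - A') * emeasure lborel B"
    by (intro add_right_mono 3)
  finally show ?thesis by (simp add: ac_simps)
qed

lemma riesz_bounded:
  fixes A B C :: "'a::euclidean_space set"
  assumes bor: "A \<in> sets borel" "B \<in> sets borel" "C \<in> sets borel"
    and sub: "A \<subseteq> ball 0 R" "B \<subseteq> ball 0 R" "C \<subseteq> ball 0 R"
    and \<rho>: "a \<le> R" "b \<le> R" "c \<le> R"
    and eq: "emeasure lborel A = emeasure lborel (ball (0::'a) a)"
      "emeasure lborel B = emeasure lborel (ball (0::'a) b)"
      "emeasure lborel C = emeasure lborel (ball (0::'a) c)"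
  shows "triple_int A B C \<le> triple_int (ball (0::'a) a) (ball 0 b) (ball 0 c)"
proof -
  define good where "good X S \<longleftrightarrow> X \<in> sets borel \<and> X \<subseteq> ball 0 R \<and> emeasure lborel X = emeasure lborel S"
    for X S :: "'a set"
  \<comment> \<open>Steiner symmetrization increases the triple integral, so it suffices that the
    infimum \<open>d\<close> of the distances to the balls over this class vanishes.\<close>
  define \<T> where "\<T> = {(X, Y, Z). good X A \<and> good Y B \<and> good Z C \<and> triple_int A B C \<le> triple_int X Y Z}"
  define \<delta> where "\<delta> = (\<lambda>(X, Y, Z). measure lborel (X - ball (0::'a) a) + measure lborel (Y - ball (0::'a) b)
      + measure lborel (Z - ball (0::'a) c))"
  have \<delta>0: "0 \<le> \<delta> w" for w unfolding \<delta>_def by (auto split: prod.splits)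
  have mem: "(A, B, C) \<in> \<T>" unfolding \<T>_def good_def using bor sub by auto
  have members: "X \<in> sets borel" "X \<subseteq> ball 0 R" "emeasure lborel X = emeasure lborel (ball (0::'a) a)"
      "Y \<in> sets borel" "Y \<subseteq> ball 0 R" "emeasure lborel Y = emeasure lborel (ball (0::'a) b)"
      "Z \<in> sets borel" "Z \<subseteq> ball 0 R" "emeasure lborel Z = emeasure lborel (ball (0::'a) c)"
    if "(X, Y, Z) \<in> \<T>" for X Y Z
    using that eq unfolding good_def \<T>_def by auto
  define d where "d = Inf (\<delta> ` \<T>)"
  have bdd: "bdd_below (\<delta> ` \<T>)" using \<delta>0 by (intro bdd_belowI[of _ 0]) auto
  have d0: "0 \<le> d" unfolding d_def using mem \<delta>0 by (intro cInf_greatest) auto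
  have "\<not> 0 < d"
  proof
    assume dp: "0 < d"
    define V where "V = measure lborel (ball (0::'a) (2 * R))"
    \<comment> \<open>The gain that \<open>steiner_improves\<close> gives for
      \<open>e = d / 3\<close>. It is the same for all members of \<open>\<T>\<close>, since
      \<open>V\<close> depends only on \<open>R\<close>.\<close>
    define g where "g = (d / 3)\<^sup>2 / (2 * V)"
    have step: False if w: "(X, Y, Z) \<in> \<T>" "\<delta> (X, Y, Z) < d + g"
      and u: "norm u = 1" and less: "\<delta> (steiner u X, steiner u Y, steiner u Z) \<le> \<delta> (X, Y, Z) - g" for X Y Z u
    proof -
      have g: "good X A" "good Y B" "good Z C" "triple_int A B C \<le> triple_int X Y Z" using w by (auto simp: \<T>_def)
      have "good (steiner u X') S" if "good X' S" for X' S
        using that steiner_subset_ball[OF u, of X' R] emeasure_steiner[OF u, of X'] unfolding good_def by auto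
      moreover have "triple_int X Y Z \<le> triple_int (steiner u X) (steiner u Y) (steiner u Z)"
        using g unfolding good_def by (intro triple_int_steiner[OF u, where R = R]) auto
      ultimately have "(steiner u X, steiner u Y, steiner u Z) \<in> \<T>"
        using g unfolding \<T>_def by (auto intro: order.trans)
      then have "d \<le> \<delta> (steiner u X, steiner u Y, steiner u Z)" unfolding d_def using bdd by (intro cInf_lower) auto
      then show False using less w(2) by simp
    qed
    have gp: "0 < g"
    proof -
      have "R > 0"
      proof (rule ccontr)
        assume "\<not> 0 < R"
        then have "A = {}" "B = {}" "C = {}" using sub ball_empty[of R "0::'a"] by auto
        then have "\<delta> (A, B, C) = 0" unfolding \<delta>_def by simp
        moreover have "d \<le> \<delta> (A, B, C)" unfolding d_def using bdd mem by (intro cInf_lower) auto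
        ultimately show False using dp by simp
      qed
      then show ?thesis unfolding g_def V_def using dp by simp
    qed
    \<comment> \<open>Take a member within \<open>g\<close> of the infimum. One of its three
      distances is at least \<open>d / 3\<close>; symmetrizing along the direction that improves it
      does not increase the other two, so the result would fall below the infimum.\<close>
    have "\<exists>w\<in>\<delta> ` \<T>. w < d + g"
      using mem gp bdd unfolding d_def by (subst cInf_less_iff[symmetric]) auto
    then obtain X Y Z where w: "(X, Y, Z) \<in> \<T>" "\<delta> (X, Y, Z) < d + g" by auto
    note G = members[OF w(1)]
    have "d \<le> \<delta> (X, Y, Z)" unfolding d_def using bdd w by (intro cInf_lower) auto
    then consider "d / 3 \<le> measure lborel (X - ball 0 a)" | "d / 3 \<le> measure lborel (Y - ball 0 b)"
      | "d / 3 \<le> measure lborel (Z - ball 0 c)"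
      unfolding \<delta>_def by fastforce
    then show False
    proof cases
      case 1
      obtain u where "norm u = 1" "measure lborel (steiner u X - ball 0 a) \<le> measure lborel (X - ball 0 a) - g"
        using steiner_improves[OF G(1,2) \<rho>(1) G(3) _ 1] dp unfolding g_def V_def by auto
      then show False
        using steiner_diff_mono[of u Y R b] steiner_diff_mono[of u Z R c] G
        by (intro step[OF w, of u]) (auto simp: \<delta>_def)
    next
      case 2
      obtain u where "norm u = 1" "measure lborel (steiner u Y - ball 0 b) \<le> measure lborel (Y - ball 0 b) - g"
        using steiner_improves[OF G(4,5) \<rho>(2) G(6) _ 2] dp unfolding g_def V_def by auto
      then show False
        using steiner_diff_mono[of u X R a] steiner_diff_mono[of u Z R c] G
        by (intro step[OF w, of u]) (auto simp: \<delta>_def)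
    next
      case 3
      obtain u where "norm u = 1" "measure lborel (steiner u Z - ball 0 c) \<le> measure lborel (Z - ball 0 c) - g"
        using steiner_improves[OF G(7,8) \<rho>(3) G(9) _ 3] dp unfolding g_def V_def by auto
      then show False
        using steiner_diff_mono[of u X R a] steiner_diff_mono[of u Y R b] G
        by (intro step[OF w, of u]) (auto simp: \<delta>_def)
    qed
  qed
  then have dz: "d = 0" using d0 by simp
  define L where "L = measure lborel A + measure lborel B"
  have L0: "0 \<le> L" unfolding L_def by simp
  show ?thesis
  proof (rule ennreal_le_epsilon)
    fix e :: real assume e: "0 < e"
    have ne: "\<delta> ` \<T> \<noteq> {}" using mem by auto
    have "\<exists>w\<in>\<delta> ` \<T>. w < e / (L + 1)"
      using ne e L0 bdd dz unfolding d_def by (subst cInf_less_iff[symmetric]) auto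
    then obtain X Y Z where w: "(X, Y, Z) \<in> \<T>" "\<delta> (X, Y, Z) < e / (L + 1)" by auto
    note G = members[OF w(1)]
    have fm: "S - T \<in> fmeasurable lborel" if "S \<in> sets borel" "S \<subseteq> ball 0 R" "T \<in> sets borel" for S T :: "'a set"
      using that by (intro fmeasurable_subset_ball[of _ R]) auto
    have fmS: "S \<in> fmeasurable lborel" if "S \<in> sets borel" "S \<subseteq> ball 0 R" for S :: "'a set"
      using that by (intro fmeasurable_subset_ball[of _ R]) auto
    have mAB: "emeasure lborel (ball (0::'a) a) = ennreal (measure lborel A)" "emeasure lborel Y = ennreal (measure lborel B)"
      using emeasure_eq_measure2[OF fmS[OF bor(1) sub(1)]] emeasure_eq_measure2[OF fmS[OF bor(2) sub(2)]] eq G(6) by auto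
    define x y z where "x = measure lborel (X - ball 0 a)" and "y = measure lborel (Y - ball 0 b)" and "z = measure lborel (Z - ball 0 c)"
    have xyz0: "0 \<le> x" "0 \<le> y" "0 \<le> z" unfolding x_def y_def z_def by auto
    have "triple_int A B C \<le> triple_int X Y Z" using w unfolding \<T>_def by auto
    also have "\<dots> \<le> triple_int (ball (0::'a) a) (ball 0 b) (ball 0 c) + (emeasure lborel (X - ball 0 a) * emeasure lborel Y
     + emeasure lborel (ball (0::'a) a) * emeasure lborel (Y - ball 0 b) + emeasure lborel (ball (0::'a) a) * emeasure lborel (Z - ball 0 c))"
      using G by (intro triple_int_diff_bound) auto
    also have "emeasure lborel (X - ball 0 a) = ennreal x" unfolding x_def y_def z_def using G by (intro emeasure_eq_measure2 fm) auto
    also have "emeasure lborel (Y - ball 0 b) = ennreal y" unfolding x_def y_def z_def using G by (intro emeasure_eq_measure2 fm) auto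
    also have "emeasure lborel (Z - ball 0 c) = ennreal z" unfolding x_def y_def z_def using G by (intro emeasure_eq_measure2 fm) auto
    also have "ennreal x * emeasure lborel Y + emeasure lborel (ball (0::'a) a) * ennreal y + emeasure lborel (ball (0::'a) a) * ennreal z
       = ennreal (x * measure lborel B + measure lborel A * y + measure lborel A * z)"
      unfolding mAB using xyz0 by (simp add: ennreal_mult ennreal_plus)
    also have "\<dots> \<le> ennreal e"
    proof (rule ennreal_leI)
      have "x * measure lborel B + measure lborel A * y + measure lborel A * z \<le> x * (L + 1) + (L + 1) * y + (L + 1) * z"
        unfolding L_def using xyz0 by (intro add_mono mult_mono) auto
      also have "\<dots> = \<delta> (X, Y, Z) * (L + 1)" unfolding \<delta>_def x_def y_def z_def by (simp add: algebra_simps)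
      also have "\<dots> \<le> e" using w(2) L0 by (simp add: field_simps)
      finally show "x * measure lborel B + measure lborel A * y + measure lborel A * z \<le> e" .
    qed
    finally show "triple_int A B C \<le> triple_int (ball (0::'a) a) (ball 0 b) (ball 0 c) + ennreal e"
      by (simp add: add_left_mono)
  qed
qed

section \<open>Radii of balls of given volume, and the Riesz inequality for sets of finite
  measure\<close>

lemma exists_ball_radius:
  fixes m :: ennreal
  assumes "m < \<infinity>"
  obtains r where "0 \<le> r" "emeasure lborel (ball (0::'a::euclidean_space) r) = m"
proof -
  obtain v where v: "0 \<le> v" "m = ennreal v" using assms by (cases m) auto
  define \<omega> where "\<omega> = unit_ball_vol (real DIM('a))"
  have \<omega>: "0 < \<omega>" unfolding \<omega>_def by simp
  define r where "r = root DIM('a) (v / \<omega>)"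
  have r0: "0 \<le> r" unfolding r_def using v \<omega> by simp
  have "emeasure lborel (ball (0::'a) r) = ennreal (\<omega> * r ^ DIM('a))"
    unfolding \<omega>_def using r0 by (rule emeasure_ball)
  also have "\<omega> * r ^ DIM('a) = v" unfolding r_def using v \<omega> by (simp add: real_root_pow_pos2)
  finally show thesis using r0 v by (intro that) auto
qed

text \<open>Radii are arbitrary reals. If \<open>s < 0\<close> its ball is empty and the nonnegative
  radius supplied by \<open>exists_ball_radius\<close> is too large, but then \<open>s\<close>
  itself is a witness.\<close>

lemma exists_smaller_ball_radius:
  assumes "m \<le> emeasure lborel (ball (0::'a::euclidean_space) s)"
  obtains r where "r \<le> s" "emeasure lborel (ball (0::'a) r) = m"
proof -
  have "m < \<infinity>" using assms emeasure_lborel_ball_finite[of "0::'a" s] by (auto intro: le_less_trans)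
  then obtain r where r: "emeasure lborel (ball (0::'a) r) = m" using exists_ball_radius by metis
  show thesis
  proof (cases "r \<le> s")
    case True then show ?thesis using r that by blast
  next
    case False
    then have "emeasure lborel (ball (0::'a) s) \<le> emeasure lborel (ball (0::'a) r)"
      by (intro emeasure_mono subset_ball) auto
    then show ?thesis using r assms by (intro that[of s]) auto
  qed
qed

text \<open>Cutting all three sets with \<open>ball 0 k\<close> reduces to the bounded case. The
  balls belonging to the cut sets lie inside the given ones, and monotone convergence in
  \<open>k\<close> removes the cut.\<close>

theorem riesz_rearrangement:
  fixes A B C :: "'a::euclidean_space set"
  assumes fm: "A \<in> fmeasurable lborel" "B \<in> fmeasurable lborel" "C \<in> fmeasurable lborel"
    and eq: "emeasure lborel A = emeasure lborel (ball (0::'a) a)"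
      "emeasure lborel B = emeasure lborel (ball (0::'a) b)"
      "emeasure lborel C = emeasure lborel (ball (0::'a) c)"
  shows "triple_int A B C \<le> triple_int (ball (0::'a) a) (ball 0 b) (ball 0 c)"
proof -
  have bor [measurable]: "A \<in> sets borel" "B \<in> sets borel" "C \<in> sets borel"
    using fm by (auto dest: fmeasurableD)
  have cut: "triple_int (A \<inter> ball 0 (real k)) (B \<inter> ball 0 (real k)) (C \<inter> ball 0 (real k))
      \<le> triple_int (ball (0::'a) a) (ball 0 b) (ball 0 c)" for k :: nat
  proof -
    have rad: "\<exists>r\<le>s. emeasure lborel (S \<inter> ball 0 (real k)) = emeasure lborel (ball (0::'a) r)"
      if S: "S \<in> fmeasurable lborel" "emeasure lborel S = emeasure lborel (ball (0::'a) s)" for S :: "'a set" and s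
    proof -
      have [measurable]: "S \<in> sets borel" using S by (auto dest: fmeasurableD)
      have le: "emeasure lborel (S \<inter> ball 0 (real k)) \<le> emeasure lborel S" by (intro emeasure_mono) auto
      show ?thesis using exists_smaller_ball_radius[OF le[unfolded S(2)]] by metis
    qed
    obtain a' b' c' where r: "a' \<le> a" "b' \<le> b" "c' \<le> c"
      "emeasure lborel (A \<inter> ball 0 (real k)) = emeasure lborel (ball (0::'a) a')"
      "emeasure lborel (B \<inter> ball 0 (real k)) = emeasure lborel (ball (0::'a) b')"
      "emeasure lborel (C \<inter> ball 0 (real k)) = emeasure lborel (ball (0::'a) c')"
      using rad[OF fm(1) eq(1)] rad[OF fm(2) eq(2)] rad[OF fm(3) eq(3)] by blast
    define R where "R = Max {real k, a', b', c'}"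
    have R: "real k \<le> R" "a' \<le> R" "b' \<le> R" "c' \<le> R" unfolding R_def by auto
    have "triple_int (A \<inter> ball 0 (real k)) (B \<inter> ball 0 (real k)) (C \<inter> ball 0 (real k))
      \<le> triple_int (ball (0::'a) a') (ball 0 b') (ball 0 c')"
      using R r by (intro riesz_bounded[where R = R]) auto
    also have "\<dots> \<le> triple_int (ball (0::'a) a) (ball 0 b) (ball 0 c)"
      using r by (intro triple_int_mono subset_ball) auto
    finally show ?thesis .
  qed
  define K where "K k = ball (0::'a) (real k)" for k :: nat
  have [measurable]: "K k \<in> sets borel" for k unfolding K_def by simp
  have mono: "indicator (S \<inter> K k) x \<le> (indicator (S \<inter> K (Suc k)) x :: ennreal)" for S k x
    unfolding K_def by (auto simp: indicator_def)
  have sup: "(SUP k. indicator (A \<inter> K k) x * indicator (B \<inter> K k) y * indicator (C \<inter> K k) (x + y))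
     = (indicator A x * indicator B y * indicator C (x + y) :: ennreal)" for x y
  proof (rule antisym)
    show "(SUP k. indicator (A \<inter> K k) x * indicator (B \<inter> K k) y * indicator (C \<inter> K k) (x + y))
     \<le> (indicator A x * indicator B y * indicator C (x + y) :: ennreal)"
      by (intro SUP_least) (auto simp: indicator_def)
    obtain k :: nat where "max (norm x) (max (norm y) (norm (x + y))) < real k"
      using reals_Archimedean2 by blast
    then have "indicator A x * indicator B y * indicator C (x + y)
       \<le> (indicator (A \<inter> K k) x * indicator (B \<inter> K k) y * indicator (C \<inter> K k) (x + y) :: ennreal)"
      unfolding K_def by (auto simp: indicator_def)
    also have "\<dots> \<le> (SUP k. indicator (A \<inter> K k) x * indicator (B \<inter> K k) y * indicator (C \<inter> K k) (x + y))"
      by (intro SUP_upper) auto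
    finally show "indicator A x * indicator B y * indicator C (x + y) \<le> \<dots>" .
  qed
  have "triple_int A B C = (\<integral>\<^sup>+x. \<integral>\<^sup>+y. (SUP k. indicator (A \<inter> K k) x * indicator (B \<inter> K k) y * indicator (C \<inter> K k) (x + y)) \<partial>lborel \<partial>lborel)"
    unfolding triple_int_def sup ..
  also have "\<dots> = (\<integral>\<^sup>+x. (SUP k. \<integral>\<^sup>+y. indicator (A \<inter> K k) x * indicator (B \<inter> K k) y * indicator (C \<inter> K k) (x + y) \<partial>lborel) \<partial>lborel)"
    by (intro nn_integral_cong nn_integral_monotone_convergence_SUP)
       (auto intro!: incseq_SucI le_funI mult_mono mono)
  also have "\<dots> = (SUP k. triple_int (A \<inter> K k) (B \<inter> K k) (C \<inter> K k))"
    unfolding triple_int_def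
    by (intro nn_integral_monotone_convergence_SUP)
       (auto intro!: incseq_SucI le_funI mult_mono mono nn_integral_mono)
  also have "\<dots> \<le> triple_int (ball (0::'a) a) (ball 0 b) (ball 0 c)"
    using cut unfolding K_def by (intro SUP_least) auto
  finally show ?thesis .
qed

section \<open>Difference energies\<close>

lemma AE_lborel_translate:
  fixes h :: "'a::euclidean_space"
  assumes "AE x in lborel. P x" shows "AE x in lborel. P (x + h)"
proof -
  obtain N where N: "N \<in> null_sets lborel" "{x. \<not> P x} \<subseteq> N"
    using assms by (auto elim: AE_E simp: null_sets_def)
  have "{x. x - (- h) \<in> N} \<in> null_sets lborel" using N(1) by (rule null_sets_translation)
  then show ?thesis by (rule AE_I') (use N(2) in auto)
qed

definition diff_energy :: "real \<Rightarrow> ('a::euclidean_space \<Rightarrow> real) \<Rightarrow> 'a \<Rightarrow> ennreal" where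
  "diff_energy p f h = (\<integral>\<^sup>+x. ennreal (\<bar>f (x + h) - f x\<bar> powr p) \<partial>lborel)"

lemma diff_energy_measurable [measurable]:
  assumes [measurable]: "f \<in> borel_measurable borel"
  shows "diff_energy p f \<in> borel_measurable borel"
  unfolding diff_energy_def by measurable

text \<open>All that the level-set argument uses of a symmetral. The exceptional null sets absorb
  the boundary spheres, which \<open>sym_set\<close> includes, and the value of
  \<open>schwarz\<close> at the origin.\<close>

definition symmetrization_of :: "('a::euclidean_space \<Rightarrow> real) \<Rightarrow> ('a \<Rightarrow> real) \<Rightarrow> bool" where
  "symmetrization_of F f \<longleftrightarrow> F \<in> borel_measurable borel \<and> (\<forall>x. 0 \<le> F x) \<and>
     (\<forall>t>0. \<exists>r. emeasure lborel {x. t < \<bar>f x\<bar>} = emeasure lborel (ball (0::'a) r)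
        \<and> (AE x in lborel. t < F x \<longleftrightarrow> x \<in> ball 0 r))"

section \<open>Slicing powers of differences into level sets\<close>

definition layer :: "real \<Rightarrow> real \<Rightarrow> real \<Rightarrow> real" where
  "layer p t a = p * max 0 (a - t) powr (p - 1)"

lemma layer_measurable [measurable (raw)]:
  assumes [measurable]: "f \<in> borel_measurable M" "g \<in> borel_measurable M"
  shows "(\<lambda>x. layer p (f x) (g x)) \<in> borel_measurable M"
  unfolding layer_def by measurable

text \<open>\<open>layer p t\<close> is nondecreasing in its last argument and vanishes up to
  \<open>t\<close>. Slicing it once more at height \<open>r\<close> thus gives an open half-line,
  whose endpoint is at least \<open>t\<close>; for \<open>0 < t\<close> it is a positive level, as
  \<open>symmetrization_of\<close> demands. The second alternative arises for \<open>p = 1\<close>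
  and \<open>1 \<le> r\<close>.\<close>

lemma layer_superlevel:
  assumes p: "1 \<le> p" and r: "0 \<le> r"
  shows "(\<exists>v\<ge>t. \<forall>a. r < layer p t a \<longleftrightarrow> v < a) \<or> (\<forall>a. \<not> r < layer p t a)"
proof (cases "p = 1")
  case True
  \<comment> \<open>By the convention \<open>0 powr 0 = 0\<close> the case \<open>a \<le> t\<close>
    gives 0 and not 1.\<close>
  then have "layer p t a = (if t < a then 1 else 0)" for a by (auto simp: layer_def)
  then show ?thesis using r by (cases "r < 1") auto
next
  case False
  with p have p1: "1 < p" by simp
  define w where "w = (r / p) powr (1 / (p - 1))"
  have w0: "0 \<le> w" and wp: "w powr (p - 1) = r / p" unfolding w_def using p1 r by (auto simp: powr_powr)
  have "r < layer p t a \<longleftrightarrow> t + w < a" for a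
  proof -
    have "r < layer p t a \<longleftrightarrow> w powr (p - 1) < max 0 (a - t) powr (p - 1)"
      unfolding layer_def wp using p1 by (simp add: field_simps)
    also have "\<dots> \<longleftrightarrow> w < max 0 (a - t)"
      using p1 w0 by (metis diff_gt_0_iff_gt max.cobounded1 not_less powr_less_mono2 powr_mono2 less_imp_le)
    also have "\<dots> \<longleftrightarrow> t + w < a" using w0 by auto
    finally show ?thesis .
  qed
  then show ?thesis using w0 by (intro disjI1 exI[of _ "t + w"]) auto
qed

lemma nn_integral_powr_segment:
  fixes a b p :: real
  assumes p: "1 \<le> p" and ab: "b \<le> a"
  shows "(\<integral>\<^sup>+t. ennreal (p * (a - t) powr (p - 1)) * indicator {b..a} t \<partial>lborel) = ennreal ((a - b) powr p)"
proof -
  have "((\<lambda>x. p * x powr (p - 1)) has_integral p * ((a - b) powr (p - 1 + 1) / (p - 1 + 1))) {0..a - b}"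
    using p ab by (intro has_integral_mult_right has_integral_powr_from_0) auto
  then have "(\<integral>\<^sup>+x. ennreal (p * x powr (p - 1)) * indicator {0..a - b} x \<partial>lborel) = ennreal ((a - b) powr p)"
    using nn_integral_has_integral_lebesgue'[of "{0..a - b}" "\<lambda>x. p * x powr (p - 1)"] p by simp
  also have "(\<integral>\<^sup>+x. ennreal (p * x powr (p - 1)) * indicator {0..a - b} x \<partial>lborel)
     = ennreal \<bar>-1\<bar> * (\<integral>\<^sup>+x. ennreal (p * (a + -1 * x) powr (p - 1)) * indicator {0..a - b} (a + -1 * x) \<partial>lborel)"
    by (rule nn_integral_real_affine) auto
  also have "\<dots> = (\<integral>\<^sup>+t. ennreal (p * (a - t) powr (p - 1)) * indicator {b..a} t \<partial>lborel)"
    by (auto intro!: nn_integral_cong simp: indicator_def)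
  finally show ?thesis by simp
qed

text \<open>For fixed \<open>a\<close>, \<open>layer p t a\<close> is minus the derivative in
  \<open>t\<close> of \<open>max 0 (a - t) powr p\<close>, so its integral over
  \<open>t \<ge> b\<close> is the positive part of the difference to the power \<open>p\<close>; the
  integral over \<open>r\<close> only writes \<open>layer p t a\<close> as the length of
  \<open>{0..<layer p t a}\<close>.\<close>

lemma layer_half:
  fixes a b p :: real
  assumes p: "1 \<le> p" and b: "0 \<le> b"
  shows "(\<integral>\<^sup>+t. \<integral>\<^sup>+r. (if 0 < t \<and> 0 \<le> r \<and> b \<le> t \<and> r < layer p t a then 1 else 0) \<partial>lborel \<partial>lborel)
     = ennreal (max 0 (a - b) powr p)"
proof -
  have inner: "(\<integral>\<^sup>+r. (if 0 < t \<and> 0 \<le> r \<and> b \<le> t \<and> r < layer p t a then 1 else 0) \<partial>lborel)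
     = (if 0 < t \<and> b \<le> t then ennreal (layer p t a) else 0)" for t
  proof -
    have "(\<integral>\<^sup>+r. (if 0 < t \<and> 0 \<le> r \<and> b \<le> t \<and> r < layer p t a then 1 else 0) \<partial>lborel)
       = (\<integral>\<^sup>+r. indicator (if 0 < t \<and> b \<le> t then {0..<layer p t a} else {}) r \<partial>lborel)"
      by (intro nn_integral_cong) (auto simp: indicator_def)
    also have "\<dots> = (if 0 < t \<and> b \<le> t then ennreal (layer p t a) else 0)"
      using p by (auto simp: layer_def)
    finally show ?thesis .
  qed
  show ?thesis
  proof (cases "b < a")
    case True
    have "(\<integral>\<^sup>+t. (if 0 < t \<and> b \<le> t then ennreal (layer p t a) else 0) \<partial>lborel)
       = (\<integral>\<^sup>+t. ennreal (p * (a - t) powr (p - 1)) * indicator {b..a} t \<partial>lborel)"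
    proof (rule nn_integral_cong_AE)
      have "AE t in lborel. t \<noteq> (0::real)" by (rule AE_lborel_singleton)
      then show "AE t in lborel. (if 0 < t \<and> b \<le> t then ennreal (layer p t a) else 0)
         = ennreal (p * (a - t) powr (p - 1)) * indicator {b..a} t"
        by eventually_elim (use b in \<open>auto simp: layer_def indicator_def max_def\<close>)
    qed
    also have "\<dots> = ennreal ((a - b) powr p)" using p True by (intro nn_integral_powr_segment) auto
    finally show ?thesis unfolding inner using True by (simp add: max_def)
  next
    case False
    then have "(if 0 < t \<and> b \<le> t then ennreal (layer p t a) else 0) = 0" for t
      by (simp add: layer_def max.absorb1)
    then show ?thesis unfolding inner using False by (simp add: max_def)
  qed
qed

definition layers :: "real \<Rightarrow> real \<Rightarrow> real \<Rightarrow> real \<Rightarrow> real \<Rightarrow> ennreal" where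
  "layers p t r a b = (if 0 < t \<and> 0 \<le> r \<and> b \<le> t \<and> r < layer p t a then 1 else 0)
                    + (if 0 < t \<and> 0 \<le> r \<and> a \<le> t \<and> r < layer p t b then 1 else 0)"

lemma layers_measurable [measurable (raw)]:
  assumes [measurable]: "f \<in> borel_measurable M" "g \<in> borel_measurable M" "h \<in> borel_measurable M" "k \<in> borel_measurable M"
  shows "(\<lambda>x. layers p (f x) (g x) (h x) (k x)) \<in> borel_measurable M"
  unfolding layers_def by measurable

text \<open>Only products of indicators of superlevel sets of \<open>a\<close> and of sublevel sets of \<open>b\<close> occur (and vice versa),
  which makes the set version of the Riesz inequality applicable.\<close>

lemma powr_diff_layers:
  fixes a b p :: real
  assumes p: "1 \<le> p" and ab: "0 \<le> a" "0 \<le> b"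
  shows "(\<integral>\<^sup>+t. \<integral>\<^sup>+r. layers p t r a b \<partial>lborel \<partial>lborel) = ennreal (\<bar>a - b\<bar> powr p)"
proof -
  have "(\<integral>\<^sup>+t. \<integral>\<^sup>+r. layers p t r a b \<partial>lborel \<partial>lborel)
     = ennreal (max 0 (a - b) powr p) + ennreal (max 0 (b - a) powr p)"
    unfolding layers_def using layer_half[OF p ab(1), of b] layer_half[OF p ab(2), of a]
    by (simp add: nn_integral_add)
  also have "\<dots> = ennreal (\<bar>a - b\<bar> powr p)" by (auto simp: max_def)
  finally show ?thesis .
qed

text \<open>The complement of \<open>E\<close> has infinite measure, so the Riesz inequality is
  applied to \<open>E\<close> instead: the integral with \<open>- E\<close> and the one with
  \<open>E\<close> add up to \<open>|K| * |U|\<close>, which is the same for the balls. Enlarging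
  one summand shrinks the other, and all quantities cancelled are finite. The two claims differ in
  which of \<open>x\<close> and \<open>x + h\<close> carries the complement.\<close>

lemma riesz_complement:
  fixes K E U :: "'a::euclidean_space set"
  assumes fm: "K \<in> fmeasurable lborel" "E \<in> fmeasurable lborel" "U \<in> fmeasurable lborel"
    and eq: "emeasure lborel K = emeasure lborel (ball (0::'a) k)"
      "emeasure lborel E = emeasure lborel (ball (0::'a) e)"
      "emeasure lborel U = emeasure lborel (ball (0::'a) w)"
  shows "(\<integral>\<^sup>+h. \<integral>\<^sup>+x. indicator (ball (0::'a) k) h * (indicator (- ball 0 e) x * indicator (ball 0 w) (x + h)) \<partial>lborel \<partial>lborel)
      \<le> (\<integral>\<^sup>+h. \<integral>\<^sup>+x. indicator K h * (indicator (- E) x * indicator U (x + h)) \<partial>lborel \<partial>lborel)" (is ?one)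
    and "(\<integral>\<^sup>+h. \<integral>\<^sup>+x. indicator (ball (0::'a) k) h * (indicator (- ball 0 e) (x + h) * indicator (ball 0 w) x) \<partial>lborel \<partial>lborel)
      \<le> (\<integral>\<^sup>+h. \<integral>\<^sup>+x. indicator K h * (indicator (- E) (x + h) * indicator U x) \<partial>lborel \<partial>lborel)" (is ?two)
proof -
  have [measurable]: "K \<in> sets borel" "E \<in> sets borel" "U \<in> sets borel" using fm by (auto dest: fmeasurableD)
  have sum1: "(\<integral>\<^sup>+h. \<integral>\<^sup>+x. indicator K h * (indicator (- E) x * indicator U (x + h)) \<partial>lborel \<partial>lborel) + triple_int K E U
      = emeasure lborel K * emeasure lborel U"
    if [measurable]: "K \<in> sets borel" "E \<in> sets borel" "U \<in> sets borel" for K E U :: "'a set"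
  proof -
    have "(\<integral>\<^sup>+h. \<integral>\<^sup>+x. indicator K h * (indicator (- E) x * indicator U (x + h)) \<partial>lborel \<partial>lborel) + triple_int K E U
      = (\<integral>\<^sup>+h. \<integral>\<^sup>+x. indicator K h * (indicator (- E) x * indicator U (x + h))
           + indicator K h * indicator E x * indicator U (h + x) \<partial>lborel \<partial>lborel)"
      unfolding triple_int_def by (simp add: nn_integral_add)
    also have "\<dots> = (\<integral>\<^sup>+h. \<integral>\<^sup>+x. indicator K h * indicator U (h + x) \<partial>lborel \<partial>lborel)"
      by (intro nn_integral_cong) (auto simp: indicator_def add.commute)
    also have "\<dots> = (\<integral>\<^sup>+h. indicator K h * (\<integral>\<^sup>+x. indicator U (h + x) \<partial>lborel) \<partial>lborel)"
      by (simp add: nn_integral_cmult)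
    also have "\<dots> = emeasure lborel K * emeasure lborel U"
      by (subst nn_integral_lborel_translate) (auto simp: nn_integral_multc)
    finally show ?thesis .
  qed
  have sum2: "(\<integral>\<^sup>+h. \<integral>\<^sup>+x. indicator K h * (indicator (- E) (x + h) * indicator U x) \<partial>lborel \<partial>lborel) + triple_int K U E
      = emeasure lborel K * emeasure lborel U"
    if [measurable]: "K \<in> sets borel" "E \<in> sets borel" "U \<in> sets borel" for K E U :: "'a set"
  proof -
    have "(\<integral>\<^sup>+h. \<integral>\<^sup>+x. indicator K h * (indicator (- E) (x + h) * indicator U x) \<partial>lborel \<partial>lborel) + triple_int K U E
      = (\<integral>\<^sup>+h. \<integral>\<^sup>+x. indicator K h * (indicator (- E) (x + h) * indicator U x)
           + indicator K h * indicator U x * indicator E (h + x) \<partial>lborel \<partial>lborel)"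
      unfolding triple_int_def by (simp add: nn_integral_add)
    also have "\<dots> = (\<integral>\<^sup>+h. \<integral>\<^sup>+x. indicator K h * indicator U x \<partial>lborel \<partial>lborel)"
      by (intro nn_integral_cong) (auto simp: indicator_def add.commute)
    also have "\<dots> = emeasure lborel K * emeasure lborel U"
      by (simp add: nn_integral_cmult nn_integral_multc)
    finally show ?thesis .
  qed
  have cancel: "X' \<le> X" if "X + T = M" "X' + T' = M" "T \<le> T'" "T' < \<infinity>" for X X' T T' M :: ennreal
  proof -
    have "X' + T' \<le> X + T'" using that by (metis add_left_mono)
    then show ?thesis using that(4) by (auto simp: add.commute ennreal_add_left_cancel_le)
  qed
  have fin: "triple_int (ball (0::'a) k) S T < \<infinity>" if "S \<in> sets borel" "T \<in> sets borel" "emeasure lborel S < \<infinity>" for S T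
  proof -
    have "triple_int (ball (0::'a) k) S T \<le> emeasure lborel (ball (0::'a) k) * emeasure lborel S"
      using that by (intro triple_int_le_mult) auto
    also have "\<dots> < \<infinity>" using that(3) emeasure_lborel_ball_finite[of "0::'a" k] by (simp add: ennreal_mult_less_top)
    finally show ?thesis .
  qed
  have bb: "ball (0::'a) s \<in> sets borel" "emeasure lborel (ball (0::'a) s) < \<infinity>" for s
    using emeasure_lborel_ball_finite[of "0::'a" s] by auto
  note kb = \<open>K \<in> sets borel\<close> \<open>E \<in> sets borel\<close> \<open>U \<in> sets borel\<close>
  have M: "emeasure lborel (ball (0::'a) k) * emeasure lborel (ball (0::'a) w) = emeasure lborel K * emeasure lborel U"
    unfolding eq ..
  show ?one
    by (rule cancel[OF sum1[OF kb] sum1[OF bb(1)[of k] bb(1)[of e] bb(1)[of w], unfolded M] riesz_rearrangement[OF fm(1,2,3) eq(1,2,3)]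
          fin[OF bb(1) bb(1) bb(2)]])
  show ?two
    by (rule cancel[OF sum2[OF kb] sum2[OF bb(1)[of k] bb(1)[of e] bb(1)[of w], unfolded M] riesz_rearrangement[OF fm(1,3,2) eq(1,3,2)]
          fin[OF bb(1) bb(1) bb(2)]])
qed

lemma fmeasurable_superlevel:
  fixes f :: "'a::euclidean_space \<Rightarrow> real"
  assumes [measurable]: "f \<in> borel_measurable borel" and p: "1 \<le> p"
    and fin: "(\<integral>\<^sup>+x. ennreal (\<bar>f x\<bar> powr p) \<partial>lborel) < \<infinity>" and t: "0 < t"
  shows "{x. t < \<bar>f x\<bar>} \<in> fmeasurable lborel"
proof (rule fmeasurableI)
  have "emeasure lborel {x. t < \<bar>f x\<bar>} \<le> emeasure lborel {x \<in> space lborel. 1 \<le> ennreal (1 / t powr p) * ennreal (\<bar>f x\<bar> powr p)}"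
  proof (intro emeasure_mono subsetI; simp)
    fix x assume "t < \<bar>f x\<bar>"
    then have "t powr p \<le> \<bar>f x\<bar> powr p" using t p by (intro powr_mono2) auto
    then have "1 \<le> 1 / t powr p * \<bar>f x\<bar> powr p" using t by (simp add: field_simps)
    then have "ennreal 1 \<le> ennreal (1 / t powr p * \<bar>f x\<bar> powr p)" by (rule ennreal_leI)
    then show "1 \<le> ennreal (1 / t powr p) * ennreal (\<bar>f x\<bar> powr p)"
      by (metis ennreal_1 ennreal_mult'' powr_ge_zero)
  qed
  also have "\<dots> \<le> ennreal (1 / t powr p) * (\<integral>\<^sup>+x. ennreal (\<bar>f x\<bar> powr p) * indicator (space lborel) x \<partial>lborel)"
    using nn_integral_Markov_inequality[of "\<lambda>x. ennreal (\<bar>f x\<bar> powr p)" "space lborel" lborel "ennreal (1 / t powr p)"] by simp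
  also have "\<dots> < \<infinity>" using fin by (simp add: ennreal_mult_less_top)
  finally show "emeasure lborel {x. t < \<bar>f x\<bar>} < \<infinity>" .
qed simp

text \<open>Integrating over the shifts \<open>h\<close> in \<open>K\<close> supplies the third set
  of the Riesz inequality. For fixed \<open>t\<close> and \<open>r\<close> the integrand involves
  only \<open>K\<close>, a superlevel set \<open>U\<close> and the complement of a superlevel set
  \<open>E\<close>, once in each order.\<close>

lemma diff_energy_riesz:
  fixes f F :: "'a::euclidean_space \<Rightarrow> real"
  assumes f [measurable]: "f \<in> borel_measurable borel" and p: "1 \<le> p"
    and fin: "(\<integral>\<^sup>+x. ennreal (\<bar>f x\<bar> powr p) \<partial>lborel) < \<infinity>"
    and sym: "symmetrization_of F f"
    and K: "K \<in> fmeasurable lborel" "emeasure lborel K = emeasure lborel (ball (0::'a) k)"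
  shows "(\<integral>\<^sup>+h. indicator (ball 0 k) h * diff_energy p F h \<partial>lborel)
       \<le> (\<integral>\<^sup>+h. indicator K h * diff_energy p f h \<partial>lborel)"
proof -
  have F [measurable]: "F \<in> borel_measurable borel" and F0: "\<And>x. 0 \<le> F x"
    using sym by (auto simp: symmetrization_of_def)
  have Kb [measurable]: "K \<in> sets borel" using K by (auto dest: fmeasurableD)
  have swap: "(\<integral>\<^sup>+h. indicator S h * diff_energy p g h \<partial>lborel)
     = (\<integral>\<^sup>+t. \<integral>\<^sup>+r. \<integral>\<^sup>+h. \<integral>\<^sup>+x. indicator S h * layers p t r (g (x + h)) (g x) \<partial>lborel \<partial>lborel \<partial>lborel \<partial>lborel)"
    if [measurable]: "g \<in> borel_measurable borel" "S \<in> sets borel" and g0: "\<And>x. 0 \<le> g x" for g :: "'a \<Rightarrow> real" and S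
  proof -
    let ?L = "\<lambda>t r h x. indicator S h * layers p t r (g (x + h)) (g x) :: ennreal"
    have "(\<integral>\<^sup>+h. indicator S h * diff_energy p g h \<partial>lborel)
       = (\<integral>\<^sup>+h. indicator S h * (\<integral>\<^sup>+x. \<integral>\<^sup>+t. \<integral>\<^sup>+r. layers p t r (g (x + h)) (g x) \<partial>lborel \<partial>lborel \<partial>lborel) \<partial>lborel)"
      unfolding diff_energy_def by (simp add: powr_diff_layers[OF p g0 g0])
    also have "\<dots> = (\<integral>\<^sup>+h. \<integral>\<^sup>+x. \<integral>\<^sup>+t. \<integral>\<^sup>+r. ?L t r h x \<partial>lborel \<partial>lborel \<partial>lborel \<partial>lborel)"
      by (simp add: nn_integral_cmult)
    also have "\<dots> = (\<integral>\<^sup>+h. \<integral>\<^sup>+t. \<integral>\<^sup>+x. \<integral>\<^sup>+r. ?L t r h x \<partial>lborel \<partial>lborel \<partial>lborel \<partial>lborel)"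
      by (intro nn_integral_cong lborel_pair.Fubini') measurable
    also have "\<dots> = (\<integral>\<^sup>+h. \<integral>\<^sup>+t. \<integral>\<^sup>+r. \<integral>\<^sup>+x. ?L t r h x \<partial>lborel \<partial>lborel \<partial>lborel \<partial>lborel)"
      by (intro nn_integral_cong lborel_pair.Fubini') measurable
    also have "\<dots> = (\<integral>\<^sup>+t. \<integral>\<^sup>+h. \<integral>\<^sup>+r. \<integral>\<^sup>+x. ?L t r h x \<partial>lborel \<partial>lborel \<partial>lborel \<partial>lborel)"
      by (intro lborel_pair.Fubini') measurable
    also have "\<dots> = (\<integral>\<^sup>+t. \<integral>\<^sup>+r. \<integral>\<^sup>+h. \<integral>\<^sup>+x. ?L t r h x \<partial>lborel \<partial>lborel \<partial>lborel \<partial>lborel)"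
      by (intro nn_integral_cong lborel_pair.Fubini') measurable
    finally show ?thesis .
  qed
  have pt: "(\<integral>\<^sup>+h. \<integral>\<^sup>+x. indicator (ball 0 k) h * layers p t r (F (x + h)) (F x) \<partial>lborel \<partial>lborel)
     \<le> (\<integral>\<^sup>+h. \<integral>\<^sup>+x. indicator K h * layers p t r \<bar>f (x + h)\<bar> \<bar>f x\<bar> \<partial>lborel \<partial>lborel)" for t r
  proof (cases "0 < t \<and> 0 \<le> r")
    case False
    then have "layers p t r a b = 0" for a b by (auto simp: layers_def)
    then show ?thesis by simp
  next
    case True
    then have t: "0 < t" and r: "0 \<le> r" by auto
    from layer_superlevel[OF p r, of t] show ?thesis
    proof
      assume "\<forall>a. \<not> r < layer p t a"
      then have "layers p t r a b = 0" for a b by (auto simp: layers_def)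
      then show ?thesis by simp
    next
      assume "\<exists>v\<ge>t. \<forall>a. r < layer p t a \<longleftrightarrow> v < a"
      then obtain v where v: "t \<le> v" "\<And>a. r < layer p t a \<longleftrightarrow> v < a" by blast
      obtain e where e: "emeasure lborel {x. t < \<bar>f x\<bar>} = emeasure lborel (ball (0::'a) e)"
        "AE x in lborel. t < F x \<longleftrightarrow> x \<in> ball 0 e"
        using sym t unfolding symmetrization_of_def by blast
      obtain w where w: "emeasure lborel {x. v < \<bar>f x\<bar>} = emeasure lborel (ball (0::'a) w)"
        "AE x in lborel. v < F x \<longleftrightarrow> x \<in> ball 0 w"
        using sym t v(1) unfolding symmetrization_of_def by (meson less_le_trans)
      define E where "E = {x. t < \<bar>f x\<bar>}"
      define U where "U = {x. v < \<bar>f x\<bar>}"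
      have fE: "E \<in> fmeasurable lborel" unfolding E_def by (rule fmeasurable_superlevel[OF f p fin t])
      have fU: "U \<in> fmeasurable lborel" unfolding U_def using t v(1) by (intro fmeasurable_superlevel[OF f p fin]) auto
      have [measurable]: "E \<in> sets borel" "U \<in> sets borel" unfolding E_def U_def by measurable
      define B where "B s = ball (0::'a) s" for s
      have [measurable]: "B s \<in> sets borel" for s unfolding B_def by simp
      have "(\<integral>\<^sup>+h. \<integral>\<^sup>+x. indicator (B k) h * layers p t r (F (x + h)) (F x) \<partial>lborel \<partial>lborel)
         = (\<integral>\<^sup>+h. \<integral>\<^sup>+x. indicator (B k) h * (indicator (- B e) x * indicator (B w) (x + h))
              + indicator (B k) h * (indicator (- B e) (x + h) * indicator (B w) x) \<partial>lborel \<partial>lborel)"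
      proof (rule nn_integral_cong, rule nn_integral_cong_AE)
        fix h
        show "AE x in lborel. indicator (B k) h * layers p t r (F (x + h)) (F x)
          = indicator (B k) h * (indicator (- B e) x * indicator (B w) (x + h))
              + indicator (B k) h * (indicator (- B e) (x + h) * indicator (B w) x)"
          using e(2) w(2) AE_lborel_translate[OF e(2), of h] AE_lborel_translate[OF w(2), of h]
          by eventually_elim (use t r in \<open>auto simp: layers_def v(2) indicator_def B_def not_less[symmetric]\<close>)
      qed
      also have "\<dots> = (\<integral>\<^sup>+h. \<integral>\<^sup>+x. indicator (B k) h * (indicator (- B e) x * indicator (B w) (x + h)) \<partial>lborel \<partial>lborel)
           + (\<integral>\<^sup>+h. \<integral>\<^sup>+x. indicator (B k) h * (indicator (- B e) (x + h) * indicator (B w) x) \<partial>lborel \<partial>lborel)"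
        by (simp add: nn_integral_add)
      also have "\<dots> \<le> (\<integral>\<^sup>+h. \<integral>\<^sup>+x. indicator K h * (indicator (- E) x * indicator U (x + h)) \<partial>lborel \<partial>lborel)
           + (\<integral>\<^sup>+h. \<integral>\<^sup>+x. indicator K h * (indicator (- E) (x + h) * indicator U x) \<partial>lborel \<partial>lborel)"
        unfolding B_def using riesz_complement[OF K(1) fE fU K(2)] e(1) w(1) unfolding E_def[symmetric] U_def[symmetric]
        by (intro add_mono) auto
      also have "\<dots> = (\<integral>\<^sup>+h. \<integral>\<^sup>+x. indicator K h * (indicator (- E) x * indicator U (x + h))
            + indicator K h * (indicator (- E) (x + h) * indicator U x) \<partial>lborel \<partial>lborel)"
        by (simp add: nn_integral_add)
      also have "\<dots> = (\<integral>\<^sup>+h. \<integral>\<^sup>+x. indicator K h * layers p t r \<bar>f (x + h)\<bar> \<bar>f x\<bar> \<partial>lborel \<partial>lborel)"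
        using t r by (intro nn_integral_cong) (auto simp: layers_def v(2) indicator_def E_def U_def)
      finally show ?thesis unfolding B_def .
    qed
  qed
  have "(\<integral>\<^sup>+h. indicator (ball 0 k) h * diff_energy p F h \<partial>lborel)
     \<le> (\<integral>\<^sup>+h. indicator K h * diff_energy p (\<lambda>x. \<bar>f x\<bar>) h \<partial>lborel)"
    by (subst (1 2) swap) (auto simp: F0 intro!: nn_integral_mono pt)
  \<comment> \<open>The symmetral sees only \<open>\<bar>f\<bar>\<close>; the passage to
    \<open>f\<close> is the reverse triangle inequality inside the power.\<close>
  also have "\<dots> \<le> (\<integral>\<^sup>+h. indicator K h * diff_energy p f h \<partial>lborel)"
    unfolding diff_energy_def using p
    by (intro nn_integral_mono mult_left_mono ennreal_leI powr_mono2) auto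
  finally show ?thesis .
qed

section \<open>Comparison of homogeneous gauges\<close>

lemma nn_integral_lborel_scale:
  fixes F :: "'a::euclidean_space \<Rightarrow> ennreal"
  assumes [measurable]: "F \<in> borel_measurable borel" and c: "0 < c"
  shows "(\<integral>\<^sup>+x. F x \<partial>lborel) = ennreal (c ^ DIM('a)) * (\<integral>\<^sup>+x. F (c *\<^sub>R x) \<partial>lborel)"
proof -
  have "(\<integral>\<^sup>+x. F x \<partial>lborel) = (\<integral>\<^sup>+x. F x \<partial>(density (distr lborel borel (\<lambda>x. 0 + c *\<^sub>R x)) (\<lambda>_. ennreal (\<bar>c\<bar> ^ DIM('a)))))"
    using c by (subst lborel_affine[of c "0::'a"]) auto
  also have "\<dots> = ennreal (c ^ DIM('a)) * (\<integral>\<^sup>+x. F (c *\<^sub>R x) \<partial>lborel)"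
    using c by (simp add: nn_integral_density nn_integral_distr nn_integral_cmult)
  finally show ?thesis .
qed

text \<open>This form of comparison survives truncation at a level, concave powers, dilation of the
  variable and integration over dilates, which is all that separates difference energies from
  gauges. Monotonicity of \<open>\<psi>\<close> along rays is not asked for.\<close>

definition rearr_dom :: "('a::euclidean_space \<Rightarrow> ennreal) \<Rightarrow> ('a \<Rightarrow> ennreal) \<Rightarrow> bool" where
  "rearr_dom \<psi> \<phi> \<longleftrightarrow> (\<forall>K k. K \<in> fmeasurable lborel \<longrightarrow> emeasure lborel K = emeasure lborel (ball (0::'a) k) \<longrightarrow>
     (\<integral>\<^sup>+h. indicator (ball 0 k) h * \<psi> h \<partial>lborel) \<le> (\<integral>\<^sup>+h. indicator K h * \<phi> h \<partial>lborel))"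

lemma rearr_domI:
  fixes \<psi> \<phi> :: "'a::euclidean_space \<Rightarrow> ennreal"
  assumes "\<And>K k. K \<in> fmeasurable lborel \<Longrightarrow> K \<in> sets borel \<Longrightarrow> emeasure lborel K = emeasure lborel (ball (0::'a) k) \<Longrightarrow>
     (\<integral>\<^sup>+h. indicator (ball 0 k) h * \<psi> h \<partial>lborel) \<le> (\<integral>\<^sup>+h. indicator K h * \<phi> h \<partial>lborel)"
  shows "rearr_dom \<psi> \<phi>"
  unfolding rearr_dom_def by (intro allI impI assms) (auto dest: fmeasurableD)

lemma rearr_domD:
  fixes \<psi> \<phi> :: "'a::euclidean_space \<Rightarrow> ennreal"
  assumes "rearr_dom \<psi> \<phi>" "K \<in> fmeasurable lborel" "emeasure lborel K = emeasure lborel (ball (0::'a) k)"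
  shows "(\<integral>\<^sup>+h. indicator (ball 0 k) h * \<psi> h \<partial>lborel) \<le> (\<integral>\<^sup>+h. indicator K h * \<phi> h \<partial>lborel)"
  using assms unfolding rearr_dom_def by blast

text \<open>The hypothesis is applied to the part \<open>K'\<close> of \<open>K\<close> where
  \<open>\<phi> \<le> c\<close>. On the remainder \<open>min (\<phi> h) c\<close> equals
  \<open>c\<close>, while \<open>min (\<psi> h) c\<close> is at most \<open>c\<close> on the
  remainder of the ball, and both remainders have the same volume.\<close>

lemma rearr_dom_min:
  fixes \<phi> \<psi> :: "'a::euclidean_space \<Rightarrow> ennreal"
  assumes [measurable]: "\<phi> \<in> borel_measurable borel" "\<psi> \<in> borel_measurable borel" and dom: "rearr_dom \<psi> \<phi>"
  shows "rearr_dom (\<lambda>h. min (\<psi> h) c) (\<lambda>h. min (\<phi> h) c)"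
proof (rule rearr_domI)
  fix K :: "'a set" and k
  assume K: "K \<in> fmeasurable lborel" "emeasure lborel K = emeasure lborel (ball (0::'a) k)"
    and [measurable]: "K \<in> sets borel"
  define K' where "K' = {h \<in> K. \<phi> h \<le> c}"
  have [measurable]: "K' \<in> sets borel" unfolding K'_def by simp
  have sub: "K' \<subseteq> K" unfolding K'_def by auto
  have le: "emeasure lborel K' \<le> emeasure lborel K" using sub by (intro emeasure_mono) auto
  obtain k' where k': "k' \<le> k" "emeasure lborel (ball (0::'a) k') = emeasure lborel K'"
    using exists_smaller_ball_radius[OF le[unfolded K(2)]] by blast
  have fK': "K' \<in> fmeasurable lborel" using K(1) sub by (rule fmeasurableI2) simp
  have finK': "emeasure lborel K' \<noteq> \<infinity>" using fK' by (auto simp: fmeasurable_def)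
  have "emeasure lborel (K - K') = emeasure lborel K - emeasure lborel K'"
    using finK' sub by (intro emeasure_Diff) auto
  also have "\<dots> = emeasure lborel (ball (0::'a) k - ball 0 k')"
    using finK' k' K(2) by (subst emeasure_Diff) auto
  finally have eqd: "emeasure lborel (K - K') = emeasure lborel (ball (0::'a) k - ball 0 k')" .
  have "(\<integral>\<^sup>+h. indicator (ball 0 k) h * min (\<psi> h) c \<partial>lborel)
     \<le> (\<integral>\<^sup>+h. indicator (ball 0 k') h * \<psi> h + c * indicator (ball 0 k - ball 0 k') h \<partial>lborel)"
    using k'(1) by (intro nn_integral_mono) (auto simp: indicator_def)
  also have "\<dots> = (\<integral>\<^sup>+h. indicator (ball 0 k') h * \<psi> h \<partial>lborel) + c * emeasure lborel (ball (0::'a) k - ball 0 k')"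
    by (subst nn_integral_add) (auto simp: nn_integral_cmult_indicator)
  also have "\<dots> \<le> (\<integral>\<^sup>+h. indicator K' h * \<phi> h \<partial>lborel) + c * emeasure lborel (K - K')"
    unfolding eqd by (intro add_right_mono rearr_domD[OF dom fK']) (simp add: k')
  also have "\<dots> = (\<integral>\<^sup>+h. indicator K' h * \<phi> h + c * indicator (K - K') h \<partial>lborel)"
    by (subst nn_integral_add) (auto simp: nn_integral_cmult_indicator)
  also have "\<dots> = (\<integral>\<^sup>+h. indicator K h * min (\<phi> h) c \<partial>lborel)"
    unfolding K'_def by (intro nn_integral_cong) (auto simp: indicator_def min_def)
  finally show "(\<integral>\<^sup>+h. indicator (ball 0 k) h * min (\<psi> h) c \<partial>lborel) \<le> (\<integral>\<^sup>+h. indicator K h * min (\<phi> h) c \<partial>lborel)" .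
qed

text \<open>By \<open>rearr_dom_min\<close> and this representation, \<open>rearr_dom\<close> is inherited by concave powers.\<close>

lemma powr_as_min_integral:
  fixes x \<theta> :: real
  assumes \<theta>: "0 < \<theta>" "\<theta> < 1" and x: "0 \<le> x"
  shows "(\<integral>\<^sup>+c. indicator {0<..} c * (min (ennreal x) (ennreal c) * ennreal (c powr (\<theta> - 2))) \<partial>lborel)
     = ennreal (1 / \<theta> + 1 / (1 - \<theta>)) * ennreal (x powr \<theta>)"
proof (cases "x = 0")
  case False
  with x have x0: "0 < x" by simp
  have 1: "(\<integral>\<^sup>+c. ennreal (c powr (\<theta> - 1)) * indicator {0..x} c \<partial>lborel) = ennreal (x powr \<theta> / \<theta>)"
    using nn_integral_has_integral_lebesgue'[OF _ has_integral_powr_from_0[of "\<theta> - 1" x]] \<theta> x by simp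
  have 2: "(\<integral>\<^sup>+c. ennreal (c powr (\<theta> - 2)) * indicator {x..} c \<partial>lborel) = ennreal (x powr (\<theta> - 1) / (1 - \<theta>))"
    using nn_integral_has_integral_lebesgue'[OF _ has_integral_powr_to_inf[of "\<theta> - 2" x]] \<theta> x0
    by (simp add: minus_divide_right)
  have "(\<integral>\<^sup>+c. indicator {0<..} c * (min (ennreal x) (ennreal c) * ennreal (c powr (\<theta> - 2))) \<partial>lborel)
    = (\<integral>\<^sup>+c. ennreal (c powr (\<theta> - 1)) * indicator {0..x} c + ennreal x * (ennreal (c powr (\<theta> - 2)) * indicator {x..} c) \<partial>lborel)"
  proof (rule nn_integral_cong_AE)
    have "AE c in lborel. c \<noteq> x" by (rule AE_lborel_singleton)
    then show "AE c in lborel. indicator {0<..} c * (min (ennreal x) (ennreal c) * ennreal (c powr (\<theta> - 2)))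
      = ennreal (c powr (\<theta> - 1)) * indicator {0..x} c + ennreal x * (ennreal (c powr (\<theta> - 2)) * indicator {x..} c)"
    proof eventually_elim
      case (elim c)
      have "c * c powr (\<theta> - 2) = c powr (\<theta> - 1)" if "0 < c"
        using that powr_add[of c 1 "\<theta> - 2"] by simp
      then have "ennreal c * ennreal (c powr (\<theta> - 2)) = ennreal (c powr (\<theta> - 1))" if "0 < c"
        using that by (simp flip: ennreal_mult)
      then show ?case using elim x0 by (auto simp: indicator_def min_def ennreal_le_iff2)
    qed
  qed
  also have "\<dots> = ennreal (x powr \<theta> / \<theta>) + ennreal x * ennreal (x powr (\<theta> - 1) / (1 - \<theta>))"
    by (simp add: nn_integral_add nn_integral_cmult 1 2)
  also have "\<dots> = ennreal (x powr \<theta> / \<theta> + x * (x powr (\<theta> - 1) / (1 - \<theta>)))"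
    using \<theta> x0 by (simp flip: ennreal_mult ennreal_plus)
  also have "x * (x powr (\<theta> - 1) / (1 - \<theta>)) = x powr \<theta> / (1 - \<theta>)"
    using x0 powr_add[of x 1 "\<theta> - 1"] by simp
  also have "x powr \<theta> / \<theta> + x powr \<theta> / (1 - \<theta>) = (1 / \<theta> + 1 / (1 - \<theta>)) * x powr \<theta>"
    by (simp add: distrib_right)
  finally show ?thesis using \<theta> by (simp add: ennreal_mult)
qed (simp add: min_def)

lemma rearr_dom_powr:
  fixes \<phi> \<psi> :: "'a::euclidean_space \<Rightarrow> real"
  assumes [measurable]: "\<phi> \<in> borel_measurable borel" "\<psi> \<in> borel_measurable borel"
    and nonneg: "\<And>h. 0 \<le> \<phi> h" "\<And>h. 0 \<le> \<psi> h"
    and dom: "rearr_dom (\<lambda>h. ennreal (\<psi> h)) (\<lambda>h. ennreal (\<phi> h))" and \<theta>: "0 < \<theta>" "\<theta> \<le> 1"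
  shows "rearr_dom (\<lambda>h. ennreal (\<psi> h powr \<theta>)) (\<lambda>h. ennreal (\<phi> h powr \<theta>))"
proof (cases "\<theta> = 1")
  case True
  then show ?thesis using dom nonneg by simp
next
  case False
  with \<theta> have \<theta>1: "\<theta> < 1" by simp
  define \<kappa> where "\<kappa> = 1 / \<theta> + 1 / (1 - \<theta>)"
  have \<kappa>: "0 < \<kappa>" unfolding \<kappa>_def using \<theta> \<theta>1 by (simp add: add_pos_pos)
  have rep: "ennreal \<kappa> * (\<integral>\<^sup>+h. indicator S h * ennreal (g h powr \<theta>) \<partial>lborel)
     = (\<integral>\<^sup>+c. indicator {0<..} c * ennreal (c powr (\<theta> - 2)) * (\<integral>\<^sup>+h. indicator S h * min (ennreal (g h)) (ennreal c) \<partial>lborel) \<partial>lborel)"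
    if [measurable]: "S \<in> sets borel" "g \<in> borel_measurable borel" and g: "\<And>h. 0 \<le> g h" for S :: "'a set" and g
  proof -
    let ?L = "\<lambda>c h. indicator S h * (indicator {0<..} c * (min (ennreal (g h)) (ennreal c) * ennreal (c powr (\<theta> - 2)))) :: ennreal"
    have "ennreal \<kappa> * (\<integral>\<^sup>+h. indicator S h * ennreal (g h powr \<theta>) \<partial>lborel)
      = (\<integral>\<^sup>+h. indicator S h * (ennreal \<kappa> * ennreal (g h powr \<theta>)) \<partial>lborel)"
      by (subst nn_integral_cmult[symmetric]) (auto simp: mult.left_commute)
    also have "\<dots> = (\<integral>\<^sup>+h. indicator S h * (\<integral>\<^sup>+c. indicator {0<..} c * (min (ennreal (g h)) (ennreal c) * ennreal (c powr (\<theta> - 2))) \<partial>lborel) \<partial>lborel)"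
      unfolding powr_as_min_integral[OF \<theta>(1) \<theta>1 g] \<kappa>_def ..
    also have "\<dots> = (\<integral>\<^sup>+h. \<integral>\<^sup>+c. ?L c h \<partial>lborel \<partial>lborel)"
      by (intro nn_integral_cong nn_integral_cmult[symmetric]) measurable
    also have "\<dots> = (\<integral>\<^sup>+c. \<integral>\<^sup>+h. ?L c h \<partial>lborel \<partial>lborel)"
      by (rule lborel_pair.Fubini') measurable
    also have "\<dots> = (\<integral>\<^sup>+c. \<integral>\<^sup>+h. indicator {0<..} c * ennreal (c powr (\<theta> - 2)) * (indicator S h * min (ennreal (g h)) (ennreal c)) \<partial>lborel \<partial>lborel)"
      by (simp only: ac_simps)
    also have "\<dots> = (\<integral>\<^sup>+c. indicator {0<..} c * ennreal (c powr (\<theta> - 2)) * (\<integral>\<^sup>+h. indicator S h * min (ennreal (g h)) (ennreal c) \<partial>lborel) \<partial>lborel)"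
      by (intro nn_integral_cong nn_integral_cmult) measurable
    finally show ?thesis .
  qed
  show ?thesis
  proof (rule rearr_domI)
    fix K :: "'a set" and k
    assume K: "K \<in> fmeasurable lborel" "K \<in> sets borel" "emeasure lborel K = emeasure lborel (ball (0::'a) k)"
    have "ennreal \<kappa> * (\<integral>\<^sup>+h. indicator (ball 0 k) h * ennreal (\<psi> h powr \<theta>) \<partial>lborel)
       \<le> ennreal \<kappa> * (\<integral>\<^sup>+h. indicator K h * ennreal (\<phi> h powr \<theta>) \<partial>lborel)"
      using K nonneg
      by (subst (1 2) rep)
        (auto intro!: nn_integral_mono[OF mult_left_mono] rearr_domD[OF rearr_dom_min[OF _ _ dom]])
    then show "(\<integral>\<^sup>+h. indicator (ball 0 k) h * ennreal (\<psi> h powr \<theta>) \<partial>lborel)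
       \<le> (\<integral>\<^sup>+h. indicator K h * ennreal (\<phi> h powr \<theta>) \<partial>lborel)"
      using \<kappa> by (simp add: ennreal_mult_le_mult_iff)
  qed
qed

section \<open>Sublevel sets of homogeneous functions\<close>

definition homogeneous :: "real \<Rightarrow> ('a::euclidean_space \<Rightarrow> ennreal) \<Rightarrow> bool" where
  "homogeneous a g \<longleftrightarrow> (\<forall>c>0. \<forall>z. g (c *\<^sub>R z) = ennreal (c powr a) * g z)"

lemma emeasure_sublevel_homogeneous:
  fixes g :: "'a::euclidean_space \<Rightarrow> ennreal"
  assumes [measurable]: "g \<in> borel_measurable borel" and hom: "homogeneous a g" and a: "0 < a" and \<mu>: "0 < \<mu>"
  shows "emeasure lborel {z. g z \<le> ennreal \<mu>} = ennreal (\<mu> powr (DIM('a) / a)) * emeasure lborel {z. g z \<le> 1}"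
proof -
  define c where "c = \<mu> powr (1 / a)"
  have c: "0 < c" "c powr a = \<mu>" "c ^ DIM('a) = \<mu> powr (DIM('a) / a)"
    unfolding c_def using \<mu> a by (auto simp: powr_powr powr_realpow[symmetric])
  have "g (c *\<^sub>R z) \<le> ennreal \<mu> \<longleftrightarrow> g z \<le> 1" for z
  proof -
    have "g (c *\<^sub>R z) = ennreal \<mu> * g z" using hom c unfolding homogeneous_def by simp
    then show ?thesis using ennreal_mult_le_mult_iff[of "ennreal \<mu>" "g z" 1] \<mu> by simp
  qed
  then have i: "indicator {z. g z \<le> ennreal \<mu>} (c *\<^sub>R z) = (indicator {z. g z \<le> 1} z :: ennreal)" for z
    by (auto simp: indicator_def)
  have "emeasure lborel {z. g z \<le> ennreal \<mu>} = (\<integral>\<^sup>+z. indicator {z. g z \<le> ennreal \<mu>} z \<partial>lborel)" by simp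
  also have "\<dots> = ennreal (c ^ DIM('a)) * (\<integral>\<^sup>+z. indicator {z. g z \<le> 1} z \<partial>lborel)"
    unfolding i[symmetric] using c(1) by (intro nn_integral_lborel_scale) auto
  finally show ?thesis unfolding c(3) by simp
qed

text \<open>Layer cake over the levels \<open>\<mu>\<close> in \<open>{0<..1}\<close>: the sublevel
  set at \<open>\<mu>\<close> has \<open>\<mu> powr (n / a)\<close> times the volume of the one at
  1, with \<open>n\<close> the dimension, and the factor is the integral of this power. Subtraction
  in \<open>ennreal\<close> is truncated, so the region \<open>g \<ge> 1\<close> contributes
  nothing.\<close>

lemma one_minus_integral:
  fixes g :: "'a::euclidean_space \<Rightarrow> ennreal"
  assumes [measurable]: "g \<in> borel_measurable borel" and hom: "homogeneous a g" and a: "0 < a"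
  shows "(\<integral>\<^sup>+z. 1 - g z \<partial>lborel) = ennreal (1 / (DIM('a) / a + 1)) * emeasure lborel {z. g z \<le> 1}"
proof -
  define \<kappa> where "\<kappa> = DIM('a) / a"
  have \<kappa>: "0 < \<kappa>" unfolding \<kappa>_def using a by simp
  have lay: "1 - x = (\<integral>\<^sup>+\<mu>. (if x \<le> ennreal \<mu> then indicator {0<..1} \<mu> else 0) \<partial>lborel)" for x :: ennreal
  proof (cases x)
    case (real r)
    have "(\<integral>\<^sup>+\<mu>. (if x \<le> ennreal \<mu> then indicator {0<..1} \<mu> else 0) \<partial>lborel) = (\<integral>\<^sup>+\<mu>. indicator {r..1} \<mu> \<partial>lborel)"
    proof (rule nn_integral_cong_AE)
      have "AE \<mu> in lborel. \<mu> \<noteq> (0::real)" by (rule AE_lborel_singleton)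
      then show "AE \<mu> in lborel. (if x \<le> ennreal \<mu> then indicator {0<..1} \<mu> else 0) = (indicator {r..1} \<mu> :: ennreal)"
        by eventually_elim (use real in \<open>auto simp: indicator_def ennreal_le_iff2\<close>)
    qed
    also have "\<dots> = ennreal (1 - r)" by (cases "r \<le> 1") (auto simp: ennreal_neg)
    also have "\<dots> = 1 - x" using real by (metis ennreal_1 ennreal_minus)
    finally show ?thesis by simp
  qed (simp add: top_unique diff_eq_0_iff_ennreal)
  have "(\<integral>\<^sup>+z. 1 - g z \<partial>lborel) = (\<integral>\<^sup>+z. \<integral>\<^sup>+\<mu>. (if g z \<le> ennreal \<mu> then indicator {0<..1} \<mu> else 0) \<partial>lborel \<partial>lborel)"
    by (simp only: lay)
  also have "\<dots> = (\<integral>\<^sup>+\<mu>. \<integral>\<^sup>+z. (if g z \<le> ennreal \<mu> then indicator {0<..1} \<mu> else 0) \<partial>lborel \<partial>lborel)"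
    by (rule lborel_pair.Fubini') measurable
  also have "\<dots> = (\<integral>\<^sup>+\<mu>. indicator {0<..1} \<mu> * emeasure lborel {z. g z \<le> ennreal \<mu>} \<partial>lborel)"
  proof (intro nn_integral_cong)
    fix \<mu> :: real
    have "(\<integral>\<^sup>+z. (if g z \<le> ennreal \<mu> then indicator {0<..1} \<mu> else 0) \<partial>lborel)
       = (\<integral>\<^sup>+z. indicator {0<..1} \<mu> * indicator {z. g z \<le> ennreal \<mu>} z \<partial>lborel)"
      by (intro nn_integral_cong) (auto simp: indicator_def)
    also have "\<dots> = indicator {0<..1} \<mu> * emeasure lborel {z. g z \<le> ennreal \<mu>}"
      by (rule nn_integral_cmult_indicator) simp
    finally show "(\<integral>\<^sup>+z. (if g z \<le> ennreal \<mu> then indicator {0<..1} \<mu> else 0) \<partial>lborel)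
      = indicator {0<..1} \<mu> * emeasure lborel {z. g z \<le> ennreal \<mu>}" .
  qed
  also have "\<dots> = (\<integral>\<^sup>+\<mu>. (ennreal (\<mu> powr \<kappa>) * indicator {0..1} \<mu>) * emeasure lborel {z. g z \<le> 1} \<partial>lborel)"
  proof (intro nn_integral_cong)
    fix \<mu> :: real
    show "indicator {0<..1} \<mu> * emeasure lborel {z. g z \<le> ennreal \<mu>}
      = (ennreal (\<mu> powr \<kappa>) * indicator {0..1} \<mu>) * emeasure lborel {z. g z \<le> 1}"
      using emeasure_sublevel_homogeneous[OF assms, of \<mu>] by (cases "0 < \<mu>") (auto simp: indicator_def \<kappa>_def)
  qed
  also have "\<dots> = ennreal (1 / (\<kappa> + 1)) * emeasure lborel {z. g z \<le> 1}"
    using nn_integral_has_integral_lebesgue'[OF _ has_integral_powr_from_0[of \<kappa> 1]] \<kappa>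
    by (subst nn_integral_multc) auto
  finally show ?thesis unfolding \<kappa>_def .
qed

text \<open>Comparing the integrals of \<open>1 - g\<close> rather than of \<open>g\<close> also covers infinite volumes: by homogeneity they are the
  same multiple of the two volumes.\<close>

lemma sublevel_volume_mono:
  fixes g g' :: "'a::euclidean_space \<Rightarrow> ennreal"
  assumes [measurable]: "g \<in> borel_measurable borel" "g' \<in> borel_measurable borel"
    and hom: "homogeneous a g" "homogeneous a g'" and a: "0 < a" and dom: "rearr_dom g' g"
  shows "emeasure lborel {z. g z \<le> 1} \<le> emeasure lborel {z. g' z \<le> 1}"
proof -
  define K where "K n = {z. g z \<le> 1} \<inter> ball 0 (real n)" for n :: nat
  have [measurable]: "K n \<in> sets borel" for n unfolding K_def by simp
  \<comment> \<open>On \<open>K n\<close>, \<open>g\<close> and \<open>1 - g\<close> add up to 1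
    exactly; on the ball, \<open>g'\<close> and \<open>1 - g'\<close> add up to at least 1. The
    volumes are equal, so the inequality for \<open>g'\<close> and \<open>g\<close> turns round for
    the complements. The cut to a ball makes the subtracted integral finite.\<close>
  have key: "(\<integral>\<^sup>+z. indicator (K n) z * (1 - g z) \<partial>lborel) \<le> (\<integral>\<^sup>+z. 1 - g' z \<partial>lborel)" for n
  proof -
    have fK: "K n \<in> fmeasurable lborel" by (rule fmeasurable_subset_ball[of _ "real n"]) (auto simp: K_def)
    then have finK: "emeasure lborel (K n) < \<infinity>" by (simp add: fmeasurable_def)
    then obtain r where r: "emeasure lborel (ball (0::'a) r) = emeasure lborel (K n)"
      using exists_ball_radius by metis
    let ?I = "\<integral>\<^sup>+z. indicator (K n) z * g z \<partial>lborel" and ?I' = "\<integral>\<^sup>+z. 1 - g' z \<partial>lborel"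
    have "g z + (1 - g z) = 1" if "g z \<le> 1" for z
      using that by simp
    then have p1: "indicator (K n) z * g z + indicator (K n) z * (1 - g z) = indicator (K n) z" for z
      by (auto simp: indicator_def K_def)
    have s1: "?I + (\<integral>\<^sup>+z. indicator (K n) z * (1 - g z) \<partial>lborel) = emeasure lborel (K n)"
      by (subst nn_integral_add[symmetric]) (auto simp: p1)
    have p2: "1 \<le> g' z + (1 - g' z)" for z
      by (auto simp: add_diff_self_ennreal)
    have "emeasure lborel (K n) = (\<integral>\<^sup>+z. indicator (ball (0::'a) r) z \<partial>lborel)" by (simp add: r)
    also have "\<dots> \<le> (\<integral>\<^sup>+z. indicator (ball 0 r) z * g' z + (1 - g' z) \<partial>lborel)"
      using p2 by (intro nn_integral_mono) (auto simp: indicator_def)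
    also have "\<dots> = (\<integral>\<^sup>+z. indicator (ball 0 r) z * g' z \<partial>lborel) + ?I'"
      by (rule nn_integral_add) auto
    also have "\<dots> \<le> ?I + ?I'"
      by (intro add_right_mono rearr_domD[OF dom fK]) (simp add: r)
    finally have s2: "emeasure lborel (K n) \<le> \<dots>" .
    have "?I \<le> emeasure lborel (K n)"
      using s1 by (metis le_iff_add)
    then have "?I < \<infinity>" using finK by (rule le_less_trans)
    then show ?thesis using s2 unfolding s1[symmetric] by (auto simp: ennreal_add_left_cancel_le)
  qed
  have "(\<integral>\<^sup>+z. 1 - g z \<partial>lborel) = (\<integral>\<^sup>+z. (SUP n. indicator (K n) z * (1 - g z)) \<partial>lborel)"
  proof (intro nn_integral_cong antisym)
    fix z :: 'a
    obtain n :: nat where "norm z < real n" using reals_Archimedean2 by blast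
    then have "1 - g z \<le> indicator (K n) z * (1 - g z)"
      by (cases "g z \<le> 1") (auto simp: K_def indicator_def diff_eq_0_iff_ennreal)
    also have "\<dots> \<le> (SUP n. indicator (K n) z * (1 - g z))" by (intro SUP_upper) auto
    finally show "1 - g z \<le> (SUP n. indicator (K n) z * (1 - g z))" .
    show "(SUP n. indicator (K n) z * (1 - g z)) \<le> 1 - g z"
      by (intro SUP_least) (auto simp: indicator_def)
  qed
  also have "\<dots> = (SUP n. \<integral>\<^sup>+z. indicator (K n) z * (1 - g z) \<partial>lborel)"
    by (intro nn_integral_monotone_convergence_SUP incseq_SucI le_funI mult_right_mono)
       (auto simp: K_def indicator_def)
  also have "\<dots> \<le> (\<integral>\<^sup>+z. 1 - g' z \<partial>lborel)" by (intro SUP_least key)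
  finally have "ennreal (1 / (DIM('a) / a + 1)) * emeasure lborel {z. g z \<le> 1}
      \<le> ennreal (1 / (DIM('a) / a + 1)) * emeasure lborel {z. g' z \<le> 1}"
    using one_minus_integral[of g a] one_minus_integral[of g' a] hom a by simp
  moreover have "0 < 1 / (DIM('a) / a + 1)" using a by (simp add: add_pos_pos)
  ultimately show ?thesis
    by (subst (asm) ennreal_mult_le_mult_iff) (simp_all only: ennreal_eq_0_iff ennreal_neq_top not_le not_False_eq_True)
qed

section \<open>Fractional gauges\<close>

text \<open>With \<open>a = s * q\<close>, \<open>\<theta> = q / p\<close> and \<open>N\<close> the
  energy of differences this is \<open>gauge_pow\<close>. Keeping \<open>N\<close> arbitrary allows
  it to be used also on the real line, for the profile of a radial function.\<close>

definition frac_gauge :: "real \<Rightarrow> real \<Rightarrow> ('a::euclidean_space \<Rightarrow> real) \<Rightarrow> 'a \<Rightarrow> ennreal" where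
  "frac_gauge a \<theta> N z =
     (\<integral>\<^sup>+t. indicator {0<..} t * ennreal (t powr (- a) * N (t *\<^sub>R z) powr \<theta> / t) \<partial>lborel)"

lemma frac_gauge_measurable [measurable]:
  assumes [measurable]: "N \<in> borel_measurable borel"
  shows "frac_gauge a \<theta> N \<in> borel_measurable borel"
  unfolding frac_gauge_def by measurable

lemma homogeneous_frac_gauge:
  fixes N :: "'a::euclidean_space \<Rightarrow> real"
  assumes [measurable]: "N \<in> borel_measurable borel"
  shows "homogeneous a (frac_gauge a \<theta> N)"
  unfolding homogeneous_def
proof (intro allI impI)
  fix c :: real and z :: 'a assume c: "0 < c"
  have "frac_gauge a \<theta> N z
     = ennreal (c ^ DIM(real)) * (\<integral>\<^sup>+t. indicator {0<..} (c *\<^sub>R t) * ennreal ((c *\<^sub>R t) powr (- a) * N ((c *\<^sub>R t) *\<^sub>R z) powr \<theta> / (c *\<^sub>R t)) \<partial>lborel)"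
    unfolding frac_gauge_def using c by (intro nn_integral_lborel_scale) auto
  also have "\<dots> = (\<integral>\<^sup>+t. ennreal c * (indicator {0<..} (c *\<^sub>R t) * ennreal ((c *\<^sub>R t) powr (- a) * N ((c *\<^sub>R t) *\<^sub>R z) powr \<theta> / (c *\<^sub>R t))) \<partial>lborel)"
    using c by (subst nn_integral_cmult) auto
  also have "\<dots> = (\<integral>\<^sup>+t. ennreal (c powr (- a)) * (indicator {0<..} t * ennreal (t powr (- a) * N (t *\<^sub>R c *\<^sub>R z) powr \<theta> / t)) \<partial>lborel)"
    using c by (intro nn_integral_cong)
      (auto simp: indicator_def powr_mult zero_less_mult_iff mult.commute simp flip: ennreal_mult)
  also have "\<dots> = ennreal (c powr (- a)) * frac_gauge a \<theta> N (c *\<^sub>R z)"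
    unfolding frac_gauge_def by (rule nn_integral_cmult) measurable
  finally have "ennreal (c powr a) * frac_gauge a \<theta> N z = ennreal (c powr a * c powr (- a)) * frac_gauge a \<theta> N (c *\<^sub>R z)"
    by (simp add: ennreal_mult mult.assoc)
  also have "c powr a * c powr (- a) = 1" using c by (simp flip: powr_add)
  finally show "frac_gauge a \<theta> N (c *\<^sub>R z) = ennreal (c powr a) * frac_gauge a \<theta> N z" by simp
qed

lemma frac_gauge_integral:
  fixes N :: "'a::euclidean_space \<Rightarrow> real"
  assumes [measurable]: "N \<in> borel_measurable borel" "S \<in> sets borel"
  shows "(\<integral>\<^sup>+z. indicator S z * frac_gauge a \<theta> N z \<partial>lborel)
    = (\<integral>\<^sup>+t. indicator {0<..} t * ennreal (t powr (- a) / t) * (\<integral>\<^sup>+z. indicator S z * ennreal (N (t *\<^sub>R z) powr \<theta>) \<partial>lborel) \<partial>lborel)"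
proof -
  let ?L = "\<lambda>t z. indicator S z * (indicator {0<..} t * ennreal (t powr (- a) * N (t *\<^sub>R z) powr \<theta> / t)) :: ennreal"
  have "(\<integral>\<^sup>+z. indicator S z * frac_gauge a \<theta> N z \<partial>lborel)
     = (\<integral>\<^sup>+z. \<integral>\<^sup>+t. ?L t z \<partial>lborel \<partial>lborel)"
    unfolding frac_gauge_def by (intro nn_integral_cong nn_integral_cmult[symmetric]) measurable
  also have "\<dots> = (\<integral>\<^sup>+t. \<integral>\<^sup>+z. ?L t z \<partial>lborel \<partial>lborel)"
    by (rule lborel_pair.Fubini') measurable
  also have "\<dots> = (\<integral>\<^sup>+t. \<integral>\<^sup>+z. (indicator {0<..} t * ennreal (t powr (- a) / t)) * (indicator S z * ennreal (N (t *\<^sub>R z) powr \<theta>)) \<partial>lborel \<partial>lborel)"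
    by (intro nn_integral_cong) (auto simp: indicator_def simp flip: ennreal_mult)
  also have "\<dots> = (\<integral>\<^sup>+t. indicator {0<..} t * ennreal (t powr (- a) / t) * (\<integral>\<^sup>+z. indicator S z * ennreal (N (t *\<^sub>R z) powr \<theta>) \<partial>lborel) \<partial>lborel)"
    by (intro nn_integral_cong nn_integral_cmult) measurable
  finally show ?thesis .
qed

lemma rearr_dom_dilate:
  fixes \<phi> \<psi> :: "'a::euclidean_space \<Rightarrow> ennreal"
  assumes [measurable]: "\<phi> \<in> borel_measurable borel" "\<psi> \<in> borel_measurable borel"
    and dom: "rearr_dom \<psi> \<phi>" and t: "0 < t"
  shows "rearr_dom (\<lambda>z. \<psi> (t *\<^sub>R z)) (\<lambda>z. \<phi> (t *\<^sub>R z))"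
proof (rule rearr_domI)
  fix K :: "'a set" and k
  assume K: "K \<in> fmeasurable lborel" "emeasure lborel K = emeasure lborel (ball (0::'a) k)"
    and [measurable]: "K \<in> sets borel"
  define dil where "dil S = {x. inverse t *\<^sub>R x \<in> S}" for S :: "'a set"
  have [measurable]: "dil S \<in> sets borel" if [measurable]: "S \<in> sets borel" for S unfolding dil_def by measurable
  have ind: "indicator (dil S) (t *\<^sub>R z) = (indicator S z :: ennreal)" for S z
    using t by (auto simp: dil_def indicator_def)
  have int: "(\<integral>\<^sup>+x. indicator (dil S) x * g x \<partial>lborel) = ennreal (t ^ DIM('a)) * (\<integral>\<^sup>+z. indicator S z * g (t *\<^sub>R z) \<partial>lborel)"
    if [measurable]: "S \<in> sets borel" "g \<in> borel_measurable borel" for S and g :: "'a \<Rightarrow> ennreal"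
    using nn_integral_lborel_scale[of "\<lambda>x. indicator (dil S) x * g x", OF _ t] by (simp add: ind)
  have em: "emeasure lborel (dil S) = ennreal (t ^ DIM('a)) * emeasure lborel S" if [measurable]: "S \<in> sets borel" for S
    using int[of S "\<lambda>_. 1"] by simp
  have db: "dil (ball 0 k) = ball 0 (t * k)"
    using t by (auto simp: dil_def field_simps)
  have "dil K \<in> fmeasurable lborel"
    using K(1) by (intro fmeasurableI) (auto simp: em ennreal_mult_less_top fmeasurable_def)
  moreover have "emeasure lborel (dil K) = emeasure lborel (ball (0::'a) (t * k))"
    unfolding db[symmetric] by (simp add: em K(2))
  ultimately have "(\<integral>\<^sup>+x. indicator (dil (ball 0 k)) x * \<psi> x \<partial>lborel) \<le> (\<integral>\<^sup>+x. indicator (dil K) x * \<phi> x \<partial>lborel)"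
    unfolding db by (rule rearr_domD[OF dom])
  then show "(\<integral>\<^sup>+z. indicator (ball 0 k) z * \<psi> (t *\<^sub>R z) \<partial>lborel) \<le> (\<integral>\<^sup>+z. indicator K z * \<phi> (t *\<^sub>R z) \<partial>lborel)"
    using t by (simp add: int ennreal_mult_le_mult_iff)
qed

lemma rearr_dom_frac_gauge:
  fixes \<phi> \<psi> :: "'a::euclidean_space \<Rightarrow> real"
  assumes [measurable]: "\<phi> \<in> borel_measurable borel" "\<psi> \<in> borel_measurable borel"
    and dom: "rearr_dom (\<lambda>h. ennreal (\<psi> h powr \<theta>)) (\<lambda>h. ennreal (\<phi> h powr \<theta>))"
  shows "rearr_dom (frac_gauge a \<theta> \<psi>) (frac_gauge a \<theta> \<phi>)"
proof (rule rearr_domI)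
  fix K :: "'a set" and k
  assume K: "K \<in> fmeasurable lborel" "emeasure lborel K = emeasure lborel (ball (0::'a) k)"
    and [measurable]: "K \<in> sets borel"
  have "(\<integral>\<^sup>+z. indicator (ball 0 k) z * ennreal (\<psi> (t *\<^sub>R z) powr \<theta>) \<partial>lborel)
      \<le> (\<integral>\<^sup>+z. indicator K z * ennreal (\<phi> (t *\<^sub>R z) powr \<theta>) \<partial>lborel)" if "0 < t" for t
    using that K by (intro rearr_domD[OF rearr_dom_dilate[OF _ _ dom]]) auto
  then have pt: "indicator {0<..} t * ennreal (t powr (- a) / t) * (\<integral>\<^sup>+z. indicator (ball 0 k) z * ennreal (\<psi> (t *\<^sub>R z) powr \<theta>) \<partial>lborel)
     \<le> indicator {0<..} t * ennreal (t powr (- a) / t) * (\<integral>\<^sup>+z. indicator K z * ennreal (\<phi> (t *\<^sub>R z) powr \<theta>) \<partial>lborel)" for t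
    by (cases "0 < t") (auto intro!: mult_left_mono)
  show "(\<integral>\<^sup>+z. indicator (ball 0 k) z * frac_gauge a \<theta> \<psi> z \<partial>lborel) \<le> (\<integral>\<^sup>+z. indicator K z * frac_gauge a \<theta> \<phi> z \<partial>lborel)"
    by (subst (1 2) frac_gauge_integral) (simp_all only: nn_integral_mono pt, auto)
qed

text \<open>The convex function \<open>x powr \<theta>\<close> lies above its tangent at
  \<open>A\<close>; this is Young's inequality, and it is integrated over \<open>K\<close>. Only a
  lower bound \<open>A\<close> for the average enters, and the right-hand side may be
  infinite.\<close>

lemma nn_integral_powr_jensen:
  fixes \<phi> :: "'a::euclidean_space \<Rightarrow> real"
  assumes [measurable]: "\<phi> \<in> borel_measurable borel" and nonneg: "\<And>x. 0 \<le> \<phi> x" "0 \<le> A" and \<theta>: "1 \<le> \<theta>"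
    and K: "K \<in> fmeasurable lborel"
    and avg: "ennreal A * emeasure lborel K \<le> (\<integral>\<^sup>+x. indicator K x * ennreal (\<phi> x) \<partial>lborel)"
  shows "ennreal (A powr \<theta>) * emeasure lborel K \<le> (\<integral>\<^sup>+x. indicator K x * ennreal (\<phi> x powr \<theta>) \<partial>lborel)"
proof (cases "A = 0")
  case False
  with nonneg have A: "0 < A" by (simp add: order_le_less)
  have [measurable]: "K \<in> sets borel" using K by (auto dest: fmeasurableD)
  have AA: "A powr (\<theta> - 1) * A = A powr \<theta>" using A powr_add[of A "\<theta> - 1" 1] by simp
  have young: "\<theta> * A powr (\<theta> - 1) * x \<le> x powr \<theta> + (\<theta> - 1) * A powr \<theta>" if "0 \<le> x" for x
  proof (cases "x = 0")
    case x: False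
    have "(x powr \<theta>) powr (1 / \<theta>) * (A powr \<theta>) powr ((\<theta> - 1) / \<theta>) \<le> 1 / \<theta> * x powr \<theta> + (\<theta> - 1) / \<theta> * A powr \<theta>"
      using \<theta> x A by (intro Youngs_inequality_0) (auto simp: field_simps)
    also have "(x powr \<theta>) powr (1 / \<theta>) * (A powr \<theta>) powr ((\<theta> - 1) / \<theta>) = x * A powr (\<theta> - 1)"
      using \<theta> that A by (simp add: powr_powr)
    finally show ?thesis using \<theta> by (simp add: field_simps)
  qed (use \<theta> in simp)
  define I where "I = (\<integral>\<^sup>+x. indicator K x * ennreal (\<phi> x powr \<theta>) \<partial>lborel)"
  define m where "m = measure lborel K"
  have m: "emeasure lborel K = ennreal m" unfolding m_def by (rule emeasure_eq_measure2[OF K])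
  have m0: "0 \<le> m" unfolding m_def by simp
  have "ennreal (\<theta> * A powr \<theta> * m) = ennreal (\<theta> * A powr (\<theta> - 1)) * (ennreal A * emeasure lborel K)"
    unfolding m using A \<theta> m0 AA by (simp add: mult.assoc flip: ennreal_mult)
  also have "\<dots> \<le> ennreal (\<theta> * A powr (\<theta> - 1)) * (\<integral>\<^sup>+x. indicator K x * ennreal (\<phi> x) \<partial>lborel)"
    by (intro mult_left_mono avg) simp
  also have "\<dots> = (\<integral>\<^sup>+x. indicator K x * ennreal (\<theta> * A powr (\<theta> - 1) * \<phi> x) \<partial>lborel)"
    using \<theta> nonneg by (subst nn_integral_cmult[symmetric]) (auto simp: ennreal_mult mult.left_commute)
  also have "\<dots> \<le> (\<integral>\<^sup>+x. indicator K x * ennreal (\<phi> x powr \<theta> + (\<theta> - 1) * A powr \<theta>) \<partial>lborel)"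
    using nonneg by (intro nn_integral_mono mult_left_mono ennreal_leI young) auto
  also have "\<dots> = (\<integral>\<^sup>+x. indicator K x * ennreal (\<phi> x powr \<theta>) + ennreal ((\<theta> - 1) * A powr \<theta>) * indicator K x \<partial>lborel)"
    using \<theta> by (intro nn_integral_cong) (auto simp: indicator_def)
  also have "\<dots> = I + ennreal ((\<theta> - 1) * A powr \<theta>) * ennreal m"
    unfolding I_def m[symmetric] by (subst nn_integral_add) (auto simp: nn_integral_cmult_indicator)
  finally have "ennreal (\<theta> * A powr \<theta> * m) \<le> I + ennreal ((\<theta> - 1) * A powr \<theta> * m)"
    using \<theta> m0 by (simp add: ennreal_mult)
  moreover have "\<theta> * A powr \<theta> * m = A powr \<theta> * m + (\<theta> - 1) * A powr \<theta> * m" by (simp add: algebra_simps)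
  ultimately have "ennreal (A powr \<theta> * m) + ennreal ((\<theta> - 1) * A powr \<theta> * m) \<le> I + ennreal ((\<theta> - 1) * A powr \<theta> * m)"
    using \<theta> m0 by (simp add: ennreal_plus)
  then have "ennreal (A powr \<theta> * m) \<le> I"
    by (simp add: add.commute[of _ "ennreal ((\<theta> - 1) * A powr \<theta> * m)"] ennreal_add_left_cancel_le)
  then show ?thesis unfolding I_def m using m0 by (simp add: ennreal_mult)
qed simp

text \<open>For exponents \<open>\<theta> > 1\<close> the power no longer commutes with \<open>rearr_dom\<close>; instead both gauges are
  compared with the radial gauge built from the averages of \<open>\<psi>\<close> over centred balls.\<close>

lemma sublevel_volume_radial:
  fixes \<phi> \<psi> :: "'a::euclidean_space \<Rightarrow> real"
  assumes [measurable]: "\<phi> \<in> borel_measurable borel" "\<psi> \<in> borel_measurable borel"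
    and nonneg: "\<And>h. 0 \<le> \<phi> h" "\<And>h. 0 \<le> \<psi> h"
    and dom: "rearr_dom (\<lambda>h. ennreal (\<psi> h)) (\<lambda>h. ennreal (\<phi> h))" and \<theta>: "1 \<le> \<theta>" and a: "0 < a"
    and D: "0 < D" and \<psi>0: "\<psi> 0 = 0" and bdd: "\<And>h. \<psi> h \<le> b"
    and avg: "\<And>h. ennreal (\<psi> h) * emeasure lborel (ball (0::'a) (norm h))
               \<le> ennreal D * (\<integral>\<^sup>+y. indicator (ball 0 (norm h)) y * ennreal (\<psi> y) \<partial>lborel)"
  shows "ennreal ((D powr \<theta>) powr (- (DIM('a) / a))) * emeasure lborel {z. frac_gauge a \<theta> \<phi> z \<le> 1}
       \<le> emeasure lborel {z. frac_gauge a \<theta> \<psi> z \<le> 1}"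
proof -
  define T where "T r = (\<integral>\<^sup>+y. (if norm y < r then ennreal (\<psi> y) else 0) \<partial>(lborel :: 'a measure))" for r
  define vol where "vol r = (\<integral>\<^sup>+y. (if norm y < r then 1 else 0) \<partial>(lborel :: 'a measure))" for r
  \<comment> \<open>The average of \<open>\<psi>\<close> over the ball of radius \<open>r\<close>.
    The bound \<open>b\<close> keeps \<open>T r\<close> finite, so \<open>enn2real\<close> loses
    nothing; the condition \<open>norm y < r\<close> in \<open>T\<close> and \<open>vol\<close>
    makes measurability in \<open>r\<close> visible.\<close>
  define A where "A r = enn2real (T r) / enn2real (vol r)" for r
  have [measurable]: "A \<in> borel_measurable borel" unfolding A_def T_def vol_def by measurable
  have A0: "0 \<le> A r" for r unfolding A_def by simp
  have T: "T r = (\<integral>\<^sup>+y. indicator (ball 0 r) y * ennreal (\<psi> y) \<partial>lborel)" for r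
    unfolding T_def by (intro nn_integral_cong) (auto simp: indicator_def)
  have vol: "vol r = emeasure lborel (ball (0::'a) r)" for r
  proof -
    have "vol r = (\<integral>\<^sup>+y. indicator (ball (0::'a) r) y \<partial>lborel)"
      unfolding vol_def by (intro nn_integral_cong) (auto simp: indicator_def)
    then show ?thesis by simp
  qed
  have volf: "vol r < \<infinity>" for r unfolding vol using emeasure_lborel_ball_finite by blast
  have vole: "vol r = ennreal (measure lborel (ball (0::'a) r))" for r
    unfolding vol using volf[of r, unfolded vol] by (simp add: emeasure_eq_ennreal_measure)
  have b0: "0 \<le> b" using bdd[of 0] \<psi>0 by simp
  have Tf: "T r < \<infinity>" for r
  proof -
    have "T r \<le> (\<integral>\<^sup>+y. ennreal b * (if norm y < r then 1 else 0) \<partial>(lborel :: 'a measure))"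
      unfolding T_def by (intro nn_integral_mono) (auto intro!: ennreal_leI bdd)
    also have "\<dots> = ennreal b * vol r" unfolding vol_def by (rule nn_integral_cmult) measurable
    also have "\<dots> < \<infinity>" using volf by (simp add: ennreal_mult_less_top)
    finally show ?thesis .
  qed
  have AT: "ennreal (A r) * vol r = T r" if "0 < r" for r
  proof -
    have pos: "0 < measure lborel (ball (0::'a) r)" using that by simp
    have "ennreal (A r) * vol r = ennreal (A r * measure lborel (ball (0::'a) r))"
      unfolding vole using A0 by (simp add: ennreal_mult)
    also have "A r * measure lborel (ball (0::'a) r) = enn2real (T r)"
      unfolding A_def vole using pos by simp
    finally show ?thesis using Tf[of r] by simp
  qed
  \<comment> \<open>By homogeneity on the line, the gauge of \<open>A (norm z)\<close> at
    \<open>z \<noteq> 0\<close> is \<open>norm z powr a\<close> times its value at radius 1. So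
    \<open>G\<close> is the radial gauge of the averages; \<open>M\<close> may be infinite.\<close>
  define M where "M = frac_gauge a \<theta> A 1"
  define G where "G z = ennreal (norm z powr a) * M" for z :: 'a
  have [measurable]: "G \<in> borel_measurable borel" unfolding G_def by measurable
  have homA: "frac_gauge a \<theta> A k = ennreal (k powr a) * M" if "0 < k" for k
    using homogeneous_frac_gauge[of A a \<theta>] that unfolding homogeneous_def M_def
    by (metis \<open>A \<in> borel_measurable borel\<close> homogeneous_def homogeneous_frac_gauge mult.right_neutral real_scaleR_def)
  have homG: "homogeneous a G"
    unfolding homogeneous_def G_def by (auto simp: powr_mult ennreal_mult mult.assoc)
  have domG: "rearr_dom G (frac_gauge a \<theta> \<phi>)"
  proof (rule rearr_domI)
    fix K :: "'a set" and k
    assume K: "K \<in> fmeasurable lborel" "emeasure lborel K = emeasure lborel (ball (0::'a) k)"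
      and [measurable]: "K \<in> sets borel"
    show "(\<integral>\<^sup>+z. indicator (ball 0 k) z * G z \<partial>lborel) \<le> (\<integral>\<^sup>+z. indicator K z * frac_gauge a \<theta> \<phi> z \<partial>lborel)"
    proof (cases "0 < k")
      case False
      then have "ball (0::'a) k = {}" by (simp add: ball_empty)
      then have "indicator (ball (0::'a) k) z = (0 :: ennreal)" for z by (metis empty_iff indicator_simps(2))
      then show ?thesis by (simp only:) simp
    next
      case True
      \<comment> \<open>At dilation \<open>t\<close> the average of \<open>\<phi>\<close> is at
        least the ball average at radius \<open>t * k\<close>. Integrating over \<open>t\<close>
        turns these bounds into the gauge of \<open>A\<close> at \<open>k\<close>, and that value
        bounds \<open>G\<close> on the whole ball of radius \<open>k\<close>.\<close>
      have jen: "ennreal (A (t * k) powr \<theta>) * emeasure lborel K \<le> (\<integral>\<^sup>+z. indicator K z * ennreal (\<phi> (t *\<^sub>R z) powr \<theta>) \<partial>lborel)"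
        if t: "0 < t" for t
      proof (rule nn_integral_powr_jensen[OF _ _ A0 \<theta> K(1)])
        have i: "indicator (ball 0 (t * k)) (t *\<^sub>R z) = (indicator (ball 0 k) z :: ennreal)" for z :: 'a
          using t by (auto simp: indicator_def)
        have s1: "T (t * k) = ennreal (t ^ DIM('a)) * (\<integral>\<^sup>+z. indicator (ball 0 k) z * ennreal (\<psi> (t *\<^sub>R z)) \<partial>lborel)"
          unfolding T using nn_integral_lborel_scale[of "\<lambda>y. indicator (ball 0 (t * k)) y * ennreal (\<psi> y)", OF _ t]
          by (simp add: i)
        have s2: "vol (t * k) = ennreal (t ^ DIM('a)) * vol k"
          unfolding vol using nn_integral_lborel_scale[of "\<lambda>y. indicator (ball (0::'a) (t * k)) y", OF _ t]
          by (simp add: i)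
        have "ennreal (t ^ DIM('a)) * (ennreal (A (t * k)) * vol k)
           = ennreal (t ^ DIM('a)) * (\<integral>\<^sup>+z. indicator (ball 0 k) z * ennreal (\<psi> (t *\<^sub>R z)) \<partial>lborel)"
          using AT[of "t * k"] t True unfolding s1[symmetric] by (simp add: s2 mult.left_commute)
        then have "ennreal (A (t * k)) * vol k = (\<integral>\<^sup>+z. indicator (ball 0 k) z * ennreal (\<psi> (t *\<^sub>R z)) \<partial>lborel)"
          using t by (simp add: ennreal_mult_cancel_left)
        also have "\<dots> \<le> (\<integral>\<^sup>+z. indicator K z * ennreal (\<phi> (t *\<^sub>R z)) \<partial>lborel)"
          using K t by (intro rearr_domD[OF rearr_dom_dilate[OF _ _ dom]]) auto
        finally show "ennreal (A (t * k)) * emeasure lborel K \<le> (\<integral>\<^sup>+z. indicator K z * ennreal (\<phi> (t *\<^sub>R z)) \<partial>lborel)"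
          unfolding K(2) vol .
      qed (auto simp: nonneg)
      have "(\<integral>\<^sup>+z. indicator (ball 0 k) z * G z \<partial>lborel) \<le> (\<integral>\<^sup>+z. (ennreal (k powr a) * M) * indicator (ball (0::'a) k) z \<partial>lborel)"
        unfolding G_def using a by (intro nn_integral_mono) (auto simp: indicator_def intro!: mult_right_mono ennreal_leI powr_mono2)
      also have "\<dots> = frac_gauge a \<theta> A k * emeasure lborel K"
        unfolding K(2) homA[OF True] by (rule nn_integral_cmult_indicator) simp
      also have "\<dots> = (\<integral>\<^sup>+t. indicator {0<..} t * ennreal (t powr (- a) * A (t *\<^sub>R k) powr \<theta> / t) * emeasure lborel K \<partial>lborel)"
        unfolding frac_gauge_def by (rule nn_integral_multc[symmetric]) measurable
      also have "\<dots> \<le> (\<integral>\<^sup>+t. indicator {0<..} t * ennreal (t powr (- a) / t) * (\<integral>\<^sup>+z. indicator K z * ennreal (\<phi> (t *\<^sub>R z) powr \<theta>) \<partial>lborel) \<partial>lborel)"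
      proof (intro nn_integral_mono)
        fix t :: real
        show "indicator {0<..} t * ennreal (t powr (- a) * A (t *\<^sub>R k) powr \<theta> / t) * emeasure lborel K
          \<le> indicator {0<..} t * ennreal (t powr (- a) / t) * (\<integral>\<^sup>+z. indicator K z * ennreal (\<phi> (t *\<^sub>R z) powr \<theta>) \<partial>lborel)"
        proof (cases "0 < t")
          case True
          have "ennreal (t powr (- a) * A (t *\<^sub>R k) powr \<theta> / t) * emeasure lborel K
             = ennreal (t powr (- a) / t) * (ennreal (A (t * k) powr \<theta>) * emeasure lborel K)"
            using True by (simp add: ennreal_mult[symmetric] mult.assoc[symmetric])
          also have "\<dots> \<le> ennreal (t powr (- a) / t) * (\<integral>\<^sup>+z. indicator K z * ennreal (\<phi> (t *\<^sub>R z) powr \<theta>) \<partial>lborel)"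
            by (intro mult_left_mono jen True) simp
          finally show ?thesis using True by simp
        qed simp
      qed
      also have "\<dots> = (\<integral>\<^sup>+z. indicator K z * frac_gauge a \<theta> \<phi> z \<partial>lborel)"
        by (rule frac_gauge_integral[symmetric]) auto
      finally show ?thesis .
    qed
  qed
  have V: "emeasure lborel {z. frac_gauge a \<theta> \<phi> z \<le> 1} \<le> emeasure lborel {z. G z \<le> 1}"
    by (rule sublevel_volume_mono[OF _ _ homogeneous_frac_gauge homG a domG]) auto
  define C where "C = D powr \<theta>"
  have C0: "0 < C" unfolding C_def using D by simp
  have le: "frac_gauge a \<theta> \<psi> z \<le> ennreal C * G z" for z
  \<comment> \<open>At the origin \<open>G\<close> is 0 even if \<open>M\<close> is infinite, so the
    left side has to vanish as well; this is what \<open>\<psi> 0 = 0\<close> provides.\<close>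
  proof (cases "z = 0")
    case True
    then show ?thesis using \<psi>0 by (simp add: frac_gauge_def)
  next
    case False
    have pt: "\<psi> h \<le> D * A (norm h)" if "h \<noteq> 0" for h
    proof -
      have n: "0 < norm h" using that by simp
      have "ennreal (\<psi> h) * vol (norm h) \<le> ennreal D * (ennreal (A (norm h)) * vol (norm h))"
        using avg[of h] unfolding AT[OF n] T[symmetric] vol[symmetric] .
      also have "\<dots> = ennreal (D * A (norm h)) * vol (norm h)" using D A0 by (simp add: ennreal_mult mult.assoc)
      finally have "vol (norm h) * ennreal (\<psi> h) \<le> vol (norm h) * ennreal (D * A (norm h))" by (simp add: mult.commute)
      moreover have "vol (norm h) \<noteq> 0" "vol (norm h) \<noteq> top" unfolding vole using n by (auto simp: ennreal_eq_0_iff not_le)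
      ultimately have "ennreal (\<psi> h) \<le> ennreal (D * A (norm h))" by (simp add: ennreal_mult_le_mult_iff)
      then show ?thesis using D A0 by (simp add: ennreal_le_iff)
    qed
    have "frac_gauge a \<theta> \<psi> z \<le> (\<integral>\<^sup>+t. ennreal C * (indicator {0<..} t * ennreal (t powr (- a) * A (t *\<^sub>R norm z) powr \<theta> / t)) \<partial>lborel)"
      unfolding frac_gauge_def
    proof (intro nn_integral_mono)
      fix t :: real
      show "indicator {0<..} t * ennreal (t powr (- a) * \<psi> (t *\<^sub>R z) powr \<theta> / t)
        \<le> ennreal C * (indicator {0<..} t * ennreal (t powr (- a) * A (t *\<^sub>R norm z) powr \<theta> / t))"
      proof (cases "0 < t")
        case True
        have "\<psi> (t *\<^sub>R z) powr \<theta> \<le> (D * A (t * norm z)) powr \<theta>"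
          using pt[of "t *\<^sub>R z"] True False \<theta> nonneg by (intro powr_mono2) auto
        also have "\<dots> = C * A (t * norm z) powr \<theta>" unfolding C_def using D A0 by (simp add: powr_mult)
        finally have "t powr (- a) * \<psi> (t *\<^sub>R z) powr \<theta> / t \<le> t powr (- a) * (C * A (t * norm z) powr \<theta>) / t"
          using True by (intro divide_right_mono mult_left_mono) auto
        also have "\<dots> = C * (t powr (- a) * A (t * norm z) powr \<theta> / t)" by simp
        finally show ?thesis using True C0 by (simp add: ennreal_mult[symmetric] ennreal_leI del: times_divide_eq_right)
      qed simp
    qed
    also have "\<dots> = ennreal C * frac_gauge a \<theta> A (norm z)"
      unfolding frac_gauge_def by (rule nn_integral_cmult) measurable
    also have "\<dots> = ennreal C * G z" using False homA[of "norm z"] unfolding G_def by simp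
    finally show ?thesis .
  qed
  have "ennreal (C powr (- (DIM('a) / a))) * emeasure lborel {z. frac_gauge a \<theta> \<phi> z \<le> 1}
     \<le> ennreal (C powr (- (DIM('a) / a))) * emeasure lborel {z. G z \<le> 1}"
    by (intro mult_left_mono V) simp
  also have conv: "C powr (- (DIM('a) / a)) = (1 / C) powr (DIM('a) / a)"
    using C0 by (simp add: powr_minus powr_divide inverse_eq_divide)
  also have "ennreal \<dots> * emeasure lborel {z. G z \<le> 1} = emeasure lborel {z. G z \<le> ennreal (1 / C)}"
    using C0 by (intro emeasure_sublevel_homogeneous[symmetric] homG a) auto
  also have "\<dots> \<le> emeasure lborel {z. frac_gauge a \<theta> \<psi> z \<le> 1}"
  proof (intro emeasure_mono subsetI; simp)
    fix z assume "G z \<le> ennreal (1 / C)"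
    then have "ennreal C * G z \<le> ennreal C * ennreal (1 / C)" by (intro mult_left_mono) auto
    also have "\<dots> = 1" using C0 by (simp flip: ennreal_mult)
    finally show "frac_gauge a \<theta> \<psi> z \<le> 1" using le[of z] by (rule order.trans[rotated])
  qed
  finally show ?thesis unfolding C_def[symmetric] conv .
qed

section \<open>Schwarz symmetrals\<close>

lemma sphere_null_lborel: "sphere (0::'a::euclidean_space) r \<in> null_sets lborel"
  using negligible_sphere[of "0::'a" r]
  by (auto simp: null_sets_completion_iff negligible_iff_null_sets negligible_convex_frontier)

text \<open>Away from the origin the set \<open>\<tau> < schwarz f x\<close> is the union of the
  closed balls of radii \<open>r t\<close> over \<open>t > \<tau>\<close>. It lies between the open
  and the closed ball of the supremum radius, which differ by a null sphere. Its measure is the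
  right one because the sets \<open>E t\<close> increase to
  \<open>{x. \<tau> < \<bar>f x\<bar>}\<close> as \<open>t\<close> decreases to
  \<open>\<tau>\<close>; the sequence \<open>d \<tau>\<close> makes this countable.\<close>

lemma schwarz_symmetrization:
  fixes f :: "'a::euclidean_space \<Rightarrow> real"
  assumes f [measurable]: "f \<in> borel_measurable borel" and p: "1 \<le> p"
    and fin: "(\<integral>\<^sup>+x. ennreal (\<bar>f x\<bar> powr p) \<partial>lborel) < \<infinity>"
  shows "symmetrization_of (schwarz f) f"
proof -
  define E where "E t = {y. t \<le> \<bar>f y\<bar>}" for t
  have [measurable]: "E t \<in> sets borel" for t unfolding E_def by measurable
  have fE: "E t \<in> fmeasurable lborel" if "0 < t" for t
  proof (rule fmeasurableI2)
    show "{x. t / 2 < \<bar>f x\<bar>} \<in> fmeasurable lborel" using that by (intro fmeasurable_superlevel[OF f p fin]) simp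
  qed (use that in \<open>auto simp: E_def\<close>)
  define \<omega> where "\<omega> = unit_ball_vol (real DIM('a))"
  have \<omega>: "0 < \<omega>" unfolding \<omega>_def by simp
  have cb: "emeasure lborel (cball (0::'a) s) = ennreal (\<omega> * s ^ DIM('a))"
    and bb: "emeasure lborel (ball (0::'a) s) = ennreal (\<omega> * s ^ DIM('a))" if "0 \<le> s" for s
    unfolding \<omega>_def using that by (auto intro: emeasure_cball emeasure_ball)
  define r where "r t = (SOME r. r \<ge> 0 \<and> emeasure lebesgue (cball (0::'a) r) = emeasure lebesgue (E t))" for t
  have rt: "0 \<le> r t" "emeasure lborel (cball (0::'a) (r t)) = emeasure lborel (E t)" if "0 < t" for t
  proof -
    have "emeasure lborel (E t) < \<infinity>" using fE[OF that] by (simp add: fmeasurable_def)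
    then obtain s where "0 \<le> s" "emeasure lborel (ball (0::'a) s) = emeasure lborel (E t)"
      using exists_ball_radius by metis
    then have "\<exists>r. r \<ge> 0 \<and> emeasure lebesgue (cball (0::'a) r) = emeasure lebesgue (E t)"
      by (intro exI[of _ s]) (simp add: cb bb)
    from someI_ex[OF this] show "0 \<le> r t" "emeasure lborel (cball (0::'a) (r t)) = emeasure lborel (E t)"
      unfolding r_def by auto
  qed
  have sym: "sym_set (E t) = cball 0 (r t)" if "0 < t" for t
    using fE[OF that] unfolding sym_set_def r_def by (auto simp: fmeasurable_def)
  have anti: "r t' \<le> r t" if "0 < t" "t \<le> t'" for t t'
  proof -
    have "emeasure lborel (E t') \<le> emeasure lborel (E t)" using that by (intro emeasure_mono) (auto simp: E_def)
    then have "ennreal (\<omega> * r t' ^ DIM('a)) \<le> ennreal (\<omega> * r t ^ DIM('a))"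
      using that rt[of t] rt[of t'] by (simp add: cb)
    then have "r t' ^ DIM('a) \<le> r t ^ DIM('a)" using \<omega> that rt[of t] by (simp add: ennreal_le_iff)
    then show ?thesis using that rt(1)[of t] rt(1)[of t'] by (simp add: power_mono_iff)
  qed
  define S where "S x = {t. 0 < t \<and> norm x \<le> r t}" for x :: 'a
  have sch: "schwarz f x = enn2real (\<integral>\<^sup>+t. indicator (S x) t \<partial>lborel)" for x
    unfolding schwarz_def E_def[symmetric]
    by (intro arg_cong[where f = enn2real] nn_integral_cong) (auto simp: indicator_def S_def sym)
  \<comment> \<open>Markov's inequality: for \<open>t\<close> in \<open>S x\<close> the level set
    \<open>E t\<close> has at least the volume \<open>v\<close>, hence
    \<open>t powr p * v \<le> c\<close>, and \<open>t \<le> t powr p\<close> once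
    \<open>t > 1\<close>. At the origin there is no bound: every closed ball contains its centre, so
    \<open>S 0\<close> is all of \<open>{0<..}\<close>, the integral is infinite and
    \<open>schwarz f 0 = 0\<close>.\<close>
  have bound: "\<exists>T. S x \<subseteq> {0<..T}" if "x \<noteq> 0" for x
  proof -
    define c where "c = enn2real (\<integral>\<^sup>+x. ennreal (\<bar>f x\<bar> powr p) \<partial>lborel)"
    define v where "v = measure lborel (ball (0::'a) (norm x))"
    have v: "0 < v" unfolding v_def using that by simp
    have "t \<le> max 1 (c / v)" if t: "t \<in> S x" for t
    proof -
      have t0: "0 < t" and xr: "norm x \<le> r t" using t by (auto simp: S_def)
      have "ennreal (t powr p * v) = ennreal (t powr p) * emeasure lborel (ball (0::'a) (norm x))"
        unfolding v_def using emeasure_lborel_ball_finite[of "0::'a" "norm x"]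
        by (simp add: ennreal_mult emeasure_eq_ennreal_measure)
      also have "\<dots> \<le> ennreal (t powr p) * emeasure lborel (cball (0::'a) (r t))"
        using xr by (intro mult_left_mono emeasure_mono) auto
      also have "\<dots> = (\<integral>\<^sup>+y. ennreal (t powr p) * indicator (E t) y \<partial>lborel)"
        unfolding rt(2)[OF t0] by (simp add: nn_integral_cmult_indicator)
      also have "\<dots> \<le> (\<integral>\<^sup>+x. ennreal (\<bar>f x\<bar> powr p) \<partial>lborel)"
        using t0 p by (intro nn_integral_mono) (auto simp: indicator_def E_def intro!: ennreal_leI powr_mono2)
      also have "\<dots> = ennreal c" unfolding c_def using fin by simp
      finally have "t powr p * v \<le> c" using v by (simp add: ennreal_le_iff c_def)
      then have "t powr p \<le> c / v" using v by (simp add: field_simps)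
      moreover have "t \<le> t powr p" if "1 < t" using powr_mono[of 1 p t] p that by simp
      ultimately show ?thesis by linarith
    qed
    then show ?thesis by (intro exI[of _ "max 1 (c / v)"]) (auto simp: S_def)
  qed
  have iff: "\<tau> < schwarz f x \<longleftrightarrow> (\<exists>t>\<tau>. norm x \<le> r t)" if x: "x \<noteq> 0" and \<tau>: "0 \<le> \<tau>" for x \<tau>
  proof
    assume *: "\<tau> < schwarz f x"
    show "\<exists>t>\<tau>. norm x \<le> r t"
    proof (rule ccontr)
      assume "\<not> (\<exists>t>\<tau>. norm x \<le> r t)"
      then have "S x \<subseteq> {0<..\<tau>}" by (auto simp: S_def) (meson linorder_not_le)
      then have "(\<integral>\<^sup>+t. indicator (S x) t \<partial>lborel) \<le> (\<integral>\<^sup>+t. indicator {0<..\<tau>} t \<partial>lborel)"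
        by (intro nn_integral_mono) (auto simp: indicator_def)
      also have "\<dots> = ennreal \<tau>" using \<tau> by simp
      finally have "schwarz f x \<le> \<tau>" unfolding sch using \<tau> by (intro enn2real_leI) auto
      then show False using * by simp
    qed
  next
    assume "\<exists>t>\<tau>. norm x \<le> r t"
    then obtain t where t: "\<tau> < t" "norm x \<le> r t" by blast
    then have t0: "0 < t" using \<tau> by simp
    obtain T where T: "S x \<subseteq> {0<..T}" using bound[OF x] by blast
    have T0: "0 < T" using T t t0 by (force simp: S_def)
    have "(\<integral>\<^sup>+t. indicator (S x) t \<partial>lborel) \<le> (\<integral>\<^sup>+t. indicator {0<..T} t \<partial>lborel)"
      using T by (intro nn_integral_mono) (auto simp: indicator_def)
    also have "\<dots> = ennreal T" using T0 by simp
    finally have f1: "(\<integral>\<^sup>+t. indicator (S x) t \<partial>lborel) < \<infinity>" by (auto simp: less_top[symmetric] top_unique)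
    have "{0<..t} \<subseteq> S x" using t anti by (auto simp: S_def intro: order.trans)
    then have "(\<integral>\<^sup>+t'. indicator {0<..t} t' \<partial>lborel) \<le> (\<integral>\<^sup>+t. indicator (S x) t \<partial>lborel)"
      by (intro nn_integral_mono) (auto simp: indicator_def)
    then have "ennreal t \<le> (\<integral>\<^sup>+t. indicator (S x) t \<partial>lborel)" using t0 by simp
    then have "t \<le> schwarz f x" unfolding sch using f1 t0
      by (metis enn2real_ennreal enn2real_mono infinity_ennreal_def less_imp_le)
    then show "\<tau> < schwarz f x" using t by simp
  qed
  define d where "d \<tau> n = \<tau> + 1 / real (Suc n)" for \<tau> n
  define U where "U \<tau> = (\<Union>n. cball (0::'a) (r (d \<tau> n)))" for \<tau>
  have d: "\<tau> < d \<tau> n" for \<tau> n unfolding d_def by simp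
  have dex: "\<exists>n. d \<tau> n < t" if "\<tau> < t" for \<tau> t
    using reals_Archimedean[of "t - \<tau>"] that unfolding d_def by (auto simp: inverse_eq_divide algebra_simps)
  have U_iff: "x \<in> U \<tau> \<longleftrightarrow> (\<exists>t>\<tau>. norm x \<le> r t)" if "0 \<le> \<tau>" for x \<tau>
  proof
    assume "x \<in> U \<tau>" then show "\<exists>t>\<tau>. norm x \<le> r t" using d by (auto simp: U_def)
  next
    assume "\<exists>t>\<tau>. norm x \<le> r t"
    then obtain t n where "\<tau> < t" "norm x \<le> r t" "d \<tau> n < t" using dex by blast
    then have "norm x \<le> r (d \<tau> n)" using anti[of "d \<tau> n" t] d[of \<tau> n] that by linarith
    then show "x \<in> U \<tau>" by (auto simp: U_def)
  qed
  have [measurable]: "U \<tau> \<in> sets borel" for \<tau> unfolding U_def by auto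
  have nn: "0 \<le> schwarz f x" for x unfolding schwarz_def by simp
  have meas: "schwarz f \<in> borel_measurable borel"
    unfolding borel_measurable_iff_greater
  proof (intro allI)
    fix \<tau> :: real
    show "{x \<in> space borel. \<tau> < schwarz f x} \<in> sets borel"
    proof (cases "0 \<le> \<tau>")
      case True
      have "{x \<in> space borel. \<tau> < schwarz f x} = (U \<tau> - {0}) \<union> (if \<tau> < schwarz f 0 then {0} else {})"
      proof (rule set_eqI)
        fix x
        show "x \<in> {x \<in> space borel. \<tau> < schwarz f x}
          \<longleftrightarrow> x \<in> (U \<tau> - {0}) \<union> (if \<tau> < schwarz f 0 then {0} else {})"
          by (cases "x = 0") (auto simp: iff[OF _ True] U_iff[OF True])
      qed
      also have "\<dots> \<in> sets borel" by auto
      finally show ?thesis .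
    next
      case False
      then have "{x \<in> space borel. \<tau> < schwarz f x} = UNIV" using nn by (auto simp: not_le intro: less_le_trans)
      then show ?thesis by simp
    qed
  qed
  have lev: "\<exists>\<rho>. emeasure lborel {x. \<tau> < \<bar>f x\<bar>} = emeasure lborel (ball (0::'a) \<rho>)
        \<and> (AE x in lborel. \<tau> < schwarz f x \<longleftrightarrow> x \<in> ball 0 \<rho>)" if \<tau>: "0 < \<tau>" for \<tau>
  proof -
    define \<rho> where "\<rho> = Sup (r ` {\<tau><..})"
    have bdd: "bdd_above (r ` {\<tau><..})" using anti[OF \<tau>] by (intro bdd_aboveI[of _ "r \<tau>"]) auto
    have ne: "r ` {\<tau><..} \<noteq> {}" by (simp add: greaterThan_non_empty)
    have up: "r t \<le> \<rho>" if "\<tau> < t" for t unfolding \<rho>_def using bdd that by (intro cSup_upper) auto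
    have \<rho>0: "0 \<le> \<rho>" using up[of "\<tau> + 1"] rt(1)[of "\<tau> + 1"] \<tau> by simp
    have sub1: "ball 0 \<rho> \<subseteq> U \<tau>"
    proof
      fix x :: 'a assume "x \<in> ball 0 \<rho>"
      then have "norm x < \<rho>" by simp
      then obtain y where "y \<in> r ` {\<tau><..}" "norm x < y" unfolding \<rho>_def using less_cSup_iff[OF ne bdd] by blast
      then obtain t where "\<tau> < t" "norm x \<le> r t" by (auto intro: less_imp_le)
      then show "x \<in> U \<tau>" using U_iff[of \<tau> x] \<tau> by auto
    qed
    have sub2: "U \<tau> \<subseteq> cball 0 \<rho>"
    proof
      fix x assume "x \<in> U \<tau>"
      then obtain t where "\<tau> < t" "norm x \<le> r t" using U_iff[of \<tau> x] \<tau> by auto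
      then show "x \<in> cball 0 \<rho>" using up[of t] by auto
    qed
    have "emeasure lborel (U \<tau>) = emeasure lborel (ball (0::'a) \<rho>)"
    proof (rule antisym)
      have "emeasure lborel (U \<tau>) \<le> emeasure lborel (cball (0::'a) \<rho>)" using sub2 by (intro emeasure_mono) auto
      then show "emeasure lborel (U \<tau>) \<le> emeasure lborel (ball (0::'a) \<rho>)" using \<rho>0 by (simp add: cb bb)
      show "emeasure lborel (ball (0::'a) \<rho>) \<le> emeasure lborel (U \<tau>)" using sub1 by (intro emeasure_mono) auto
    qed
    moreover have "emeasure lborel (U \<tau>) = emeasure lborel {x. \<tau> < \<bar>f x\<bar>}"
    proof -
      have dpos: "0 < d \<tau> n" for n using d[of \<tau> n] \<tau> by simp
      have dec: "d \<tau> (Suc n) \<le> d \<tau> n" for n unfolding d_def by (simp add: frac_le)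
      have "emeasure lborel (U \<tau>) = (SUP n. emeasure lborel (cball (0::'a) (r (d \<tau> n))))"
        unfolding U_def
        by (intro SUP_emeasure_incseq[symmetric] incseq_SucI) (auto intro: order.trans[OF _ anti[OF dpos dec]])
      also have "\<dots> = (SUP n. emeasure lborel (E (d \<tau> n)))" by (simp add: rt(2)[OF dpos])
      also have "\<dots> = emeasure lborel (\<Union>n. E (d \<tau> n))"
        by (intro SUP_emeasure_incseq incseq_SucI) (auto simp: E_def intro: order.trans[OF dec])
      also have "(\<Union>n. E (d \<tau> n)) = {x. \<tau> < \<bar>f x\<bar>}"
        using d[of \<tau>] dex[of \<tau>] by (auto simp: E_def intro: less_le_trans) (meson less_imp_le)
      finally show ?thesis .
    qed
    moreover have "AE x in lborel. \<tau> < schwarz f x \<longleftrightarrow> x \<in> ball 0 \<rho>"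
    proof -
      have "AE x in lborel. x \<notin> sphere (0::'a) \<rho>" by (rule AE_not_in[OF sphere_null_lborel])
      moreover have "AE x in lborel. x \<noteq> (0::'a)" by (rule AE_lborel_singleton)
      ultimately show ?thesis
      proof eventually_elim
        case (elim x)
        have "\<tau> < schwarz f x \<longleftrightarrow> x \<in> U \<tau>" using iff[OF elim(2), of \<tau>] U_iff[of \<tau> x] \<tau> by simp
        moreover have "norm x \<le> \<rho>" if "x \<in> U \<tau>" using sub2 that by auto
        moreover have "x \<in> U \<tau>" if "norm x < \<rho>" using sub1 that by auto
        moreover have "norm x \<noteq> \<rho>" using elim(1) by simp
        ultimately show ?case by (auto simp: order_less_le)
      qed
    qed
    ultimately show ?thesis by metis
  qed
  show ?thesis unfolding symmetrization_of_def using meas nn lev by blast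
qed

text \<open>Equimeasurability with the layer cake formula. It makes the energy of the symmetral
  finite, without which \<open>enn2real\<close> would silently replace an infinite energy by
  0.\<close>

lemma symmetrization_nn_integral_powr:
  fixes F f :: "'a::euclidean_space \<Rightarrow> real"
  assumes [measurable]: "f \<in> borel_measurable borel" and p: "1 \<le> p" and sym: "symmetrization_of F f"
  shows "(\<integral>\<^sup>+x. ennreal (F x powr p) \<partial>lborel) = (\<integral>\<^sup>+x. ennreal (\<bar>f x\<bar> powr p) \<partial>lborel)"
proof -
  have [measurable]: "F \<in> borel_measurable borel" and F0: "\<And>x. 0 \<le> F x"
    using sym by (auto simp: symmetrization_of_def)
  have pt: "ennreal (y powr p) = (\<integral>\<^sup>+\<tau>. (if 0 < \<tau> \<and> \<tau> powr (1 / p) < y then 1 else 0) \<partial>lborel)" if "0 \<le> y" for y :: real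
  proof -
    have eq: "\<tau> powr (1 / p) < y \<longleftrightarrow> \<tau> < y powr p" if \<tau>: "0 < \<tau>" for \<tau>
    proof -
      have i1: "(\<tau> powr (1 / p)) powr p = \<tau>" "(y powr p) powr (1 / p) = y"
        using p \<tau> \<open>0 \<le> y\<close> by (auto simp: powr_powr)
      show ?thesis
        using powr_less_mono2[of p "\<tau> powr (1 / p)" y] powr_less_mono2[of "1 / p" \<tau> "y powr p"] p \<tau> i1 by auto
    qed
    have "(\<integral>\<^sup>+\<tau>. (if 0 < \<tau> \<and> \<tau> powr (1 / p) < y then 1 else 0) \<partial>lborel) = (\<integral>\<^sup>+\<tau>. indicator {0<..<y powr p} \<tau> \<partial>lborel)"
      by (intro nn_integral_cong) (auto simp: indicator_def eq)
    then show ?thesis by simp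
  qed
  have rep: "(\<integral>\<^sup>+x. ennreal (g x powr p) \<partial>lborel)
     = (\<integral>\<^sup>+\<tau>. indicator {0<..} \<tau> * emeasure lborel {x. \<tau> powr (1 / p) < g x} \<partial>lborel)"
    if [measurable]: "g \<in> borel_measurable borel" and g0: "\<And>x. 0 \<le> g x" for g :: "'a \<Rightarrow> real"
  proof -
    have "(\<integral>\<^sup>+x. ennreal (g x powr p) \<partial>lborel)
      = (\<integral>\<^sup>+x. \<integral>\<^sup>+\<tau>. (if 0 < \<tau> \<and> \<tau> powr (1 / p) < g x then 1 else 0) \<partial>lborel \<partial>lborel)"
      by (simp only: pt[OF g0])
    also have "\<dots> = (\<integral>\<^sup>+\<tau>. \<integral>\<^sup>+x. (if 0 < \<tau> \<and> \<tau> powr (1 / p) < g x then 1 else 0) \<partial>lborel \<partial>lborel)"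
      by (rule lborel_pair.Fubini') measurable
    also have "\<dots> = (\<integral>\<^sup>+\<tau>. \<integral>\<^sup>+x. indicator {0<..} \<tau> * indicator {x. \<tau> powr (1 / p) < g x} x \<partial>lborel \<partial>lborel)"
      by (intro nn_integral_cong) (auto simp: indicator_def)
    also have "\<dots> = (\<integral>\<^sup>+\<tau>. indicator {0<..} \<tau> * emeasure lborel {x. \<tau> powr (1 / p) < g x} \<partial>lborel)"
      by (intro nn_integral_cong nn_integral_cmult_indicator) auto
    finally show ?thesis .
  qed
  have "emeasure lborel {x. v < F x} = emeasure lborel {x. v < \<bar>f x\<bar>}" if "0 < v" for v
  proof -
    obtain r where r: "emeasure lborel {x. v < \<bar>f x\<bar>} = emeasure lborel (ball (0::'a) r)"
        "AE x in lborel. v < F x \<longleftrightarrow> x \<in> ball 0 r"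
      using sym \<open>0 < v\<close> unfolding symmetrization_of_def by blast
    have "emeasure lborel {x. v < F x} = emeasure lborel (ball (0::'a) r)"
      using r(2) by (intro emeasure_eq_AE) auto
    then show ?thesis using r(1) by simp
  qed
  then have "indicator {0<..} \<tau> * emeasure lborel {x. \<tau> powr (1 / p) < F x}
     = indicator {0<..} \<tau> * emeasure lborel {x. \<tau> powr (1 / p) < \<bar>f x\<bar>}" for \<tau> :: real
    by (cases "0 < \<tau>") auto
  then show ?thesis using rep[of F] rep[of "\<lambda>x. \<bar>f x\<bar>"] F0 by simp
qed

section \<open>Bounds for difference energies under addition of shifts\<close>

lemma powr_abs_add_le:
  fixes x y p :: real
  assumes "1 \<le> p"
  shows "\<bar>x + y\<bar> powr p \<le> 2 powr p * (\<bar>x\<bar> powr p + \<bar>y\<bar> powr p)"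
proof -
  \<comment> \<open>Cruder than convexity, which would give \<open>2 powr (p - 1)\<close>, but
    \<open>2 powr p\<close> still fits into the final constant.\<close>
  have "\<bar>x + y\<bar> powr p \<le> (2 * max \<bar>x\<bar> \<bar>y\<bar>) powr p" using assms by (intro powr_mono2) auto
  also have "\<dots> = 2 powr p * max \<bar>x\<bar> \<bar>y\<bar> powr p" by (simp add: powr_mult)
  also have "\<dots> \<le> 2 powr p * (\<bar>x\<bar> powr p + \<bar>y\<bar> powr p)" by (intro mult_left_mono) (auto simp: max_def)
  finally show ?thesis .
qed

lemma diff_energy_bound:
  fixes f :: "'a::euclidean_space \<Rightarrow> real"
  assumes [measurable]: "f \<in> borel_measurable borel" and p: "1 \<le> p"
  shows "diff_energy p f h \<le> ennreal (2 powr p) * (2 * (\<integral>\<^sup>+x. ennreal (\<bar>f x\<bar> powr p) \<partial>lborel))"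
proof -
  have tr: "(\<integral>\<^sup>+x. ennreal (\<bar>f (h + x)\<bar> powr p) \<partial>lborel) = (\<integral>\<^sup>+x. ennreal (\<bar>f x\<bar> powr p) \<partial>lborel)"
    by (rule nn_integral_lborel_translate) measurable
  have "diff_energy p f h \<le> (\<integral>\<^sup>+x. ennreal (2 powr p) * (ennreal (\<bar>f (h + x)\<bar> powr p) + ennreal (\<bar>f x\<bar> powr p)) \<partial>lborel)"
    unfolding diff_energy_def
  proof (intro nn_integral_mono)
    fix x
    have "ennreal (\<bar>f (x + h) - f x\<bar> powr p) \<le> ennreal (2 powr p * (\<bar>f (x + h)\<bar> powr p + \<bar>f x\<bar> powr p))"
      using powr_abs_add_le[OF p, of "f (x + h)" "- f x"] by (intro ennreal_leI) simp
    then show "ennreal (\<bar>f (x + h) - f x\<bar> powr p) \<le> ennreal (2 powr p) * (ennreal (\<bar>f (h + x)\<bar> powr p) + ennreal (\<bar>f x\<bar> powr p))"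
      by (simp add: ennreal_mult ennreal_plus add.commute)
  qed
  also have "\<dots> = ennreal (2 powr p) * (2 * (\<integral>\<^sup>+x. ennreal (\<bar>f x\<bar> powr p) \<partial>lborel))"
    by (simp add: nn_integral_cmult nn_integral_add tr mult_2)
  finally show ?thesis .
qed

lemma diff_energy_subadd:
  fixes f :: "'a::euclidean_space \<Rightarrow> real"
  assumes [measurable]: "f \<in> borel_measurable borel" and p: "1 \<le> p"
  shows "diff_energy p f h \<le> ennreal (2 powr p) * (diff_energy p f y + diff_energy p f (h - y))"
proof -
  have tr: "(\<integral>\<^sup>+x. ennreal (\<bar>f ((y + x) + (h - y)) - f (y + x)\<bar> powr p) \<partial>lborel) = diff_energy p f (h - y)"
    unfolding diff_energy_def by (rule nn_integral_lborel_translate) measurable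
  have "diff_energy p f h \<le> (\<integral>\<^sup>+x. ennreal (2 powr p) * (ennreal (\<bar>f (x + y) - f x\<bar> powr p)
      + ennreal (\<bar>f ((y + x) + (h - y)) - f (y + x)\<bar> powr p)) \<partial>lborel)"
    unfolding diff_energy_def
  proof (intro nn_integral_mono)
    fix x
    have "ennreal (\<bar>f (x + h) - f x\<bar> powr p) \<le> ennreal (2 powr p * (\<bar>f (x + y) - f x\<bar> powr p + \<bar>f (x + h) - f (x + y)\<bar> powr p))"
      using powr_abs_add_le[OF p, of "f (x + y) - f x" "f (x + h) - f (x + y)"] by (intro ennreal_leI) simp
    then show "ennreal (\<bar>f (x + h) - f x\<bar> powr p) \<le> ennreal (2 powr p) * (ennreal (\<bar>f (x + y) - f x\<bar> powr p)
      + ennreal (\<bar>f ((y + x) + (h - y)) - f (y + x)\<bar> powr p))"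
      by (simp add: ennreal_mult ennreal_plus add.commute[of y])
  qed
  also have "\<dots> = ennreal (2 powr p) * ((\<integral>\<^sup>+x. ennreal (\<bar>f (x + y) - f x\<bar> powr p) \<partial>lborel) + diff_energy p f (h - y))"
    unfolding tr[symmetric] by (simp add: nn_integral_cmult nn_integral_add)
  finally show ?thesis unfolding diff_energy_def[of p f y] .
qed

lemma nn_integral_lborel_reflect:
  fixes F :: "'a::euclidean_space \<Rightarrow> ennreal"
  assumes [measurable]: "F \<in> borel_measurable borel"
  shows "(\<integral>\<^sup>+x. F (h - x) \<partial>lborel) = (\<integral>\<^sup>+x. F x \<partial>lborel)"
proof -
  have "(\<integral>\<^sup>+x. F x \<partial>lborel) = (\<integral>\<^sup>+x. F x \<partial>(density (distr lborel borel (\<lambda>x. h + (-1) *\<^sub>R x)) (\<lambda>_. ennreal (\<bar>-1\<bar> ^ DIM('a)))))"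
    by (subst lborel_affine[of "-1" h]) auto
  also have "\<dots> = (\<integral>\<^sup>+x. F (h - x) \<partial>lborel)"
    by (simp add: nn_integral_density nn_integral_distr)
  finally show ?thesis by simp
qed

text \<open>Write \<open>h = y + (h - y)\<close> and average over \<open>y\<close> in the ball
  \<open>B\<close> with diameter from 0 to \<open>h\<close>. It is invariant under
  \<open>y \<mapsto> h - y\<close>, so both terms have the same integral, which gives the factor 2;
  it lies in \<open>ball 0 (norm h)\<close> and fills the fraction \<open>1 / 2 ^ DIM('a)\<close> of
  it.\<close>

lemma diff_energy_le_average:
  fixes f :: "'a::euclidean_space \<Rightarrow> real"
  assumes [measurable]: "f \<in> borel_measurable borel" and p: "1 \<le> p"
  shows "diff_energy p f h * emeasure lborel (ball (0::'a) (norm h))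
     \<le> ennreal (2 powr p * 2 * 2 ^ DIM('a)) * (\<integral>\<^sup>+y. indicator (ball 0 (norm h)) y * diff_energy p f y \<partial>lborel)"
proof -
  define B where "B = ball (h /\<^sub>R 2) (norm h / 2)"
  have [measurable]: "B \<in> sets borel" unfolding B_def by simp
  have emB: "emeasure lborel (ball (0::'a) (norm h)) = ennreal (2 ^ DIM('a)) * emeasure lborel B"
    unfolding B_def by (simp add: emeasure_ball power_divide flip: ennreal_mult)
  have refl: "h - y \<in> B \<longleftrightarrow> y \<in> B" for y
  proof -
    have "h /\<^sub>R 2 - (h - y) = - (h /\<^sub>R 2 - y)"
      using scaleR_half_double[of h] by (simp add: algebra_simps flip: scaleR_add_right)
    then show ?thesis unfolding B_def by (simp only: mem_ball dist_norm norm_minus_cancel)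
  qed
  have sub: "B \<subseteq> ball 0 (norm h)"
  proof
    fix y assume "y \<in> B"
    then have "norm (h /\<^sub>R 2 - y) < norm h / 2" by (simp add: B_def dist_norm)
    moreover have "norm y \<le> norm (h /\<^sub>R 2) + norm (h /\<^sub>R 2 - y)"
      by (metis norm_triangle_sub norm_minus_commute)
    ultimately show "y \<in> ball 0 (norm h)" by simp
  qed
  have r: "(\<integral>\<^sup>+y. indicator B y * diff_energy p f (h - y) \<partial>lborel) = (\<integral>\<^sup>+y. indicator B y * diff_energy p f y \<partial>lborel)"
  proof -
    have "(\<integral>\<^sup>+y. indicator B y * diff_energy p f (h - y) \<partial>lborel) = (\<integral>\<^sup>+y. indicator B (h - y) * diff_energy p f (h - y) \<partial>lborel)"
      by (intro nn_integral_cong) (simp add: indicator_def refl)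
    also have "\<dots> = (\<integral>\<^sup>+y. indicator B y * diff_energy p f y \<partial>lborel)"
      by (rule nn_integral_lborel_reflect) measurable
    finally show ?thesis .
  qed
  have "diff_energy p f h * emeasure lborel B = (\<integral>\<^sup>+y. diff_energy p f h * indicator B y \<partial>lborel)"
    by (simp add: nn_integral_cmult_indicator)
  also have "\<dots> \<le> (\<integral>\<^sup>+y. ennreal (2 powr p) * (indicator B y * diff_energy p f y + indicator B y * diff_energy p f (h - y)) \<partial>lborel)"
    using diff_energy_subadd[OF assms] by (intro nn_integral_mono) (auto simp: indicator_def)
  also have "\<dots> = ennreal (2 powr p) * ((\<integral>\<^sup>+y. indicator B y * diff_energy p f y \<partial>lborel) + (\<integral>\<^sup>+y. indicator B y * diff_energy p f (h - y) \<partial>lborel))"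
    by (simp add: nn_integral_cmult nn_integral_add)
  also have "\<dots> = ennreal (2 powr p * 2) * (\<integral>\<^sup>+y. indicator B y * diff_energy p f y \<partial>lborel)"
    unfolding r by (simp add: ennreal_mult mult_2 distrib_left distrib_right mult.assoc)
  also have "\<dots> \<le> ennreal (2 powr p * 2) * (\<integral>\<^sup>+y. indicator (ball 0 (norm h)) y * diff_energy p f y \<partial>lborel)"
    using sub by (intro mult_left_mono nn_integral_mono) (auto simp: indicator_def)
  finally have "ennreal (2 ^ DIM('a)) * (diff_energy p f h * emeasure lborel B)
    \<le> ennreal (2 ^ DIM('a)) * (ennreal (2 powr p * 2) * (\<integral>\<^sup>+y. indicator (ball 0 (norm h)) y * diff_energy p f y \<partial>lborel))"
    by (rule mult_left_mono) simp
  then show ?thesis unfolding emB by (simp add: ennreal_mult ac_simps)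
qed

section \<open>The volume inequality\<close>

lemma lebesgue_measurable_translate:
  "(\<lambda>x::'a::euclidean_space. x + h) \<in> lebesgue \<rightarrow>\<^sub>M lebesgue"
proof -
  have "(\<lambda>x::'a. h + (\<Sum>j\<in>Basis. (1 * (x \<bullet> j)) *\<^sub>R j)) \<in> lebesgue \<rightarrow>\<^sub>M lebesgue"
    by (rule lebesgue_affine_measurable) simp
  then show ?thesis by (simp add: euclidean_representation add.commute)
qed

text \<open>Passes to a Borel representative, on which the product-measure arguments run. Finiteness
  is not assumed: for a non-integrable power the Bochner integral and \<open>enn2real\<close> of the
  infinite integral are both 0.\<close>

lemma gauge_pow_eq_frac_gauge:
  fixes f f' :: "'a::euclidean_space \<Rightarrow> real"
  assumes f [measurable]: "f \<in> borel_measurable lebesgue" and f' [measurable]: "f' \<in> borel_measurable borel"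
    and eq: "AE x in lborel. f x = f' x"
  shows "gauge_pow s p q f = frac_gauge (s * q) (q / p) (\<lambda>h. enn2real (diff_energy p f' h))"
proof -
  have int: "(\<integral>x. \<bar>Delta h f x\<bar> powr p \<partial>lebesgue) = enn2real (diff_energy p f' h)" for h
  proof -
    have [measurable]: "(\<lambda>x. f (x + h)) \<in> borel_measurable lebesgue"
      using measurable_compose[OF lebesgue_measurable_translate f] .
    have "(\<integral>x. \<bar>Delta h f x\<bar> powr p \<partial>lebesgue) = enn2real (\<integral>\<^sup>+x. ennreal (\<bar>f (x + h) - f x\<bar> powr p) \<partial>lebesgue)"
      unfolding Delta_def by (rule integral_eq_nn_integral) auto
    also have "(\<integral>\<^sup>+x. ennreal (\<bar>f (x + h) - f x\<bar> powr p) \<partial>lebesgue) = (\<integral>\<^sup>+x. ennreal (\<bar>f' (x + h) - f' x\<bar> powr p) \<partial>lebesgue)"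
    proof (rule nn_integral_cong_AE)
      have "AE x in lborel. f (x + h) = f' (x + h)" by (rule AE_lborel_translate[OF eq])
      with eq have "AE x in lborel. ennreal (\<bar>f (x + h) - f x\<bar> powr p) = ennreal (\<bar>f' (x + h) - f' x\<bar> powr p)"
        by eventually_elim simp
      then show "AE x in lebesgue. ennreal (\<bar>f (x + h) - f x\<bar> powr p) = ennreal (\<bar>f' (x + h) - f' x\<bar> powr p)"
        by (rule AE_completion)
    qed
    also have "\<dots> = diff_energy p f' h" unfolding diff_energy_def by (rule nn_integral_completion)
    finally show ?thesis .
  qed
  show ?thesis
    unfolding gauge_pow_def[abs_def] frac_gauge_def[abs_def] Lp_norm_def int by (simp add: powr_powr)
qed

lemma volPiStar_eq:
  fixes f f' :: "'a::euclidean_space \<Rightarrow> real"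
  assumes "f \<in> borel_measurable lebesgue" "f' \<in> borel_measurable borel" "AE x in lborel. f x = f' x"
  shows "volPiStar s p q f
    = emeasure lborel {z. frac_gauge (s * q) (q / p) (\<lambda>h. enn2real (diff_energy p f' h)) z \<le> 1}"
proof -
  have [measurable]: "f' \<in> borel_measurable borel" by fact
  have "{z. frac_gauge (s * q) (q / p) (\<lambda>h. enn2real (diff_energy p f' h)) z \<le> 1} \<in> sets borel" by measurable
  then show ?thesis
    unfolding volPiStar_def PiStar_def gauge_pow_eq_frac_gauge[OF assms] by simp
qed

text \<open>The equality is everywhere, not just almost everywhere, because \<open>sym_set\<close>
  depends only on the measure of a level set.\<close>

lemma schwarz_cong_AE:
  fixes f f' :: "'a::euclidean_space \<Rightarrow> real"
  assumes [measurable]: "f \<in> borel_measurable lebesgue" "f' \<in> borel_measurable borel" and eq: "AE x in lborel. f x = f' x"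
  shows "schwarz f = schwarz f'"
proof -
  have [measurable]: "f' \<in> borel_measurable lebesgue" using assms(2) by (simp add: measurable_completion)
  have "emeasure lebesgue {y. t \<le> \<bar>f y\<bar>} = emeasure lebesgue {y. t \<le> \<bar>f' y\<bar>}" for t
  proof (rule emeasure_eq_AE)
    show "AE x in lebesgue. x \<in> {y. t \<le> \<bar>f y\<bar>} \<longleftrightarrow> x \<in> {y. t \<le> \<bar>f' y\<bar>}"
      by (rule AE_completion) (use eq in \<open>eventually_elim, simp\<close>)
    have "{y \<in> space lebesgue. t \<le> \<bar>f y\<bar>} \<in> sets lebesgue" "{y \<in> space lebesgue. t \<le> \<bar>f' y\<bar>} \<in> sets lebesgue" by measurable
    then show "{y. t \<le> \<bar>f y\<bar>} \<in> sets lebesgue" "{y. t \<le> \<bar>f' y\<bar>} \<in> sets lebesgue" by simp_all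
  qed
  then have "sym_set {y. t \<le> \<bar>f y\<bar>} = sym_set {y. t \<le> \<bar>f' y\<bar>}" for t
    unfolding sym_set_def by simp
  then show ?thesis unfolding schwarz_def[abs_def] by simp
qed

text \<open>The factor in front of \<open>V\<close> is the \<open>k\<close> with
  \<open>k powr (- b) = C\<close>, and negative powers reverse the order. The extreme values agree
  with the convention: \<open>V = 0\<close> makes the right side infinite, and
  \<open>V = \<infinity>\<close> forces \<open>V' = \<infinity>\<close>.\<close>

lemma neg_pow_le_mult:
  assumes b: "0 < b" and C: "0 < C" and le: "ennreal (C powr (- (1 / b))) * V \<le> V'"
  shows "neg_pow V' b \<le> ennreal C * neg_pow V b"
proof -
  define k where "k = C powr (- (1 / b))"
  have k: "0 < k" unfolding k_def using C by simp
  have kb: "k powr (- b) = C" unfolding k_def using b C by (simp add: powr_powr)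
  consider "V = 0" | "V = \<infinity>" | v where "V = ennreal v" "0 < v"
    by (cases V) (auto simp: order_le_less)
  then show ?thesis
  proof cases
    case 1
    then show ?thesis using C by (simp add: neg_pow_def ennreal_mult_top)
  next
    case 2
    then have "V' = \<infinity>" using le k unfolding k_def[symmetric] by (simp add: ennreal_mult_top top_unique)
    then show ?thesis by (simp add: neg_pow_def)
  next
    case 3
    then have kv: "ennreal (k * v) \<le> V'" using le k unfolding k_def[symmetric] by (simp add: ennreal_mult)
    show ?thesis
    proof (cases V')
      case (real w)
      have w: "k * v \<le> w" using kv real k 3 by (simp add: ennreal_le_iff)
      have w0: "0 < w" using w k 3 by (smt (verit) mult_pos_pos)
      have "w powr (- b) \<le> (k * v) powr (- b)"
        using w k 3 b by (intro powr_mono2') auto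
      also have "\<dots> = C * v powr (- b)" using k 3 kb by (simp add: powr_mult)
      finally have "ennreal (w powr (- b)) \<le> ennreal (C * v powr (- b))" by (rule ennreal_leI)
      then show ?thesis using real w0 3 C by (simp add: neg_pow_def ennreal_mult)
    next
      case top
      then show ?thesis by (simp add: neg_pow_def)
    qed
  qed
qed

theorem mainTheorem14:
  fixes f :: "'a::euclidean_space \<Rightarrow> real" and s p q :: real
  assumes "0 < s" "s < 1" "1 \<le> p" "1 \<le> q" and "in_Lp p f"
  shows "neg_pow (volPiStar s p q (schwarz f)) (s * q / DIM('a))
           \<le> ennreal (4 powr q * (2 ^ DIM('a) + 1) powr (max (q / p) 1))
             * neg_pow (volPiStar s p q f) (s * q / DIM('a))
         \<and> (p = q \<longrightarrow> neg_pow (volPiStar s p q (schwarz f)) (s * q / DIM('a))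
           \<le> neg_pow (volPiStar s p q f) (s * q / DIM('a)))"
proof -
  define a where "a = s * q"
  define \<theta> where "\<theta> = q / p"
  define b where "b = a / DIM('a)"
  have a: "0 < a" and b: "0 < b" and \<theta>0: "0 < \<theta>" unfolding a_def b_def \<theta>_def using assms by auto
  have p: "1 \<le> p" by fact
  have fleb: "f \<in> borel_measurable lebesgue" and fint: "integrable lebesgue (\<lambda>x. \<bar>f x\<bar> powr p)"
    using assms(5) by (auto simp: in_Lp_def)
  obtain g where g [measurable]: "g \<in> borel_measurable borel" and eq: "AE x in lborel. f x = g x"
    using completion_ex_borel_measurable_real[OF fleb] by auto
  have gfin: "(\<integral>\<^sup>+x. ennreal (\<bar>g x\<bar> powr p) \<partial>lborel) < \<infinity>"
  proof -
    have "(\<integral>\<^sup>+x. ennreal (\<bar>g x\<bar> powr p) \<partial>lborel) = (\<integral>\<^sup>+x. ennreal (\<bar>f x\<bar> powr p) \<partial>lborel)"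
      using eq by (intro nn_integral_cong_AE) auto
    also have "\<dots> = (\<integral>\<^sup>+x. ennreal (\<bar>f x\<bar> powr p) \<partial>lebesgue)" by (rule nn_integral_completion[symmetric])
    also have "\<dots> < \<infinity>" using fint by (simp add: integrable_iff_bounded)
    finally show ?thesis .
  qed
  define F where "F = schwarz f"
  have FG: "F = schwarz g" unfolding F_def by (rule schwarz_cong_AE[OF fleb g eq])
  have sym: "symmetrization_of F g" unfolding FG by (rule schwarz_symmetrization[OF g p gfin])
  then have F [measurable]: "F \<in> borel_measurable borel" and F0: "\<And>x. 0 \<le> F x"
    by (auto simp: symmetrization_of_def)
  have Ffin: "(\<integral>\<^sup>+x. ennreal (\<bar>F x\<bar> powr p) \<partial>lborel) < \<infinity>"
    using symmetrization_nn_integral_powr[OF g p sym] gfin F0 by simp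
  have fin: "diff_energy p u h < \<infinity>" if "u \<in> borel_measurable borel" "(\<integral>\<^sup>+x. ennreal (\<bar>u x\<bar> powr p) \<partial>lborel) < \<infinity>"
    for u :: "'a \<Rightarrow> real" and h
    using diff_energy_bound[OF that(1) p, of h] that(2)
    by (elim le_less_trans) (simp add: ennreal_mult_less_top)
  define \<phi> where "\<phi> = (\<lambda>h. enn2real (diff_energy p g h))"
  define \<psi> where "\<psi> = (\<lambda>h. enn2real (diff_energy p F h))"
  have [measurable]: "\<phi> \<in> borel_measurable borel" "\<psi> \<in> borel_measurable borel"
    unfolding \<phi>_def \<psi>_def by measurable
  have e\<phi>: "ennreal (\<phi> h) = diff_energy p g h" and e\<psi>: "ennreal (\<psi> h) = diff_energy p F h" for h
    unfolding \<phi>_def \<psi>_def using fin[OF g gfin, of h] fin[OF F Ffin, of h] by auto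
  have nonneg: "\<And>h. 0 \<le> \<phi> h" "\<And>h. 0 \<le> \<psi> h" unfolding \<phi>_def \<psi>_def by auto
  have dom: "rearr_dom (\<lambda>h. ennreal (\<psi> h)) (\<lambda>h. ennreal (\<phi> h))"
    unfolding e\<phi> e\<psi> by (rule rearr_domI) (rule diff_energy_riesz[OF g p gfin sym])
  define V where "V = volPiStar s p q f"
  define V' where "V' = volPiStar s p q F"
  have V: "V = emeasure lborel {z. frac_gauge a \<theta> \<phi> z \<le> 1}"
    unfolding V_def volPiStar_eq[OF fleb g eq] a_def \<theta>_def \<phi>_def ..
  have V': "V' = emeasure lborel {z. frac_gauge a \<theta> \<psi> z \<le> 1}"
  proof -
    have "F \<in> borel_measurable lebesgue" using F by (simp add: measurable_completion)
    then show ?thesis unfolding V'_def using volPiStar_eq[of F F s p q] F by (simp add: a_def \<theta>_def \<psi>_def)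
  qed
  \<comment> \<open>The case \<open>q = p\<close> is included, so this one claim serves both the
    second conjunct and half of the first.\<close>
  have small: "neg_pow V' b \<le> neg_pow V b" if "q \<le> p"
  proof -
    have "\<theta> \<le> 1" unfolding \<theta>_def using that p by simp
    then have "rearr_dom (\<lambda>h. ennreal (\<psi> h powr \<theta>)) (\<lambda>h. ennreal (\<phi> h powr \<theta>))"
      using nonneg dom \<theta>0 by (intro rearr_dom_powr) auto
    then have "rearr_dom (frac_gauge a \<theta> \<psi>) (frac_gauge a \<theta> \<phi>)" by (intro rearr_dom_frac_gauge) auto
    then have "V \<le> V'" unfolding V V'
      by (intro sublevel_volume_mono[OF _ _ homogeneous_frac_gauge homogeneous_frac_gauge a]) auto
    then show ?thesis using neg_pow_le_mult[OF b, of 1 V V'] by simp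
  qed
  define C where "C = 4 powr q * (2 ^ DIM('a) + 1) powr (max (q / p) 1)"
  have "neg_pow V' b \<le> ennreal C * neg_pow V b"
  proof (cases "q \<le> p")
    case True
    have "1 \<le> (4::real) powr q" "1 \<le> (2 ^ DIM('a) + 1 :: real) powr (max (q / p) 1)"
      using assms by (auto intro!: ge_one_powr_ge_zero)
    then have "1 \<le> C" unfolding C_def by (metis mult_mono' mult_1 zero_le_one)
    then have "1 * neg_pow V b \<le> ennreal C * neg_pow V b"
      by (intro mult_right_mono) (auto simp flip: ennreal_1 intro!: ennreal_leI)
    then show ?thesis using small[OF True] by simp
  next
    case False
    then have \<theta>1: "1 \<le> \<theta>" unfolding \<theta>_def using p by simp
    \<comment> \<open>\<open>2 powr p\<close> is the price of splitting a difference, 2 counts its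
      two halves, and \<open>2 ^ DIM('a)\<close> is the ratio of the volumes of the two balls in
      \<open>diff_energy_le_average\<close>.\<close>
    define D where "D = 2 powr p * 2 * 2 ^ DIM('a)"
    have D: "0 < D" unfolding D_def by simp
    have psi_zero: "\<psi> 0 = 0" unfolding \<psi>_def diff_energy_def by simp
    define B where "B = enn2real (ennreal (2 powr p) * (2 * (\<integral>\<^sup>+x. ennreal (\<bar>F x\<bar> powr p) \<partial>lborel)))"
    have bdd: "\<psi> h \<le> B" for h
      unfolding \<psi>_def B_def using diff_energy_bound[OF F p, of h] Ffin
      by (intro enn2real_mono) (auto simp: ennreal_mult_less_top)
    have "ennreal ((D powr \<theta>) powr (- (DIM('a) / a))) * V \<le> V'"
      unfolding V V' using nonneg dom \<theta>1 a D psi_zero bdd diff_energy_le_average[OF F p]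
      by (intro sublevel_volume_radial[where b = B]) (auto simp: e\<psi> D_def)
    then have "neg_pow V' b \<le> ennreal (D powr \<theta>) * neg_pow V b"
      using D a by (intro neg_pow_le_mult[OF b]) (auto simp: b_def)
    also have "\<dots> \<le> ennreal C * neg_pow V b"
    proof (intro mult_right_mono ennreal_leI)
      have "D powr \<theta> = (2 powr (p + 1)) powr \<theta> * (2 ^ DIM('a)) powr \<theta>"
        unfolding D_def by (simp add: powr_mult powr_add)
      also have "(2 powr (p + 1)) powr \<theta> = 2 powr ((p + 1) * \<theta>)" by (simp add: powr_powr)
      \<comment> \<open>Here \<open>1 \<le> p\<close> enters through \<open>q / p \<le> q\<close>;
        this is the origin of \<open>4 powr q\<close>.\<close>
      also have "\<dots> \<le> 2 powr (2 * q)"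
      proof (rule powr_mono)
        have "q / p \<le> q" using p assms by (simp add: field_simps)
        then show "(p + 1) * \<theta> \<le> 2 * q" unfolding \<theta>_def using p by (simp add: field_simps)
      qed simp
      also have "2 powr (2 * q) = 4 powr q" using powr_powr[of 2 2 q] by simp
      finally have "D powr \<theta> \<le> 4 powr q * (2 ^ DIM('a)) powr \<theta>" by (simp add: mult_right_mono)
      \<comment> \<open>The argument yields \<open>2 ^ DIM('a)\<close>; it is enlarged to the stated
        \<open>2 ^ DIM('a) + 1\<close>.\<close>
      also have "\<dots> \<le> 4 powr q * (2 ^ DIM('a) + 1) powr \<theta>"
        using \<theta>0 by (intro mult_left_mono powr_mono2) auto
      finally have "D powr \<theta> \<le> 4 powr q * (2 ^ DIM('a) + 1) powr \<theta>" .
      moreover have "max (q / p) 1 = \<theta>" using \<theta>1 by (simp add: \<theta>_def)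
      ultimately show "D powr \<theta> \<le> C" unfolding C_def by simp
    qed simp
    finally show ?thesis .
  qed
  then show ?thesis
    using small unfolding C_def V_def V'_def F_def b_def a_def by auto
qed

end
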